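(* Let $b,\omega:\mathbb{R}\to\mathbb{R}^+$ be continuous functions such that $0<b_0\le b(t)\le b_1$ and $0\le\omega_0\le\omega(t)\le\omega_1$ for all $t\in\mathbb{R}$, with $\omega_1<\pi^2$, and such that $b(t)\to b_\infty\in[b_0,b_1]$ and $\omega(t)\to\omega_\infty\in[\omega_0,\omega_1]$ as $t\to+\infty$. Let $H^+=\{v\in L^2(0,1):v(x)\ge0\text{ for a.a. }x\in(0,1)\}$. Let $\mathcal{A}^+=\{\mathcal{A}^+(t)\}_{t\in\mathbb{R}}$ be the pullback attractor of the multivalued process $U^+$ on $H^+$ generated by all non-negative strong solutions of $$\frac{\partial u}{\partial t}-\frac{\partial^2u}{\partial x^2}\in b(t)H_0(u)+\omega(t)u\ \text{ on }(\tau,\infty)\times(0,1),\qquad u(t,0)=u(t,1)=0,\qquad u(\tau,x)=u_\tau(x),$$ where $H_0(u)=\{1\}$ if $u>0$, $H_0(0)=[-1,1]$, $H_0(u)=\{-1\}$ if $u<0$. Let $\mathcal{A}_\infty^+$ be the global attractor of the multivalued semiflow $G$ on $H^+$ generated by all non-negative strong solutions (with $\tau=0$) of the autonomous problem in which $b(t),\omega(t)$ are replaced by the constants $b_\infty,\omega_\infty$. Then $$\lim_{t\to+\infty}dist_H(\mathcal{A}^+(t),\mathcal{A}_\infty^+)=0.$$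
   Context: Let $H=L^2(0,1)$ with norm $\|\cdot\|$, and $A=-\frac{d^2}{dx^2}$ with $D(A)=H^2(0,1)\cap H_0^1(0,1)$. A strong solution with $u_\tau\in H$ is $u\in C([\tau,+\infty),H)$ with $u(\tau)=u_\tau$, absolutely continuous on $[T_1,T_2]$ for all $\tau<T_1<T_2$, $u(t)\in D(A)$ for a.a. $t\in(T_1,T_2)$, and such that there is $r\in L^2_{loc}([\tau,+\infty);H)$ with $r(t,x)\in b(t)H_0(u(t,x))$ for a.a. $(t,x)\in(\tau,+\infty)\times(0,1)$ and $\frac{du}{dt}+Au(t)=r(t)+\omega(t)u(t)$ in $H$ for a.a. $t>\tau$. It is non-negative if $u(t)\in H^+$ for all $t\ge\tau$. $U^+(t,\tau,u_\tau)$ is the set of values $u(t)$ of all non-negative strong solutions with $u(\tau)=u_\tau\in H^+$; $G(t,u_0)$ is the set of values $u(t)$ of all non-negative strong solutions of the autonomous problem with $u(0)=u_0\in H^+$. Images of sets are unions of images of points. The phase space is $H^+$ with the metric of $H$; $dist(A,B)=\sup_{y\in A}\inf_{x\in B}\|y-x\|$ and $dist_H(A,B)=\max\{dist(A,B),dist(B,A)\}$. The pullback attractor is the family of non-empty compact negatively invariant sets ($\mathcal{A}^+(t)\subset U^+(t,s,\mathcal{A}^+(s))$ for $t\ge s$) which is the minimal family of closed sets satisfying $dist(U^+(t,t_0,B),\mathcal{A}^+(t))\to0$ as $t_0\to-\infty$ for every bounded $B\subset H^+$ and every fixed $t$. The global attractor of $G$ is the compact set with $\mathcal{A}_\infty^+\subset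 G(t,\mathcal{A}_\infty^+)$ for $t\ge0$ and $dist(G(t,B),\mathcal{A}_\infty^+)\to0$ as $t\to+\infty$ for every bounded $B\subset H^+$. Both are known to exist. *)

theory Defs
  imports "HOL-Analysis.Analysis"
begin

section \<open>The Hilbert space of square-integrable functions on the unit interval\<close>

text \<open>
  Representatives are Borel measurable. As every Lebesgue measurable function agrees almost
  everywhere with a Borel measurable one, the quotient is the usual space.
\<close>

abbreviation unit_measure :: "real measure" where
  "unit_measure \<equiv> restrict_space lborel {0<..<1}"

definition square_int :: "(real \<Rightarrow> real) \<Rightarrow> bool" where
  "square_int f \<longleftrightarrow> f \<in> borel_measurable unit_measure \<and> integrable unit_measure (\<lambda>x. (f x)\<^sup>2)"

definition L2_rel :: "(real \<Rightarrow> real) \<Rightarrow> (real \<Rightarrow> real) \<Rightarrow> bool" where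
  "L2_rel f g \<longleftrightarrow> square_int f \<and> square_int g \<and> (AE x in unit_measure. f x = g x)"

lemma square_int_zero: "square_int (\<lambda>_. 0)"
  by (simp add: square_int_def)

lemma part_equivp_L2_rel: "part_equivp L2_rel"
proof (rule part_equivpI)
  show "\<exists>f. L2_rel f f"
    using square_int_zero by (auto simp: L2_rel_def)
  show "symp L2_rel"
    by (rule sympI) (auto simp: L2_rel_def)
  show "transp L2_rel"
    by (rule transpI) (auto simp: L2_rel_def)
qed

quotient_type L2 = "real \<Rightarrow> real" / partial: L2_rel
  by (rule part_equivp_L2_rel)

lemma square_int_mult:
  assumes "square_int f" "square_int g"
  shows "integrable unit_measure (\<lambda>x. f x * g x)"
proof (rule Bochner_Integration.integrable_bound)
  show "integrable unit_measure (\<lambda>x. (f x)\<^sup>2 + (g x)\<^sup>2)"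
    using assms by (auto simp: square_int_def)
  show "(\<lambda>x. f x * g x) \<in> borel_measurable unit_measure"
    using assms by (auto simp: square_int_def)
  have "norm (f x * g x) \<le> norm ((f x)\<^sup>2 + (g x)\<^sup>2)" for x
  proof -
    have "2 * \<bar>f x\<bar> * \<bar>g x\<bar> \<le> \<bar>f x\<bar>\<^sup>2 + \<bar>g x\<bar>\<^sup>2"
      by (rule sum_squares_bound)
    moreover have "0 \<le> \<bar>f x\<bar> * \<bar>g x\<bar>" by (rule mult_nonneg_nonneg) auto
    ultimately have "\<bar>f x\<bar> * \<bar>g x\<bar> \<le> \<bar>f x\<bar>\<^sup>2 + \<bar>g x\<bar>\<^sup>2" by linarith
    then show ?thesis by (simp add: abs_mult)
  qed
  then show "AE x in unit_measure. norm (f x * g x) \<le> norm ((f x)\<^sup>2 + (g x)\<^sup>2)"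
    by simp
qed

lemma square_int_scale: "square_int f \<Longrightarrow> square_int (\<lambda>x. c * f x)"
  by (auto simp: square_int_def power_mult_distrib)

lemma square_int_add:
  assumes "square_int f" "square_int g"
  shows "square_int (\<lambda>x. f x + g x)"
proof -
  have "integrable unit_measure (\<lambda>x. (f x)\<^sup>2 + (g x)\<^sup>2 + 2 * (f x * g x))"
    using assms square_int_mult[OF assms] by (auto simp: square_int_def)
  then show ?thesis
    using assms by (auto simp: square_int_def power2_sum mult.assoc)
qed

lemma square_int_uminus: "square_int f \<Longrightarrow> square_int (\<lambda>x. - f x)"
  by (auto simp: square_int_def)

lemma square_int_diff: "square_int f \<Longrightarrow> square_int g \<Longrightarrow> square_int (\<lambda>x. f x - g x)"
  using square_int_add[of f "\<lambda>x. - g x"] square_int_uminus[of g] by simp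

instantiation L2 :: real_vector
begin

lift_definition zero_L2 :: L2 is "\<lambda>_. 0"
  by (simp add: L2_rel_def square_int_zero)

lift_definition plus_L2 :: "L2 \<Rightarrow> L2 \<Rightarrow> L2" is "\<lambda>f g x. f x + g x"
  by (auto simp: L2_rel_def square_int_add)

lift_definition minus_L2 :: "L2 \<Rightarrow> L2 \<Rightarrow> L2" is "\<lambda>f g x. f x - g x"
  by (auto simp: L2_rel_def square_int_diff)

lift_definition uminus_L2 :: "L2 \<Rightarrow> L2" is "\<lambda>f x. - f x"
  by (auto simp: L2_rel_def square_int_uminus)

lift_definition scaleR_L2 :: "real \<Rightarrow> L2 \<Rightarrow> L2" is "\<lambda>c f x. c * f x"
  by (auto simp: L2_rel_def square_int_scale)

instance
  by standard
    (transfer; force simp: L2_rel_def square_int_zero square_int_add square_int_diff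
      square_int_uminus square_int_scale algebra_simps)+

end

instantiation L2 :: real_inner
begin

lift_definition inner_L2 :: "L2 \<Rightarrow> L2 \<Rightarrow> real" is
  "\<lambda>f g. \<integral>x. f x * g x \<partial>unit_measure"
proof -
  fix f f' g g' assume "L2_rel f f'" "L2_rel g g'"
  then show "(\<integral>x. f x * g x \<partial>unit_measure) = (\<integral>x. f' x * g' x \<partial>unit_measure)"
    by (intro integral_cong_AE) (auto simp: L2_rel_def square_int_def)
qed

definition norm_L2 :: "L2 \<Rightarrow> real" where "norm_L2 v = sqrt (inner v v)"
definition dist_L2 :: "L2 \<Rightarrow> L2 \<Rightarrow> real" where "dist_L2 v w = norm (v - w)"
definition sgn_L2 :: "L2 \<Rightarrow> L2" where "sgn_L2 v = v /\<^sub>R norm v"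
definition uniformity_L2 :: "(L2 \<times> L2) filter" where
  "uniformity_L2 = (INF e\<in>{0<..}. principal {(v, w). dist v w < e})"
definition open_L2 :: "L2 set \<Rightarrow> bool" where
  "open_L2 U \<longleftrightarrow> (\<forall>v\<in>U. \<forall>\<^sub>F (v', w) in uniformity. v' = v \<longrightarrow> w \<in> U)"

instance
proof
  fix u v w :: L2 and c :: real
  show "dist u v = norm (u - v)" by (rule dist_L2_def)
  show "sgn u = u /\<^sub>R norm u" by (rule sgn_L2_def)
  show "(uniformity :: (L2 \<times> L2) filter) = (INF e\<in>{0<..}. principal {(v, w). dist v w < e})"
    by (rule uniformity_L2_def)
  show "open U \<longleftrightarrow> (\<forall>v\<in>U. \<forall>\<^sub>F (v', w) in uniformity. v' = v \<longrightarrow> w \<in> U)" for U :: "L2 set"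
    by (rule open_L2_def)
  show "norm u = sqrt (inner u u)" by (rule norm_L2_def)
  show "inner u v = inner v u"
    by transfer (simp add: mult.commute)
  show "inner (u + v) w = inner u w + inner v w"
    by transfer (simp add: L2_rel_def distrib_right square_int_mult)
  show "inner (c *\<^sub>R u) v = c * inner u v"
    by transfer (simp add: mult.assoc)
  show "0 \<le> inner u u"
    by transfer simp
  show "inner u u = 0 \<longleftrightarrow> u = 0"
  proof transfer
    fix f assume "L2_rel f f"
    then have "square_int f" by (simp add: L2_rel_def)
    then have "(\<integral>x. f x * f x \<partial>unit_measure) = 0 \<longleftrightarrow> (AE x in unit_measure. f x * f x = 0)"
      by (intro integral_nonneg_eq_0_iff_AE square_int_mult) auto
    with \<open>square_int f\<close> show "(\<integral>x. f x * f x \<partial>unit_measure) = 0 \<longleftrightarrow> L2_rel f (\<lambda>_. 0)"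
      by (simp add: L2_rel_def square_int_zero)
  qed
qed

end

definition L2_of :: "(real \<Rightarrow> real) \<Rightarrow> L2" where
  "L2_of f = abs_L2 f"

definition represents :: "(real \<Rightarrow> real) \<Rightarrow> L2 \<Rightarrow> bool" where
  "represents f v \<longleftrightarrow> square_int f \<and> L2_of f = v"

lift_definition nonneg_L2 :: "L2 \<Rightarrow> bool" is "\<lambda>f. AE x in unit_measure. 0 \<le> f x"
proof -
  fix f g assume "L2_rel f g"
  then have "AE x in unit_measure. f x = g x" by (simp add: L2_rel_def)
  then have "AE x in unit_measure. 0 \<le> f x \<longleftrightarrow> 0 \<le> g x" by eventually_elim simp
  then show "(AE x in unit_measure. 0 \<le> f x) \<longleftrightarrow> (AE x in unit_measure. 0 \<le> g x)"
    by (rule eventually_subst)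
qed

definition H_pos :: "L2 set" where
  "H_pos = {v. nonneg_L2 v}"


section \<open>Sobolev spaces and the Dirichlet Laplacian\<close>

definition test_function :: "(real \<Rightarrow> real) \<Rightarrow> bool" where
  "test_function \<phi> \<longleftrightarrow>
     (\<forall>n x. (deriv ^^ n) \<phi> field_differentiable (at x)) \<and>
     compact (closure {x. \<phi> x \<noteq> 0}) \<and> closure {x. \<phi> x \<noteq> 0} \<subseteq> {0<..<1}"

definition has_weak_deriv :: "L2 \<Rightarrow> L2 \<Rightarrow> bool" where
  "has_weak_deriv v w \<longleftrightarrow>
     (\<forall>\<phi>. test_function \<phi> \<longrightarrow> inner v (L2_of (deriv \<phi>)) = - inner w (L2_of \<phi>))"

definition weak_deriv :: "L2 \<Rightarrow> L2" where
  "weak_deriv v = (THE w. has_weak_deriv v w)"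

definition H1 :: "L2 set" where
  "H1 = {v. \<exists>w. has_weak_deriv v w}"

definition H2 :: "L2 set" where
  "H2 = {v \<in> H1. weak_deriv v \<in> H1}"

definition H1_norm :: "L2 \<Rightarrow> real" where
  "H1_norm v = sqrt ((norm v)\<^sup>2 + (norm (weak_deriv v))\<^sup>2)"

text \<open>The closure of the test functions in the norm of \<open>H1\<close>.\<close>

definition H1_0 :: "L2 set" where
  "H1_0 = {v \<in> H1. \<forall>\<epsilon>>0. \<exists>\<phi>. test_function \<phi> \<and> H1_norm (v - L2_of \<phi>) < \<epsilon>}"

definition dom_A :: "L2 set" where
  "dom_A = H2 \<inter> H1_0"

definition op_A :: "L2 \<Rightarrow> L2" where
  "op_A v = - weak_deriv (weak_deriv v)"


section \<open>Strong solutions\<close>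

definition H_0 :: "real \<Rightarrow> real set" where
  "H_0 u = (if u > 0 then {1} else if u = 0 then {-1..1} else {-1})"

definition abs_continuous_on :: "real \<Rightarrow> real \<Rightarrow> (real \<Rightarrow> 'a::metric_space) \<Rightarrow> bool" where
  "abs_continuous_on a b u \<longleftrightarrow>
     (\<forall>\<epsilon>>0. \<exists>\<delta>>0. \<forall>(n::nat) (p::nat \<Rightarrow> real) q.
        (\<forall>i<n. a \<le> p i \<and> p i \<le> q i \<and> q i \<le> b) \<and>
        disjoint_family_on (\<lambda>i. {p i<..<q i}) {..<n} \<and>
        (\<Sum>i<n. q i - p i) < \<delta>
        \<longrightarrow> (\<Sum>i<n. dist (u (p i)) (u (q i))) < \<epsilon>)"

text \<open>
  \<open>L2\<close> is separable, so Borel measurability of \<open>r\<close> coincides with strong measurability.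
\<close>

definition L2_loc :: "real \<Rightarrow> (real \<Rightarrow> L2) \<Rightarrow> bool" where
  "L2_loc \<tau> r \<longleftrightarrow>
     r \<in> borel_measurable (restrict_space lborel {\<tau>..}) \<and>
     (\<forall>T>\<tau>. set_integrable lborel {\<tau>..T} (\<lambda>t. (norm (r t))\<^sup>2))"

text \<open>
  A statement about \<open>u(t,x)\<close> for almost all \<open>(t,x)\<close> refers to a jointly measurable
  representative of the curve \<open>u\<close>; such a representative is unique up to null sets of the plane.
  Picking a representative of \<open>u t\<close> separately for each \<open>t\<close> would not guarantee joint measurability.
\<close>

definition joint_representative :: "real \<Rightarrow> (real \<times> real \<Rightarrow> real) \<Rightarrow> (real \<Rightarrow> L2) \<Rightarrow> bool" where
  "joint_representative \<tau> f u \<longleftrightarrow>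
     f \<in> borel_measurable (restrict_space lborel ({\<tau><..} \<times> {0<..<1})) \<and>
     (AE t in lborel. t > \<tau> \<longrightarrow> represents (\<lambda>x. f (t, x)) (u t))"

definition selection_of_H_0 ::
    "(real \<Rightarrow> real) \<Rightarrow> real \<Rightarrow> (real \<Rightarrow> L2) \<Rightarrow> (real \<Rightarrow> L2) \<Rightarrow> bool" where
  "selection_of_H_0 b \<tau> u r \<longleftrightarrow>
     (\<exists>uf rf. joint_representative \<tau> uf u \<and> joint_representative \<tau> rf r \<and>
        (AE (t, x) in lborel. t > \<tau> \<and> 0 < x \<and> x < 1 \<longrightarrow>
           rf (t, x) \<in> (\<lambda>z. b t * z) ` H_0 (uf (t, x))))"

definition strong_solution ::
    "(real \<Rightarrow> real) \<Rightarrow> (real \<Rightarrow> real) \<Rightarrow> real \<Rightarrow> (real \<Rightarrow> L2) \<Rightarrow> bool" where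
  "strong_solution b \<omega> \<tau> u \<longleftrightarrow>
     continuous_on {\<tau>..} u \<and>
     (\<forall>T1 T2. \<tau> < T1 \<and> T1 < T2 \<longrightarrow>
        abs_continuous_on T1 T2 u \<and>
        (AE t in lborel. t \<in> {T1<..<T2} \<longrightarrow> u t \<in> dom_A)) \<and>
     (\<exists>r. L2_loc \<tau> r \<and> selection_of_H_0 b \<tau> u r \<and>
        (AE t in lborel. t > \<tau> \<longrightarrow>
           (\<exists>u'. (u has_vector_derivative u') (at t) \<and>
                 u' + op_A (u t) = r t + \<omega> t *\<^sub>R u t)))"

definition nonneg_strong_solution ::
    "(real \<Rightarrow> real) \<Rightarrow> (real \<Rightarrow> real) \<Rightarrow> real \<Rightarrow> (real \<Rightarrow> L2) \<Rightarrow> bool" where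
  "nonneg_strong_solution b \<omega> \<tau> u \<longleftrightarrow>
     strong_solution b \<omega> \<tau> u \<and> (\<forall>t\<ge>\<tau>. u t \<in> H_pos)"

text \<open>Only times \<open>t \<ge> \<tau>\<close> (respectively \<open>t \<ge> 0\<close>) are meaningful here.\<close>

definition U_pos ::
    "(real \<Rightarrow> real) \<Rightarrow> (real \<Rightarrow> real) \<Rightarrow> real \<Rightarrow> real \<Rightarrow> L2 \<Rightarrow> L2 set" where
  "U_pos b \<omega> t \<tau> u\<^sub>\<tau> = {u t |u. nonneg_strong_solution b \<omega> \<tau> u \<and> u \<tau> = u\<^sub>\<tau>}"

definition G_pos :: "real \<Rightarrow> real \<Rightarrow> real \<Rightarrow> L2 \<Rightarrow> L2 set" where
  "G_pos b\<^sub>0 \<omega>\<^sub>0 t u\<^sub>0 =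
     {u t |u. nonneg_strong_solution (\<lambda>_. b\<^sub>0) (\<lambda>_. \<omega>\<^sub>0) 0 u \<and> u 0 = u\<^sub>0}"


section \<open>Attractors\<close>

text \<open>Distances take values in \<open>[0, \<infinity>]\<close>, so that suprema and infima are always meaningful.\<close>

definition semidist :: "'a::metric_space set \<Rightarrow> 'a set \<Rightarrow> ennreal" where
  "semidist A B = (SUP y\<in>A. INF x\<in>B. ennreal (dist y x))"

definition Hausdorff_dist :: "'a::metric_space set \<Rightarrow> 'a set \<Rightarrow> ennreal" where
  "Hausdorff_dist A B = max (semidist A B) (semidist B A)"

definition pullback_attracting ::
    "'a::metric_space set \<Rightarrow> (real \<Rightarrow> real \<Rightarrow> 'a \<Rightarrow> 'a set) \<Rightarrow> (real \<Rightarrow> 'a set) \<Rightarrow> bool" where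
  "pullback_attracting X U K \<longleftrightarrow>
     (\<forall>B t. B \<subseteq> X \<and> bounded B \<longrightarrow>
        ((\<lambda>t0. semidist (\<Union>v\<in>B. U t t0 v) (K t)) \<longlongrightarrow> 0) at_bot)"

definition pullback_attractor ::
    "'a::metric_space set \<Rightarrow> (real \<Rightarrow> real \<Rightarrow> 'a \<Rightarrow> 'a set) \<Rightarrow> (real \<Rightarrow> 'a set) \<Rightarrow> bool" where
  "pullback_attractor X U K \<longleftrightarrow>
     (\<forall>t. K t \<subseteq> X \<and> K t \<noteq> {} \<and> compact (K t)) \<and>
     (\<forall>s t. s \<le> t \<longrightarrow> K t \<subseteq> (\<Union>v\<in>K s. U t s v)) \<and>
     pullback_attracting X U K \<and>
     (\<forall>C. (\<forall>t. closedin (top_of_set X) (C t)) \<and> pullback_attracting X U C \<longrightarrow>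
        (\<forall>t. K t \<subseteq> C t))"

definition global_attractor ::
    "'a::metric_space set \<Rightarrow> (real \<Rightarrow> 'a \<Rightarrow> 'a set) \<Rightarrow> 'a set \<Rightarrow> bool" where
  "global_attractor X G K \<longleftrightarrow>
     K \<subseteq> X \<and> compact K \<and>
     (\<forall>t\<ge>0. K \<subseteq> (\<Union>v\<in>K. G t v)) \<and>
     (\<forall>B. B \<subseteq> X \<and> bounded B \<longrightarrow>
        ((\<lambda>t. semidist (\<Union>v\<in>B. G t v) K) \<longlongrightarrow> 0) at_top)"

end

theory Submission
  imports Defs "HOL-Complex_Analysis.Complex_Analysis"
begin

text \<open>
  On the set where a non-negative solution vanishes, its time derivative and its second space
  derivative vanish almost everywhere, hence so does the reaction term. A solution is therefore
  a supersolution of the heat equation and, once it is different from 0, it is positive almost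
  everywhere; from then on it solves the linear equation with the reaction term \<open>b t\<close>. So
  every non-negative solution stays at 0 up to some time \<open>s\<close> and then follows the linear
  solution \<open>W s t\<close>, or it starts from a non-zero value and approaches \<open>W \<tau> t\<close>
  exponentially, as \<open>\<omega>1 < \<pi>\<^sup>2\<close>. Consequently the pullback attractor at time \<open>t\<close> is the closure of
  \<open>{W s t | s \<le> t}\<close>, the global attractor is described in the same way by the autonomous
  linear problem, and the solutions of the two linear problems started from 0 at the same time
  \<open>s \<le> t\<close> are close to each other for large \<open>t\<close>, uniformly in \<open>s\<close>. Linear problems are
  solved in the basis of the functions \<open>sin (k \<pi> x)\<close>.
\<close>

section \<open>The space of square-integrable functions\<close>

text \<open>The obstacle is the multivalued reaction at 0: solutions with the same data may leave 0
  at different times, so no estimate between two arbitrary solutions can hold. Parametrizing by the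
  leaving time \<open>s\<close> removes this, since both attractors are compared through the same
  pair \<open>(s, t)\<close>; the price is that every bound has to be uniform in \<open>s\<close>,
  which is not bounded below. Strict positivity is obtained from analyticity in time instead of a
  pointwise strong maximum principle: for fixed \<open>g\<close> and \<open>f\<close> the number
  \<open>inner (heat t g) f\<close> is a power series in \<open>exp (- (pi ^ 2 * t))\<close>, which
  tolerates no accumulating zeros. Solutions are merely absolutely continuous and differentiable
  almost everywhere. Comparison is therefore obtained by testing with backward heat solutions that
  end slightly after the final time. The bound \<omega>1 < \<pi>^2 enters twice:
  \<open>decay\<close> = \<pi>^2 - \<omega>1 is the rate at which initial data are forgotten, and
  \<open>\<kappa>\<close> = 1 - \<omega>1 / \<pi>^2 yields bounds on all \<open>W s t\<close> in the
  domain of the operator, independent of \<open>s\<close> and \<open>t\<close>.\<close>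

lemma space_unit_measure [simp]: "space unit_measure = {0<..<1}"
  by (simp add: space_restrict_space)

lemma finite_measure_unit_measure: "finite_measure unit_measure"
  by (rule finite_measureI) (simp add: emeasure_restrict_space)

interpretation unit_measure: finite_measure unit_measure
  by (rule finite_measure_unit_measure)

lemma measure_unit_measure: "measure unit_measure {0<..<1} = 1"
  by (simp add: measure_restrict_space)

lemma L2_rel_refl_iff: "L2_rel f f \<longleftrightarrow> square_int f"
  by (simp add: L2_rel_def)

lemma square_int_rep: "square_int (rep_L2 v)"
  using Quotient3_rep_reflp[OF Quotient3_L2, of v] by (simp add: L2_rel_refl_iff)

lemma L2_of_rep [simp]: "L2_of (rep_L2 v) = v"
  by (simp add: L2_of_def Quotient3_abs_rep[OF Quotient3_L2])

lemma L2_of_eq_iff: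
  assumes "square_int f" "square_int g"
  shows "L2_of f = L2_of g \<longleftrightarrow> (AE x in unit_measure. f x = g x)"
  using Quotient3_rel[OF Quotient3_L2, of f g] assms
  by (auto simp: L2_of_def L2_rel_def)

lemma L2_cases: obtains f where "square_int f" "v = L2_of f"
  using square_int_rep[of v] L2_of_rep[of v] by metis

lemma inner_L2_of:
  assumes "square_int f" "square_int g"
  shows "inner (L2_of f) (L2_of g) = (\<integral>x. f x * g x \<partial>unit_measure)"
  unfolding L2_of_def using assms by (intro inner_L2.abs_eq) (simp_all add: L2_rel_refl_iff)

lemma norm_L2_of:
  assumes "square_int f"
  shows "(norm (L2_of f))\<^sup>2 = (\<integral>x. (f x)\<^sup>2 \<partial>unit_measure)"
  unfolding power2_norm_eq_inner inner_L2_of[OF assms assms] by (simp add: power2_eq_square)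

lemma L2_of_zero: "L2_of (\<lambda>_. 0) = 0"
  unfolding L2_of_def by (simp add: zero_L2.abs_eq)

lemma L2_of_add:
  "square_int f \<Longrightarrow> square_int g \<Longrightarrow> L2_of (\<lambda>x. f x + g x) = L2_of f + L2_of g"
  unfolding L2_of_def by (subst plus_L2.abs_eq) (simp_all add: L2_rel_refl_iff)

lemma L2_of_diff:
  "square_int f \<Longrightarrow> square_int g \<Longrightarrow> L2_of (\<lambda>x. f x - g x) = L2_of f - L2_of g"
  unfolding L2_of_def by (subst minus_L2.abs_eq) (simp_all add: L2_rel_refl_iff)

lemma L2_of_uminus: "square_int f \<Longrightarrow> L2_of (\<lambda>x. - f x) = - L2_of f"
  unfolding L2_of_def by (subst uminus_L2.abs_eq) (simp_all add: L2_rel_refl_iff)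

lemma L2_of_scale: "square_int f \<Longrightarrow> L2_of (\<lambda>x. c * f x) = c *\<^sub>R L2_of f"
  unfolding L2_of_def by (subst scaleR_L2.abs_eq) (simp_all add: L2_rel_refl_iff)

lemma square_int_sum:
  "(\<And>i. i \<in> I \<Longrightarrow> square_int (f i)) \<Longrightarrow> square_int (\<lambda>x. \<Sum>i\<in>I. f i x)"
  by (induction I rule: infinite_finite_induct) (auto simp: square_int_zero square_int_add)

lemma L2_of_sum:
  "(\<And>i. i \<in> I \<Longrightarrow> square_int (f i)) \<Longrightarrow> L2_of (\<lambda>x. \<Sum>i\<in>I. f i x) = (\<Sum>i\<in>I. L2_of (f i))"
  by (induction I rule: infinite_finite_induct)
    (auto simp: L2_of_zero L2_of_add square_int_sum)

lemma nonneg_L2_of: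
  "square_int f \<Longrightarrow> nonneg_L2 (L2_of f) \<longleftrightarrow> (AE x in unit_measure. 0 \<le> f x)"
  unfolding L2_of_def by (subst nonneg_L2.abs_eq) (simp_all add: L2_rel_refl_iff)

lemma square_int_measurable: "square_int f \<Longrightarrow> f \<in> borel_measurable unit_measure"
  by (simp add: square_int_def)

section \<open>Square integrability, integration on the unit interval and completeness\<close>

lemma square_int_mono:
  assumes "f \<in> borel_measurable unit_measure" "square_int g"
    and "AE x in unit_measure. \<bar>f x\<bar> \<le> \<bar>g x\<bar>"
  shows "square_int f"
proof -
  have "integrable unit_measure (\<lambda>x. (f x)\<^sup>2)"
  proof (rule Bochner_Integration.integrable_bound)
    show "integrable unit_measure (\<lambda>x. (g x)\<^sup>2)"
      using assms(2) by (simp add: square_int_def)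
    show "(\<lambda>x. (f x)\<^sup>2) \<in> borel_measurable unit_measure"
      using assms(1) by measurable
    show "AE x in unit_measure. norm ((f x)\<^sup>2) \<le> norm ((g x)\<^sup>2)"
      using assms(3) by eventually_elim (simp add: abs_le_square_iff)
  qed
  with assms(1) show ?thesis by (simp add: square_int_def)
qed

lemma square_int_const: "square_int (\<lambda>_. c)"
  by (simp add: square_int_def)

lemma square_int_bounded:
  assumes "f \<in> borel_measurable unit_measure" "\<And>x. 0 < x \<Longrightarrow> x < 1 \<Longrightarrow> \<bar>f x\<bar> \<le> C"
  shows "square_int f"
proof (rule square_int_mono[OF assms(1) square_int_const[of C]])
  show "AE x in unit_measure. \<bar>f x\<bar> \<le> \<bar>C\<bar>"
  proof (rule AE_I2)
    fix x assume "x \<in> space unit_measure"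
    then have "\<bar>f x\<bar> \<le> C" using assms(2) by simp
    then show "\<bar>f x\<bar> \<le> \<bar>C\<bar>" by linarith
  qed
qed

lemma square_int_abs: "square_int f \<Longrightarrow> square_int (\<lambda>x. \<bar>f x\<bar>)"
  by (auto simp: square_int_def)

lemma borel_measurable_unit_continuous:
  fixes f :: "real \<Rightarrow> real"
  assumes "continuous_on {0..1} f"
  shows "f \<in> borel_measurable unit_measure"
proof -
  have "continuous_on {0<..<1} f"
    using assms by (rule continuous_on_subset) auto
  then have "f \<in> borel_measurable (restrict_space borel {0<..<1})"
    by (rule borel_measurable_continuous_on_restrict)
  then show ?thesis
    by (simp cong: measurable_cong_sets add: sets_restrict_space)
qed

lemma square_int_continuous:
  fixes f :: "real \<Rightarrow> real"
  assumes "continuous_on {0..1} f"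
  shows "square_int f"
proof -
  obtain C where "\<And>x. x \<in> {0..1} \<Longrightarrow> \<bar>f x\<bar> \<le> C"
    using compact_imp_bounded[OF compact_continuous_image[OF assms compact_Icc]]
    unfolding bounded_iff by fastforce
  then show ?thesis
    by (intro square_int_bounded[of _ C] borel_measurable_unit_continuous[OF assms]) auto
qed

text \<open>The fundamental theorem of calculus is applied on the closed interval; the two endpoints
  that \<open>unit_measure\<close> leaves out form a null set.\<close>

lemma integral_derivative_unit:
  fixes F f :: "real \<Rightarrow> real"
  assumes "\<And>x. 0 \<le> x \<Longrightarrow> x \<le> 1 \<Longrightarrow> (F has_field_derivative f x) (at x)"
    and "continuous_on {0..1} f"
  shows "(\<integral>x. f x \<partial>unit_measure) = F 1 - F 0"
proof -
  have "(\<integral>x. indicator {0..1} x *\<^sub>R f x \<partial>lborel) = F 1 - F 0"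
    using assms by (intro integral_FTC_Icc)
      (auto simp: has_real_derivative_iff_has_vector_derivative[symmetric] intro: DERIV_subset)
  then have "(\<integral>x. f x * indicator {0..1} x \<partial>lborel) = F 1 - F 0"
    by (simp add: mult.commute)
  also have "(\<integral>x. f x * indicator {0..1} x \<partial>lborel) = (\<integral>x. f x * indicator {0<..<1} x \<partial>lborel)"
  proof (rule integral_cong_AE)
    have f: "f \<in> borel_measurable (restrict_space borel {0..1})"
      using assms(2) by (rule borel_measurable_continuous_on_restrict)
    show m: "(\<lambda>x. f x * indicator {0..1} x) \<in> borel_measurable lborel"
      using f by (subst (asm) borel_measurable_restrict_space_iff) (auto simp: mult.commute)
    have "(\<lambda>x. f x * indicator {0<..<1} x) = (\<lambda>x. (f x * indicator {0..1} x) * indicator {0<..<1} x)"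
      by (auto simp: fun_eq_iff indicator_def)
    then show "(\<lambda>x. f x * indicator {0<..<1} x) \<in> borel_measurable lborel"
      using m by simp
    have "AE x in lborel. x \<noteq> (0::real)" "AE x in lborel. x \<noteq> (1::real)"
      by (auto intro: AE_lborel_singleton)
    then show "AE x in lborel. f x * indicator {0..1} x = f x * indicator {0<..<1} x"
      by eventually_elim (auto simp: indicator_def)
  qed
  finally show ?thesis
    by (subst integral_restrict_space) (auto simp: mult.commute)
qed

lemma L2_tendsto_dominated:
  assumes "\<And>n. square_int (f n)" "square_int g" "square_int h"
    and "AE x in unit_measure. (\<lambda>n. f n x) \<longlonglongrightarrow> g x"
    and "\<And>n. AE x in unit_measure. \<bar>f n x - g x\<bar> \<le> h x"
  shows "(\<lambda>n. L2_of (f n)) \<longlonglongrightarrow> L2_of g"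
proof -
  have "(\<lambda>n. \<integral>x. (f n x - g x)\<^sup>2 \<partial>unit_measure) \<longlonglongrightarrow> (\<integral>x. 0 \<partial>unit_measure)"
  proof (rule integral_dominated_convergence[where w = "\<lambda>x. (h x)\<^sup>2"])
    show "AE x in unit_measure. (\<lambda>n. (f n x - g x)\<^sup>2) \<longlonglongrightarrow> 0"
      using assms(4) by eventually_elim (auto intro!: tendsto_eq_intros)
    show "AE x in unit_measure. norm ((f n x - g x)\<^sup>2) \<le> (h x)\<^sup>2" for n
      using assms(5)[of n] by eventually_elim (simp add: abs_le_square_iff[symmetric])
    show "(\<lambda>x. (f n x - g x)\<^sup>2) \<in> borel_measurable unit_measure" for n
      using square_int_measurable[OF square_int_diff[OF assms(1)[of n] assms(2)]]
      by (rule borel_measurable_power)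
  qed (use assms in \<open>auto simp: square_int_def\<close>)
  then have "(\<lambda>n. (norm (L2_of (f n) - L2_of g))\<^sup>2) \<longlonglongrightarrow> 0"
    using assms by (simp add: L2_of_diff[symmetric] norm_L2_of square_int_diff)
  then have "(\<lambda>n. sqrt ((norm (L2_of (f n) - L2_of g))\<^sup>2)) \<longlonglongrightarrow> sqrt 0"
    by (rule tendsto_real_sqrt)
  then show ?thesis
    by (simp add: LIM_zero_iff tendsto_norm_zero_iff)
qed

text \<open>Riesz-Fischer: by the triangle inequality the partial sums \<open>S N\<close> of the
  absolute values are bounded in norm by \<open>M\<close>, so monotone convergence makes their limit
  \<open>T\<close> finite almost everywhere and square integrable. The error of the partial sums is
  then dominated by \<open>2 * T\<close>.\<close>

lemma L2_series_complete:
  fixes X :: "nat \<Rightarrow> L2"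
  assumes "summable (\<lambda>n. norm (X n))"
  shows "convergent (\<lambda>n. \<Sum>i<n. X i)"
proof -
  define f where "f n = rep_L2 (X n)" for n
  have sq: "square_int (f n)" and Lf: "L2_of (f n) = X n" for n
    by (simp_all add: f_def square_int_rep)
  define S where "S N x = (\<Sum>n<N. \<bar>f n x\<bar>)" for N x
  have sqS: "square_int (S N)" for N
    unfolding S_def by (intro square_int_sum square_int_abs sq)
  have norm_abs: "norm (L2_of (\<lambda>x. \<bar>f n x\<bar>)) = norm (X n)" for n
  proof -
    have "(norm (L2_of (\<lambda>x. \<bar>f n x\<bar>)))\<^sup>2 = (norm (L2_of (f n)))\<^sup>2"
      by (simp add: norm_L2_of square_int_abs sq)
    then show ?thesis by (simp add: Lf)
  qed
  define M where "M = (\<Sum>n. norm (X n))"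
  have M: "norm (L2_of (S N)) \<le> M" for N
  proof -
    have "norm (L2_of (S N)) \<le> (\<Sum>n<N. norm (X n))"
      unfolding S_def by (subst L2_of_sum) (auto intro!: sum_norm_le square_int_abs sq simp: norm_abs)
    also have "\<dots> \<le> M"
      unfolding M_def by (intro sum_le_suminf assms) auto
    finally show ?thesis .
  qed
  have Sm: "(\<lambda>x. ennreal ((S N x)\<^sup>2)) \<in> borel_measurable unit_measure" for N
    using square_int_measurable[OF sqS[of N]] by measurable
  have inc: "incseq (\<lambda>N x. ennreal ((S N x)\<^sup>2))"
    by (intro incseq_SucI le_funI ennreal_leI power_mono) (auto simp: S_def sum_nonneg)
  have nnS: "(\<integral>\<^sup>+x. ennreal ((S N x)\<^sup>2) \<partial>unit_measure) = ennreal ((norm (L2_of (S N)))\<^sup>2)" for N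
    using sqS[of N] by (subst nn_integral_eq_integral) (auto simp: norm_L2_of square_int_def)
  have "(\<integral>\<^sup>+x. (SUP N. ennreal ((S N x)\<^sup>2)) \<partial>unit_measure) \<le> ennreal (M\<^sup>2)"
    by (subst nn_integral_monotone_convergence_SUP[OF inc Sm])
      (auto simp: nnS intro!: SUP_least ennreal_leI power_mono M)
  then have fin: "(\<integral>\<^sup>+x. (SUP N. ennreal ((S N x)\<^sup>2)) \<partial>unit_measure) < \<infinity>"
    by (simp add: le_less_trans)
  have "AE x in unit_measure. (SUP N. ennreal ((S N x)\<^sup>2)) \<noteq> \<infinity>"
    using fin Sm by (intro nn_integral_PInf_AE) auto
  then have sums: "AE x in unit_measure. summable (\<lambda>n. \<bar>f n x\<bar>)"
  proof eventually_elim
    case (elim x)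
    then obtain C where C: "C \<ge> 0" "(SUP N. ennreal ((S N x)\<^sup>2)) = ennreal C"
      by (cases "(SUP N. ennreal ((S N x)\<^sup>2))") auto
    have "(S N x)\<^sup>2 \<le> C" for N
      using SUP_upper[of N UNIV "\<lambda>N. ennreal ((S N x)\<^sup>2)"] C by simp
    then have "S N x \<le> sqrt C" for N
      by (simp add: real_le_rsqrt)
    then show ?case
      by (intro summableI_nonneg_bounded[of _ "sqrt C"]) (auto simp: S_def)
  qed
  define T where "T x = (\<Sum>n. \<bar>f n x\<bar>)" for x
  define g where "g x = (\<Sum>n. f n x)" for x
  have fm: "f n \<in> borel_measurable unit_measure" for n
    by (rule square_int_measurable[OF sq])
  have Tm: "T \<in> borel_measurable unit_measure" and gm: "g \<in> borel_measurable unit_measure"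
    unfolding T_def g_def by (intro borel_measurable_suminf borel_measurable_abs fm)+
  have T2: "AE x in unit_measure. ennreal ((T x)\<^sup>2) \<le> (SUP N. ennreal ((S N x)\<^sup>2))"
    using sums
  proof eventually_elim
    case (elim x)
    have "(\<lambda>N. S N x) \<longlonglongrightarrow> T x"
      unfolding S_def using elim by (simp add: T_def summable_LIMSEQ)
    then have "(\<lambda>N. ennreal ((S N x)\<^sup>2)) \<longlonglongrightarrow> ennreal ((T x)\<^sup>2)"
      by (intro tendsto_ennrealI tendsto_power)
    then show ?case
      by (rule LIMSEQ_le_const2) (auto intro!: SUP_upper exI[of _ 0])
  qed
  have sqT: "square_int T"
  proof -
    have "(\<integral>\<^sup>+x. ennreal ((T x)\<^sup>2) \<partial>unit_measure) < \<infinity>"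
      using nn_integral_mono_AE[OF T2] fin by (rule le_less_trans)
    then show ?thesis
      using Tm unfolding square_int_def by (auto intro!: integrableI_bounded)
  qed
  have gT: "AE x in unit_measure. \<bar>g x\<bar> \<le> \<bar>T x\<bar>"
    using sums
  proof eventually_elim
    case (elim x)
    then show ?case
      by (auto simp: g_def T_def intro!: order_trans[OF summable_rabs])
  qed
  have sqg: "square_int g"
    by (rule square_int_mono[OF gm sqT gT])
  have "(\<lambda>N. L2_of (\<lambda>x. \<Sum>n<N. f n x)) \<longlonglongrightarrow> L2_of g"
  proof (rule L2_tendsto_dominated[where h = "\<lambda>x. 2 * T x"])
    show "AE x in unit_measure. (\<lambda>N. \<Sum>n<N. f n x) \<longlonglongrightarrow> g x"
      using sums
      by eventually_elim (auto simp: g_def intro!: summable_LIMSEQ dest: summable_rabs_cancel)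
    show "AE x in unit_measure. \<bar>(\<Sum>n<N. f n x) - g x\<bar> \<le> 2 * T x" for N
      using sums gT
    proof eventually_elim
      case (elim x)
      have "\<bar>\<Sum>n<N. f n x\<bar> \<le> (\<Sum>n<N. \<bar>f n x\<bar>)" by (rule sum_abs)
      also have "\<dots> \<le> T x"
        using elim unfolding T_def by (auto intro!: sum_le_suminf)
      finally show ?case using elim(2) by (auto simp: abs_le_iff)
    qed
  qed (auto intro!: square_int_sum sq sqg square_int_scale sqT)
  then show ?thesis
    by (auto simp: convergent_def L2_of_sum sq Lf)
qed

instance L2 :: banach
proof
  fix X :: "nat \<Rightarrow> L2" assume X: "Cauchy X"
  have "\<forall>n. \<exists>M. \<forall>i\<ge>M. \<forall>j\<ge>M. norm (X i - X j) < (1 / 2) ^ n"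
    using X unfolding Cauchy_iff by auto
  then obtain N where N: "\<And>n i j. i \<ge> N n \<Longrightarrow> j \<ge> N n \<Longrightarrow> norm (X i - X j) < (1 / 2) ^ n"
    by metis
  \<comment> \<open>The sum makes \<open>r n\<close> at least \<open>N n\<close> and the summand
    \<open>n\<close> makes \<open>r\<close> strictly increasing; the increments of \<open>X\<close>
    along \<open>r\<close> are then dominated by a geometric series.\<close>
  define r where "r n = n + (\<Sum>i\<le>n. N i)" for n
  have r: "strict_mono r"
    by (rule strict_monoI_Suc) (simp add: r_def)
  have rN: "r n \<ge> N n" for n
    unfolding r_def by (cases n) auto
  define Y where "Y n = X (r (Suc n)) - X (r n)" for n
  have "norm (Y n) \<le> (1 / 2) ^ n" for n
  proof -
    have "r (Suc n) \<ge> N n"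
      using rN[of n] strict_monoD[OF r, of n "Suc n"] by simp
    then show ?thesis using N[of n "r (Suc n)" "r n"] rN[of n] by (simp add: Y_def)
  qed
  then have "summable (\<lambda>n. norm (Y n))"
    by (intro summable_comparison_test'[OF summable_geometric[of "1 / 2 :: real"], of 0]) simp_all
  then obtain l where "(\<lambda>n. \<Sum>i<n. Y i) \<longlonglongrightarrow> l"
    using L2_series_complete by (auto simp: convergent_def)
  moreover have "(\<Sum>i<n. Y i) = X (r n) - X (r 0)" for n
    unfolding Y_def by (rule sum_lessThan_telescope)
  ultimately have "(\<lambda>n. X (r n) - X (r 0) + X (r 0)) \<longlonglongrightarrow> l + X (r 0)"
    by (intro tendsto_add tendsto_const) simp
  then have "(X \<circ> r) \<longlonglongrightarrow> l + X (r 0)" by (simp add: o_def)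
  then show "convergent X"
    using Cauchy_converges_subseq[OF X r] by (auto simp: convergent_def)
qed

subsection \<open>The order structure\<close>

lemma inner_nonneg_L2:
  assumes "nonneg_L2 v" "nonneg_L2 w"
  shows "0 \<le> inner v w"
proof -
  obtain f g where f: "square_int f" "v = L2_of f" and g: "square_int g" "w = L2_of g"
    by (metis L2_cases)
  have "AE x in unit_measure. 0 \<le> f x * g x"
    using assms f g by (auto simp: nonneg_L2_of)
  then show ?thesis
    using f g by (auto simp: inner_L2_of intro!: integral_nonneg_AE)
qed

lemma L2_of_eq_zero_iff: "square_int f \<Longrightarrow> L2_of f = 0 \<longleftrightarrow> (AE x in unit_measure. f x = 0)"
  using L2_of_eq_iff[OF _ square_int_zero] by (simp add: L2_of_zero)

lemma square_int_max:
  "square_int f \<Longrightarrow> square_int g \<Longrightarrow> square_int (\<lambda>x. max (f x) (g x))"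
  by (rule square_int_mono[where g = "\<lambda>x. \<bar>f x\<bar> + \<bar>g x\<bar>"])
    (simp_all add: square_int_add square_int_abs borel_measurable_max square_int_measurable)

text \<open>The cone of non-negative functions is self-dual: paired with its negative part
  \<open>g\<close>, the function \<open>f\<close> gives minus the squared norm of \<open>g\<close>.
  Closure of the cone under sums, multiples and limits then follows without choosing
  representatives.\<close>

lemma nonneg_L2_dual:
  assumes "\<And>w. nonneg_L2 w \<Longrightarrow> 0 \<le> inner v w"
  shows "nonneg_L2 v"
proof -
  obtain f where f: "square_int f" "v = L2_of f"
    by (rule L2_cases)
  define g where "g x = max (- f x) 0" for x
  have g: "square_int g"
    unfolding g_def by (intro square_int_max square_int_uminus f square_int_zero)
  have "(\<integral>x. f x * g x \<partial>unit_measure) = (\<integral>x. - (g x)\<^sup>2 \<partial>unit_measure)"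
    by (intro Bochner_Integration.integral_cong) (auto simp: g_def max_def power2_eq_square)
  moreover have "0 \<le> inner v (L2_of g)"
    by (rule assms) (simp add: nonneg_L2_of g, simp add: g_def)
  ultimately have "(norm (L2_of g))\<^sup>2 \<le> 0"
    using f g by (simp add: inner_L2_of norm_L2_of)
  then have "L2_of g = 0" by simp
  then have "AE x in unit_measure. g x = 0"
    using g by (simp add: L2_of_eq_zero_iff)
  then have "AE x in unit_measure. 0 \<le> f x"
    by eventually_elim (auto simp: g_def max_def split: if_splits)
  then show ?thesis using f by (simp add: nonneg_L2_of)
qed

lemma nonneg_L2_zero [simp]: "nonneg_L2 0"
  by (rule nonneg_L2_dual) simp

lemma nonneg_L2_add: "nonneg_L2 v \<Longrightarrow> nonneg_L2 w \<Longrightarrow> nonneg_L2 (v + w)"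
  by (rule nonneg_L2_dual) (simp add: inner_add_left inner_nonneg_L2)

lemma nonneg_L2_scaleR: "0 \<le> c \<Longrightarrow> nonneg_L2 v \<Longrightarrow> nonneg_L2 (c *\<^sub>R v)"
  by (rule nonneg_L2_dual) (simp add: inner_nonneg_L2)

lemma nonneg_L2_sum: "(\<And>i. i \<in> I \<Longrightarrow> nonneg_L2 (v i)) \<Longrightarrow> nonneg_L2 (\<Sum>i\<in>I. v i)"
  by (induction I rule: infinite_finite_induct) (auto simp: nonneg_L2_add)

lemma nonneg_L2_tendsto:
  assumes "(f \<longlongrightarrow> v) F" "eventually (\<lambda>x. nonneg_L2 (f x)) F" "F \<noteq> bot"
  shows "nonneg_L2 v"
proof (rule nonneg_L2_dual)
  fix w assume w: "nonneg_L2 w"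
  have "((\<lambda>x. inner (f x) w) \<longlongrightarrow> inner v w) F"
    by (intro tendsto_inner assms tendsto_const)
  then show "0 \<le> inner v w"
    by (rule tendsto_lowerbound)
      (use assms(2,3) w in \<open>auto elim!: eventually_mono simp: inner_nonneg_L2\<close>)
qed

lemma nonneg_L2_antisym:
  assumes "nonneg_L2 v" "nonneg_L2 (- v)"
  shows "v = 0"
proof -
  have "inner v v = 0"
    using inner_nonneg_L2[OF assms] inner_ge_zero[of v] unfolding inner_minus_right by linarith
  then show ?thesis by simp
qed

text \<open>Both \<open>w - v\<close> and \<open>w + v\<close> are non-negative, and their inner
  product is the difference of the squared norms.\<close>

lemma norm_mono_L2:
  assumes "nonneg_L2 v" "nonneg_L2 (w - v)"
  shows "norm v \<le> norm w"
proof -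
  have "nonneg_L2 (w + v)"
    using nonneg_L2_add[OF assms(2) nonneg_L2_scaleR[OF _ assms(1), of 2]]
    by (simp add: scaleR_2 algebra_simps)
  from inner_nonneg_L2[OF assms(2) this] show ?thesis
    by (simp add: algebra_simps inner_commute norm_le)
qed

text \<open>Its purpose is the positive part, which occurs only in the doubled form
  \<open>v + L2_abs v\<close>.\<close>

definition L2_abs :: "L2 \<Rightarrow> L2" where
  "L2_abs v = L2_of (\<lambda>x. \<bar>rep_L2 v x\<bar>)"

lemma L2_abs_of:
  assumes "square_int f"
  shows "L2_abs (L2_of f) = L2_of (\<lambda>x. \<bar>f x\<bar>)"
proof -
  have "AE x in unit_measure. rep_L2 (L2_of f) x = f x"
    using L2_of_eq_iff[OF square_int_rep[of "L2_of f"] assms] by simp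
  then show ?thesis
    unfolding L2_abs_def using assms
    by (subst L2_of_eq_iff) (auto intro!: square_int_abs square_int_rep)
qed

lemma norm_L2_abs [simp]: "norm (L2_abs v) = norm v"
proof -
  obtain f where f: "square_int f" "v = L2_of f"
    by (rule L2_cases)
  then have "(norm (L2_abs v))\<^sup>2 = (norm v)\<^sup>2"
    by (simp add: L2_abs_of norm_L2_of square_int_abs)
  then show ?thesis by simp
qed

lemma nonneg_L2_abs_add: "nonneg_L2 (v + L2_abs v)"
proof -
  obtain f where f: "square_int f" "v = L2_of f"
    by (rule L2_cases)
  then show ?thesis
    by (simp add: L2_abs_of L2_of_add[symmetric] square_int_abs nonneg_L2_of square_int_add)
qed

lemma nonneg_L2_abs_diff: "nonneg_L2 (L2_abs v - v)"
proof -
  obtain f where f: "square_int f" "v = L2_of f"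
    by (rule L2_cases)
  then show ?thesis
    by (simp add: L2_abs_of L2_of_diff[symmetric] square_int_abs nonneg_L2_of square_int_diff)
qed

text \<open>A bound of \<open>v\<close> by a non-negative \<open>w\<close> passes to the positive
  part of \<open>v\<close>. In the proof of strict positivity this turns a minorant of unknown sign
  into a non-negative one.\<close>

lemma nonneg_L2_pos_part_le:
  assumes "nonneg_L2 w" "nonneg_L2 (w - v)"
  shows "nonneg_L2 (2 *\<^sub>R w - (v + L2_abs v))"
proof -
  obtain f g where f: "square_int f" "v = L2_of f" and g: "square_int g" "w = L2_of g"
    by (metis L2_cases)
  have eq: "2 *\<^sub>R w - (v + L2_abs v) = L2_of (\<lambda>x. 2 * g x - (f x + \<bar>f x\<bar>))"
    using f g by (simp add: L2_abs_of L2_of_diff L2_of_add L2_of_scale square_int_abs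
        square_int_add square_int_scale)
  have "AE x in unit_measure. 0 \<le> g x" "AE x in unit_measure. 0 \<le> g x - f x"
    using assms f g by (auto simp: nonneg_L2_of L2_of_diff[symmetric] square_int_diff)
  then have "AE x in unit_measure. 0 \<le> 2 * g x - (f x + \<bar>f x\<bar>)"
    by eventually_elim linarith
  then show ?thesis
    unfolding eq using f g
    by (subst nonneg_L2_of)
      (auto intro!: square_int_diff square_int_add square_int_abs square_int_scale)
qed


section \<open>Fourier sine series\<close>

text \<open>Indices are shifted by one: \<open>freq 0\<close> is \<pi>, and \<open>lam 0\<close> is
  the lowest eigenvalue \<pi>^2.\<close>

definition freq :: "nat \<Rightarrow> real" where
  "freq k = real (Suc k) * pi"

definition lam :: "nat \<Rightarrow> real" where
  "lam k = (freq k)\<^sup>2"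

definition sinb :: "nat \<Rightarrow> real \<Rightarrow> real" where
  "sinb k x = sqrt 2 * sin (freq k * x)"

definition cosb :: "nat \<Rightarrow> real \<Rightarrow> real" where
  "cosb k x = sqrt 2 * cos (freq k * x)"

definition esin :: "nat \<Rightarrow> L2" where
  "esin k = L2_of (sinb k)"

definition ecos :: "nat \<Rightarrow> L2" where
  "ecos k = L2_of (cosb k)"

lemma freq_pos [simp]: "0 < freq k"
  by (simp add: freq_def)

lemma freq_nonzero [simp]: "freq k \<noteq> 0"
  using freq_pos[of k] by linarith

lemma lam_pos [simp]: "0 < lam k"
  by (simp add: lam_def)

lemma lam_ge: "pi\<^sup>2 \<le> lam k"
  unfolding lam_def freq_def by (intro power_mono) (auto simp: mult_le_cancel_right1)

lemma sinb_deriv: "(sinb k has_field_derivative freq k * cosb k x) (at x)"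
  unfolding sinb_def cosb_def by (auto intro!: derivative_eq_intros)

lemma cosb_deriv: "(cosb k has_field_derivative - (freq k * sinb k x)) (at x)"
  unfolding sinb_def cosb_def by (auto intro!: derivative_eq_intros)

lemma continuous_on_sinb [continuous_intros]: "continuous_on S (sinb k)"
  unfolding sinb_def by (intro continuous_intros)

lemma continuous_on_cosb [continuous_intros]: "continuous_on S (cosb k)"
  unfolding cosb_def by (intro continuous_intros)

lemma sinb_0 [simp]: "sinb k 0 = 0" and sinb_1 [simp]: "sinb k 1 = 0"
  using sin_npi[of "Suc k"] by (simp_all add: sinb_def freq_def del: of_nat_Suc)

lemma abs_sinb_le: "\<bar>sinb k x\<bar> \<le> sqrt 2" and abs_cosb_le: "\<bar>cosb k x\<bar> \<le> sqrt 2"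
  unfolding sinb_def cosb_def by (auto simp: abs_mult mult_left_le)

lemma square_int_sinb [simp]: "square_int (sinb k)" and square_int_cosb [simp]: "square_int (cosb k)"
  by (auto intro!: square_int_continuous continuous_intros)

text \<open>The frequency is an integer and not a natural number because the product formulas
  produce the difference of two indices.\<close>

lemma integral_cos_unit:
  "(\<integral>x. cos (real_of_int n * pi * x) \<partial>unit_measure) = (if n = 0 then 1 else 0)"
proof (cases "n = 0")
  case True
  then show ?thesis
    by (simp add: measure_unit_measure)
next
  case False
  have "(\<integral>x. cos (real_of_int n * pi * x) \<partial>unit_measure)
      = sin (real_of_int n * pi * 1) / (real_of_int n * pi) - sin (real_of_int n * pi * 0) / (real_of_int n * pi)"
    by (rule integral_derivative_unit)
      (use False in \<open>auto intro!: derivative_eq_intros continuous_intros\<close>)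
  then show ?thesis
    using False sin_npi_int[of n] by (simp add: mult.commute)
qed

lemma integrable_continuous_unit:
  fixes f :: "real \<Rightarrow> real"
  assumes "continuous_on {0..1} f"
  shows "integrable unit_measure f"
  using square_int_mult[OF square_int_continuous[OF assms] square_int_const[of 1]] by simp

lemma freq_diff: "freq i - freq j = real_of_int (int i - int j) * pi"
  and freq_add: "freq i + freq j = real_of_int (int i + int j + 2) * pi"
  by (simp_all add: freq_def algebra_simps)

lemma inner_esin: "inner (esin i) (esin j) = (if i = j then 1 else 0)"
  and inner_ecos: "inner (ecos i) (ecos j) = (if i = j then 1 else 0)"
proof -
  let ?C = "\<lambda>n. \<lambda>x. cos (real_of_int n * pi * x)"
  have int: "integrable unit_measure (?C n)" for n
    by (intro integrable_continuous_unit continuous_intros)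
  have c: "cos (freq i * x - freq j * x) = ?C (int i - int j) x"
      "cos (freq i * x + freq j * x) = ?C (int i + int j + 2) x" for x
    by (simp_all only: left_diff_distrib[symmetric] distrib_right[symmetric] freq_diff freq_add)
  have s: "sinb i x * sinb j x = ?C (int i - int j) x - ?C (int i + int j + 2) x"
    and c: "cosb i x * cosb j x = ?C (int i - int j) x + ?C (int i + int j + 2) x" for x
    unfolding c[symmetric] sinb_def cosb_def cos_add cos_diff by simp_all
  show "inner (esin i) (esin j) = (if i = j then 1 else 0)"
    unfolding esin_def inner_L2_of[OF square_int_sinb square_int_sinb] s
      Bochner_Integration.integral_diff[OF int int] integral_cos_unit by auto
  show "inner (ecos i) (ecos j) = (if i = j then 1 else 0)"
    unfolding ecos_def inner_L2_of[OF square_int_cosb square_int_cosb] c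
      Bochner_Integration.integral_add[OF int int] integral_cos_unit by auto
qed

text \<open>
  Multiplying by \<open>sin (\<pi> x)\<close> turns the polynomials in \<open>cos (\<pi> x)\<close>, which are dense
  by the Weierstrass theorem, into combinations of the functions \<open>sin (k \<pi> x)\<close>.
\<close>

lemma esin_total:
  assumes v: "\<And>k. inner v (esin k) = 0"
  shows "v = 0"
proof -
  obtain f where f: "square_int f" "v = L2_of f"
    by (rule L2_cases)
  have fcont: "integrable unit_measure (\<lambda>x. f x * g x)" if "continuous_on {0..1} g" for g
    by (intro square_int_mult f square_int_continuous that)
  have fsin: "(\<integral>x. f x * sin (freq k * x) \<partial>unit_measure) = 0" for k
    using v[of k] f by (simp add: esin_def inner_L2_of sinb_def mult.left_commute[of _ "sqrt 2"])
  have pow: "(\<integral>x. f x * (sin (freq k * x) * cos (pi * x) ^ n) \<partial>unit_measure) = 0" for n k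
  proof (induction n arbitrary: k)
    case (Suc n)
    \<comment> \<open>\<open>s k\<close> is the sine one frequency below \<open>freq k\<close>, as
      produced by the addition formulas. For \<open>k = 0\<close> it is the zero function, otherwise
      the induction hypothesis covers it.\<close>
    define s where "s j x = sin (real j * pi * x)" for j :: nat and x :: real
    have eq: "sin (freq k * x) * cos (pi * x) ^ Suc n
        = 1/2 * (sin (freq (Suc k) * x) * cos (pi * x) ^ n) + 1/2 * (s k x * cos (pi * x) ^ n)" for x
    proof -
      have "sin (freq (Suc k) * x) + s k x = 2 * sin (freq k * x) * cos (pi * x)"
      proof -
        have "freq (Suc k) * x = freq k * x + pi * x" "real k * pi * x = freq k * x - pi * x"
          by (simp_all add: freq_def algebra_simps)
        then show ?thesis by (simp add: s_def sin_add sin_diff)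
      qed
      then have "sin (freq k * x) * cos (pi * x) = 1/2 * (sin (freq (Suc k) * x) + s k x)"
        by simp
      then have "sin (freq k * x) * cos (pi * x) ^ Suc n = 1/2 * (sin (freq (Suc k) * x) + s k x) * cos (pi * x) ^ n"
        by (simp add: mult.assoc[symmetric])
      then show ?thesis by (simp add: algebra_simps)
    qed
    have sk: "(\<integral>x. f x * (s k x * cos (pi * x) ^ n) \<partial>unit_measure) = 0"
    proof (cases k)
      case 0
      then show ?thesis by (simp add: s_def)
    next
      case (Suc m)
      then have "s k = (\<lambda>x. sin (freq m * x))"
        by (simp add: s_def freq_def fun_eq_iff)
      then show ?thesis using Suc.IH[of m] by simp
    qed
    have i: "integrable unit_measure (\<lambda>x. f x * (sin (freq (Suc k) * x) * cos (pi * x) ^ n))"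
       "integrable unit_measure (\<lambda>x. f x * (s k x * cos (pi * x) ^ n))"
    proof -
      have "continuous_on {0..1} (\<lambda>x. sin (freq (Suc k) * x) * cos (pi * x) ^ n)"
        "continuous_on {0..1} (\<lambda>x. s k x * cos (pi * x) ^ n)"
        unfolding s_def by (intro continuous_intros)+
      then show "integrable unit_measure (\<lambda>x. f x * (sin (freq (Suc k) * x) * cos (pi * x) ^ n))"
        "integrable unit_measure (\<lambda>x. f x * (s k x * cos (pi * x) ^ n))"
        by (auto dest: fcont)
    qed
    have "(\<integral>x. f x * (sin (freq k * x) * cos (pi * x) ^ Suc n) \<partial>unit_measure)
      = (\<integral>x. 1/2 * (f x * (sin (freq (Suc k) * x) * cos (pi * x) ^ n))
           + 1/2 * (f x * (s k x * cos (pi * x) ^ n)) \<partial>unit_measure)"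
      unfolding eq by (intro Bochner_Integration.integral_cong) (auto simp: algebra_simps)
    also have "\<dots> = 0"
      using i Suc.IH[of "Suc k"] sk by (subst Bochner_Integration.integral_add) auto
    finally show ?case .
  qed (simp add: fsin)
  define h where "h x = f x * sin (pi * x)" for x
  have hint: "integrable unit_measure h"
    unfolding h_def by (rule fcont) (intro continuous_intros)
  have hcont: "integrable unit_measure (\<lambda>x. h x * g x)" if "continuous_on {0..1} g" for g
    using fcont[of "\<lambda>x. sin (pi * x) * g x"] that
    by (simp add: h_def mult.assoc continuous_intros)
  have hpow: "(\<integral>x. h x * cos (pi * x) ^ n \<partial>unit_measure) = 0" for n
    using pow[of 0 n] by (simp add: h_def freq_def mult.assoc)
  have hpoly: "(\<integral>x. h x * p (cos (pi * x)) \<partial>unit_measure) = 0" if p: "real_polynomial_function p" for p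
  proof -
    obtain a n where p: "p = (\<lambda>x. \<Sum>i\<le>n. a i * x ^ i)"
      using p by (auto simp: real_polynomial_function_iff_sum)
    have "(\<integral>x. h x * p (cos (pi * x)) \<partial>unit_measure)
      = (\<integral>x. (\<Sum>i\<le>n. a i * (h x * cos (pi * x) ^ i)) \<partial>unit_measure)"
      by (intro Bochner_Integration.integral_cong) (auto simp: p sum_distrib_left ac_simps)
    also have "\<dots> = (\<Sum>i\<le>n. (\<integral>x. a i * (h x * cos (pi * x) ^ i) \<partial>unit_measure))"
      by (intro Bochner_Integration.integral_sum integrable_mult_right hcont continuous_intros)
    also have "\<dots> = 0"
      by (simp add: hpow)
    finally show ?thesis .
  qed
  have hzero: "(\<integral>x. h x * g x \<partial>unit_measure) = 0" if g: "continuous_on {0..1} g" for g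
  proof -
    have "\<bar>\<integral>x. h x * g x \<partial>unit_measure\<bar> \<le> e * (\<integral>x. \<bar>h x\<bar> \<partial>unit_measure)" if e: "e > 0" for e
    proof -
      \<comment> \<open>The substitution \<open>y = cos (pi * x)\<close> is a bijection of the
        closed unit interval onto [-1, 1], which turns polynomials in the cosine into polynomials in
        \<open>y\<close>.\<close>
      have "continuous_on {-1..1} (\<lambda>y. g (arccos y / pi))"
        by (rule continuous_on_compose2[OF g])
          (auto intro!: continuous_intros simp: divide_simps arccos_lbound arccos_ubound)
      then obtain p where p: "real_polynomial_function p"
          "\<And>y. y \<in> {-1..1} \<Longrightarrow> \<bar>g (arccos y / pi) - p y\<bar> < e"
        using Stone_Weierstrass_real_polynomial_function[OF compact_Icc _ e] by metis
      have pe: "\<bar>g x - p (cos (pi * x))\<bar> < e" if "0 < x" "x < 1" for x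
        using p(2)[of "cos (pi * x)"] that by (simp add: arccos_cos)
      have pc: "continuous_on {0..1} (\<lambda>x. p (cos (pi * x)))"
      proof (rule continuous_on_compose2[where g = p and t = UNIV])
        show "continuous_on UNIV p"
          using p(1) by (intro continuous_on_polymonial_function) (simp add: real_polynomial_function_eq)
        show "continuous_on {0..1} (\<lambda>x. cos (pi * x))"
          by (intro continuous_intros)
      qed simp
      have "(\<integral>x. h x * g x \<partial>unit_measure)
        = (\<integral>x. h x * g x \<partial>unit_measure) - (\<integral>x. h x * p (cos (pi * x)) \<partial>unit_measure)"
        by (simp add: hpoly p(1))
      also have "\<dots> = (\<integral>x. h x * g x - h x * p (cos (pi * x)) \<partial>unit_measure)"
        by (intro Bochner_Integration.integral_diff[symmetric] hcont g pc)
      also have "\<bar>\<dots>\<bar> \<le> (\<integral>x. \<bar>h x * g x - h x * p (cos (pi * x))\<bar> \<partial>unit_measure)"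
        by (rule integral_abs_bound)
      also have "\<dots> \<le> (\<integral>x. e * \<bar>h x\<bar> \<partial>unit_measure)"
      proof (intro integral_mono integrable_abs Bochner_Integration.integrable_diff
          integrable_mult_right hcont g pc hint)
        fix x assume "x \<in> space unit_measure"
        then have "\<bar>g x - p (cos (pi * x))\<bar> \<le> e" using pe[of x] by simp
        then have "\<bar>h x\<bar> * \<bar>g x - p (cos (pi * x))\<bar> \<le> \<bar>h x\<bar> * e"
          by (intro mult_left_mono) auto
        then show "\<bar>h x * g x - h x * p (cos (pi * x))\<bar> \<le> e * \<bar>h x\<bar>"
          by (simp only: right_diff_distrib[symmetric] abs_mult mult.commute[of e])
      qed
      finally show ?thesis by simp
    qed
    then have le: "\<bar>\<integral>x. h x * g x \<partial>unit_measure\<bar> \<le> e * (\<integral>x. \<bar>h x\<bar> \<partial>unit_measure)" if "e > 0" for e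
      using that by simp
    have "\<bar>\<integral>x. h x * g x \<partial>unit_measure\<bar> \<le> 0 + e" if "e > 0" for e
    proof -
      define I where "I = (\<integral>x. \<bar>h x\<bar> \<partial>unit_measure)"
      have I: "I \<ge> 0" unfolding I_def by simp
      have pos: "0 < e / (I + 1)"
        using that I by (intro divide_pos_pos) linarith+
      have "\<bar>\<integral>x. h x * g x \<partial>unit_measure\<bar> \<le> e / (I + 1) * I"
        unfolding I_def by (rule le) (use pos in \<open>simp add: I_def\<close>)
      also have "\<dots> = e * (I / (I + 1))" by simp
      also have "\<dots> \<le> e * 1"
        using that I by (intro mult_left_mono) (simp_all add: divide_le_eq_1)
      finally show ?thesis by simp
    qed
    then show ?thesis using field_le_epsilon[of "\<bar>\<integral>x. h x * g x \<partial>unit_measure\<bar>" 0] by auto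
  qed
  \<comment> \<open>Passage from continuous to measurable test functions: extended by 0,
    \<open>h\<close> is almost everywhere a limit of functions that are continuous on the
    line.\<close>
  define H where "H x = indicator {0<..<1} x * h x" for x :: real
  have "(\<lambda>x. h x) \<in> borel_measurable (restrict_space lborel {0<..<1})"
    using hint by simp
  then have "H \<in> borel_measurable lborel"
    unfolding H_def by (subst (asm) borel_measurable_restrict_space_iff) auto
  then have "H \<in> borel_measurable lebesgue"
    by (rule measurable_completion)
  then have "H measurable_on UNIV"
    by (rule lebesgue_measurable_imp_measurable_on_real) simp
  then obtain N g where N: "negligible N" and g: "\<And>n. continuous_on UNIV (g n)"
      and lim: "\<And>x. x \<notin> N \<Longrightarrow> (\<lambda>n. g n x) \<longlonglongrightarrow> H x"
    unfolding measurable_on_def by auto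
  \<comment> \<open>Truncation to [-1, 1] preserves continuity, supplies the integrable majorant
    \<open>\<bar>h x\<bar>\<close>, and makes \<open>h x * clip (h x)\<close> non-negative with
    zeros only where \<open>h\<close> vanishes.\<close>
  define clip where "clip y = max (-1) (min 1 y)" for y :: real
  have clip1: "\<bar>y\<bar> * \<bar>clip z\<bar> \<le> \<bar>y\<bar>" for y z
    by (rule mult_left_le) (auto simp: clip_def)
  have clipc: "continuous_on UNIV clip"
    unfolding clip_def by (intro continuous_intros)
  have AEN: "AE x in unit_measure. x \<notin> N"
  proof -
    have "AE x in lebesgue. x \<notin> N"
      using N AE_not_in[of N lebesgue] by (simp add: negligible_iff_null_sets)
    then have "AE x in lborel. x \<notin> N"
      by (simp add: AE_completion_iff)
    then show ?thesis by (auto simp: AE_restrict_space_iff elim!: eventually_mono)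
  qed
  have "(\<lambda>n. \<integral>x. h x * clip (g n x) \<partial>unit_measure) \<longlonglongrightarrow> (\<integral>x. h x * clip (h x) \<partial>unit_measure)"
  proof (rule integral_dominated_convergence[where w = "\<lambda>x. \<bar>h x\<bar>"])
    show "AE x in unit_measure. (\<lambda>n. h x * clip (g n x)) \<longlonglongrightarrow> h x * clip (h x)"
      using AEN AE_space
    proof eventually_elim
      case (elim x)
      have "(\<lambda>n. clip (g n x)) \<longlonglongrightarrow> clip (H x)"
        using continuous_on_tendsto_compose[OF clipc lim[OF elim(1)]] by simp
      then show ?case using elim(2) by (auto intro!: tendsto_intros simp: H_def)
    qed
    show "AE x in unit_measure. norm (h x * clip (g n x)) \<le> \<bar>h x\<bar>" for n
      by (simp add: abs_mult clip1)
    have hm: "h \<in> borel_measurable unit_measure" using hint by simp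
    show "(\<lambda>x. h x * clip (h x)) \<in> borel_measurable unit_measure"
      unfolding clip_def using hm by measurable
    show "(\<lambda>x. h x * clip (g n x)) \<in> borel_measurable unit_measure" for n
      by (rule borel_measurable_integrable, rule hcont,
          rule continuous_on_compose2[OF clipc continuous_on_subset[OF g]]) auto
  qed (use hint in auto)
  moreover have "(\<integral>x. h x * clip (g n x) \<partial>unit_measure) = 0" for n
    by (rule hzero, rule continuous_on_compose2[OF clipc continuous_on_subset[OF g]]) auto
  ultimately have "(\<integral>x. h x * clip (h x) \<partial>unit_measure) = 0"
    by (simp add: LIMSEQ_const_iff)
  moreover have "integrable unit_measure (\<lambda>x. h x * clip (h x))"
  proof (rule Bochner_Integration.integrable_bound[OF hint])
    have hm: "h \<in> borel_measurable unit_measure" using hint by simp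
    show "(\<lambda>x. h x * clip (h x)) \<in> borel_measurable unit_measure"
      unfolding clip_def using hm by measurable
  qed (simp add: abs_mult clip1)
  moreover have "0 \<le> h x * clip (h x)" for x
    by (cases "h x \<ge> 0") (auto simp: clip_def max_def min_def mult_nonneg_nonneg mult_nonpos_nonpos)
  ultimately have "AE x in unit_measure. h x * clip (h x) = 0"
    by (subst (asm) integral_nonneg_eq_0_iff_AE) auto
  then have "AE x in unit_measure. f x = 0"
    using AE_space
  proof eventually_elim
    case (elim x)
    then have "sin (pi * x) > 0" by (intro sin_gt_zero) auto
    with elim show ?case
      by (auto simp: h_def clip_def max_def min_def split: if_splits)
  qed
  then show ?thesis using f by (simp add: L2_of_eq_zero_iff)
qed

section \<open>Orthonormal series and Fourier coefficients\<close>

lemma norm_orthonormal_sum: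
  fixes e :: "nat \<Rightarrow> 'a::real_inner"
  assumes "\<And>i j. inner (e i) (e j) = (if i = j then 1 else 0)" "finite I"
  shows "(norm (\<Sum>i\<in>I. a i *\<^sub>R e i))\<^sup>2 = (\<Sum>i\<in>I. (a i)\<^sup>2)"
proof -
  have "(norm (\<Sum>i\<in>I. a i *\<^sub>R e i))\<^sup>2 = (\<Sum>i\<in>I. \<Sum>j\<in>I. a i * (a j * (if j = i then 1 else 0)))"
    by (simp add: power2_norm_eq_inner inner_sum_left inner_sum_right assms(1) sum_distrib_left)
  also have "\<dots> = (\<Sum>i\<in>I. (a i)\<^sup>2)"
    using assms(2) by (intro sum.cong) (auto simp: power2_eq_square if_distrib cong: if_cong)
  finally show ?thesis .
qed

text \<open>By orthonormality the Cauchy criterion for the vectors is that for the squared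
  coefficients. The system is left general because the sines carry the functions and the cosines
  their weak derivatives.\<close>

lemma summable_orthonormal:
  fixes e :: "nat \<Rightarrow> 'a::{real_inner, banach}"
  assumes e: "\<And>i j. inner (e i) (e j) = (if i = j then 1 else 0)"
    and "summable (\<lambda>k. (a k)\<^sup>2)"
  shows "summable (\<lambda>k. a k *\<^sub>R e k)"
  unfolding summable_Cauchy
proof (intro allI impI)
  fix \<epsilon> :: real assume \<epsilon>: "\<epsilon> > 0"
  then obtain N where N: "\<And>m n. m \<ge> N \<Longrightarrow> norm (\<Sum>k=m..<n. (a k)\<^sup>2) < \<epsilon>\<^sup>2"
    using assms(2) unfolding summable_Cauchy by (meson zero_less_power)
  have "norm (\<Sum>k=m..<n. a k *\<^sub>R e k) < \<epsilon>" if "m \<ge> N" for m n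
  proof (rule power2_less_imp_less)
    show "(norm (\<Sum>k=m..<n. a k *\<^sub>R e k))\<^sup>2 < \<epsilon>\<^sup>2"
      using N[OF that, of n] by (subst norm_orthonormal_sum[OF e]) auto
  qed (use \<epsilon> in auto)
  then show "\<exists>N. \<forall>m\<ge>N. \<forall>n. norm (\<Sum>k=m..<n. a k *\<^sub>R e k) < \<epsilon>"
    by blast
qed

lemma inner_suminf_orthonormal:
  fixes e :: "nat \<Rightarrow> 'a::{real_inner, banach}"
  assumes e: "\<And>i j. inner (e i) (e j) = (if i = j then 1 else 0)"
    and "summable (\<lambda>k. (a k)\<^sup>2)"
  shows "inner (\<Sum>k. a k *\<^sub>R e k) (e j) = a j"
proof -
  have "(\<lambda>k. inner (a k *\<^sub>R e k) (e j)) sums inner (\<Sum>k. a k *\<^sub>R e k) (e j)"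
    by (rule bounded_linear.sums[OF bounded_linear_inner_left
          summable_sums[OF summable_orthonormal[OF assms]]])
  moreover have "(\<lambda>k. inner (a k *\<^sub>R e k) (e j)) sums a j"
    using sums_If_finite_set[of "{j}" a] by (simp add: e if_distrib cong: if_cong)
  ultimately show ?thesis by (rule sums_unique2)
qed

lemma bessel:
  fixes e :: "nat \<Rightarrow> 'a::real_inner"
  assumes e: "\<And>i j. inner (e i) (e j) = (if i = j then 1 else 0)"
  shows "summable (\<lambda>k. (inner v (e k))\<^sup>2)"
proof (rule summableI_nonneg_bounded)
  fix n
  let ?S = "\<Sum>k<n. inner v (e k) *\<^sub>R e k"
  have "0 \<le> inner (v - ?S) (v - ?S)" by simp
  also have "\<dots> = (norm v)\<^sup>2 - 2 * inner v ?S + (norm ?S)\<^sup>2"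
    by (simp add: inner_diff_left inner_diff_right inner_commute power2_norm_eq_inner)
  also have "inner v ?S = (\<Sum>k<n. (inner v (e k))\<^sup>2)"
    by (simp add: inner_sum_right power2_eq_square)
  also have "(norm ?S)\<^sup>2 = (\<Sum>k<n. (inner v (e k))\<^sup>2)"
    by (rule norm_orthonormal_sum[OF e]) simp
  finally show "(\<Sum>k<n. (inner v (e k))\<^sup>2) \<le> (norm v)\<^sup>2" by simp
qed simp

definition coef :: "L2 \<Rightarrow> nat \<Rightarrow> real" where
  "coef v k = inner v (esin k)"

text \<open>The series has a meaning only for square summable \<open>a\<close>; this is verified
  wherever coefficients are read off through \<open>coef_synth\<close>.\<close>

definition synth :: "(nat \<Rightarrow> real) \<Rightarrow> L2" where
  "synth a = (\<Sum>k. a k *\<^sub>R esin k)"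

lemma coef_simps [simp]:
  "coef 0 k = 0" "coef (v + w) k = coef v k + coef w k" "coef (v - w) k = coef v k - coef w k"
  "coef (- v) k = - coef v k" "coef (c *\<^sub>R v) k = c * coef v k"
  by (simp_all add: coef_def inner_add_left inner_diff_left)

lemma coef_synth: "summable (\<lambda>k. (a k)\<^sup>2) \<Longrightarrow> coef (synth a) k = a k"
  unfolding coef_def synth_def by (rule inner_suminf_orthonormal[OF inner_esin])

lemma summable_coef: "summable (\<lambda>k. (coef v k)\<^sup>2)"
  unfolding coef_def by (rule bessel[OF inner_esin])

lemma coef_eqI:
  assumes "\<And>k. coef v k = coef w k"
  shows "v = w"
proof -
  have "v - w = 0"
    by (rule esin_total) (use assms in \<open>simp add: coef_def inner_diff_left\<close>)
  then show ?thesis by simp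
qed

lemma synth_coef [simp]: "synth (coef v) = v"
  by (rule coef_eqI) (simp add: coef_synth summable_coef)

lemma coef_sums: "(\<lambda>k. coef v k *\<^sub>R esin k) sums v"
  using summable_sums[OF summable_orthonormal[OF inner_esin summable_coef[of v]]]
  by (simp add: synth_def[symmetric])

lemma inner_coef_sums: "(\<lambda>k. coef v k * coef w k) sums inner v w"
  using bounded_linear.sums[OF bounded_linear_inner_left coef_sums[of v], of w]
  by (simp add: coef_def inner_commute)

lemma norm_coef_sums: "(\<lambda>k. (coef v k)\<^sup>2) sums (norm v)\<^sup>2"
  using inner_coef_sums[of v v] by (simp add: power2_norm_eq_inner power2_eq_square[of "coef _ _"])

lemma norm_le_coef:
  assumes "\<And>k. \<bar>coef v k\<bar> \<le> M * \<bar>coef w k\<bar>" "0 \<le> M"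
  shows "norm v \<le> M * norm w"
proof (rule power2_le_imp_le)
  have "(coef v k)\<^sup>2 \<le> M\<^sup>2 * (coef w k)\<^sup>2" for k
    using power_mono[OF assms(1)[of k], of 2] by (simp add: power_mult_distrib)
  then have "(norm v)\<^sup>2 \<le> M\<^sup>2 * (norm w)\<^sup>2"
    by (rule sums_le[OF _ norm_coef_sums sums_mult[OF norm_coef_sums]])
  then show "(norm v)\<^sup>2 \<le> (M * norm w)\<^sup>2"
    by (simp add: power_mult_distrib)
qed (use assms in auto)

lemma summable_square_bound:
  assumes "\<And>k. \<bar>a k\<bar> \<le> M * \<bar>coef w k\<bar>"
  shows "summable (\<lambda>k. (a k)\<^sup>2)"
proof (rule summable_comparison_test'[where N = 0])
  show "summable (\<lambda>k. M\<^sup>2 * (coef w k)\<^sup>2)"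
    by (intro summable_mult summable_coef)
  show "norm ((a n)\<^sup>2) \<le> M\<^sup>2 * (coef w n)\<^sup>2" for n
    using power_mono[OF assms(1)[of n], of 2] by (simp add: power_mult_distrib)
qed

text \<open>Dominated convergence for the series of squared coefficients of \<open>x t - y\<close>,
  in the form of Tannery's theorem: twice the squares of \<open>B k\<close> and of
  \<open>coef y k\<close> form a majorant independent of \<open>t\<close>.\<close>

lemma L2_tendsto_coef:
  assumes lim: "\<And>k. ((\<lambda>t. coef (x t) k) \<longlongrightarrow> coef y k) F"
    and ev: "eventually (\<lambda>t. \<forall>k. \<bar>coef (x t) k\<bar> \<le> B k) F"
    and B: "summable (\<lambda>k. (B k)\<^sup>2)" and F: "F \<noteq> bot"
  shows "(x \<longlongrightarrow> y) F"
proof -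
  have "((\<lambda>t. \<Sum>k. (coef (x t - y) k)\<^sup>2) \<longlongrightarrow> (\<Sum>k. 0)) F"
  proof (rule tannerys_theorem[THEN conjunct2, THEN conjunct2])
    show "((\<lambda>t. (coef (x t - y) k)\<^sup>2) \<longlongrightarrow> 0) F" for k
      using lim[of k] by (auto intro!: tendsto_eq_intros)
    show "summable (\<lambda>k. 2 * (B k)\<^sup>2 + 2 * (coef y k)\<^sup>2)"
      by (intro summable_add summable_mult B summable_coef)
    have "\<forall>\<^sub>F p in (at_top :: nat filter) \<times>\<^sub>F F. \<forall>k. \<bar>coef (x (snd p)) k\<bar> \<le> B k"
      using eventually_compose_filterlim[OF ev filterlim_snd] .
    then show "\<forall>\<^sub>F (k, t) in at_top \<times>\<^sub>F F. norm ((coef (x t - y) k)\<^sup>2) \<le> 2 * (B k)\<^sup>2 + 2 * (coef y k)\<^sup>2"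
    proof eventually_elim
      case (elim p)
      show ?case
      proof (cases p)
        case (Pair k t)
        have "(coef (x t) k - coef y k)\<^sup>2 \<le> 2 * (coef (x t) k)\<^sup>2 + 2 * (coef y k)\<^sup>2"
          using zero_le_power2[of "coef (x t) k + coef y k"]
          by (simp add: power2_sum power2_diff)
        also have "(coef (x t) k)\<^sup>2 \<le> (B k)\<^sup>2"
          using elim Pair by (metis abs_le_square_iff abs_ge_self order_trans snd_conv)
        finally show ?thesis using Pair by simp
      qed
    qed
  qed fact
  moreover have "(\<Sum>k. (coef (x t - y) k)\<^sup>2) = (norm (x t - y))\<^sup>2" for t
    using norm_coef_sums by (rule sums_unique[symmetric])
  ultimately have "((\<lambda>t. sqrt ((norm (x t - y))\<^sup>2)) \<longlongrightarrow> sqrt 0) F"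
    by (intro tendsto_real_sqrt) simp
  then show ?thesis
    by (simp add: tendsto_norm_zero_iff LIM_zero_iff)
qed

section \<open>Derivatives of curves, coefficient by coefficient\<close>

lemma has_vector_derivative_iff_quotient:
  fixes f :: "real \<Rightarrow> 'a::real_normed_vector"
  shows "(f has_vector_derivative D) (at t within S)
    \<longleftrightarrow> ((\<lambda>s. (f s - f t) /\<^sub>R (s - t)) \<longlongrightarrow> D) (at t within S)"
proof -
  have "norm (f s - f t - (s - t) *\<^sub>R D) / norm (s - t) = norm ((f s - f t) /\<^sub>R (s - t) - D)"
    if "s \<noteq> t" for s
  proof -
    have "(f s - f t) /\<^sub>R (s - t) - D = (f s - f t - (s - t) *\<^sub>R D) /\<^sub>R (s - t)"
      using that by (simp add: scaleR_diff_right)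
    then show ?thesis
      by (simp add: divide_inverse mult.commute)
  qed
  then have ev: "eventually (\<lambda>s. norm (f s - f t - (s - t) *\<^sub>R D) / norm (s - t)
      = norm ((f s - f t) /\<^sub>R (s - t) - D)) (at t within S)"
    by (auto simp: eventually_at_filter)
  show ?thesis
    unfolding has_vector_derivative_def has_derivative_iff_norm tendsto_cong[OF ev]
    by (simp add: bounded_linear_scaleR_left tendsto_norm_zero_iff LIM_zero_iff)
qed

text \<open>By the mean value theorem a bound \<open>B k\<close> on the derivative of a coefficient
  also bounds its difference quotients, so these converge in norm as soon as they converge
  coefficient by coefficient.\<close>

lemma vector_derivative_coef:
  assumes d: "\<And>k s. s \<in> S \<Longrightarrow> ((\<lambda>s. coef (x s) k) has_field_derivative coef (x' s) k) (at s)"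
    and S: "open S" "convex S" "t \<in> S"
    and B: "\<And>k s. s \<in> S \<Longrightarrow> \<bar>coef (x' s) k\<bar> \<le> B k" "summable (\<lambda>k. (B k)\<^sup>2)"
  shows "(x has_vector_derivative x' t) (at t)"
proof -
  have "((\<lambda>s. (x s - x t) /\<^sub>R (s - t)) \<longlongrightarrow> x' t) (at t)"
  proof (rule L2_tendsto_coef[OF _ _ B(2)])
    show "((\<lambda>s. coef ((x s - x t) /\<^sub>R (s - t)) k) \<longlongrightarrow> coef (x' t) k) (at t)" for k
      using d[OF S(3), of k] unfolding has_field_derivative_iff
      by (simp add: divide_inverse mult.commute)
    have "\<bar>coef ((x s - x t) /\<^sub>R (s - t)) k\<bar> \<le> B k" if "s \<in> S" "s \<noteq> t" for s k
    proof -
      have "norm (coef (x s) k - coef (x t) k) \<le> B k * norm (s - t)"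
        by (rule field_differentiable_bound[OF S(2)])
          (use d B S that in \<open>auto intro: has_field_derivative_at_within\<close>)
      then show ?thesis
        using that by (simp add: abs_mult divide_simps mult.commute)
    qed
    moreover have "eventually (\<lambda>s. s \<in> S \<and> s \<noteq> t) (at t)"
      using eventually_at_in_open[OF S(1,3)] by (simp add: eventually_mono)
    ultimately show "\<forall>\<^sub>F s in at t. \<forall>k. \<bar>coef ((x s - x t) /\<^sub>R (s - t)) k\<bar> \<le> B k"
      by (auto elim!: eventually_mono)
  qed simp
  then show ?thesis
    by (simp add: has_vector_derivative_iff_quotient)
qed


section \<open>Test functions and weak derivatives\<close>

definition smooth_fun :: "(real \<Rightarrow> real) \<Rightarrow> bool" where
  "smooth_fun f \<longleftrightarrow> (\<forall>n x. (deriv ^^ n) f field_differentiable (at x))"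

text \<open>Coinduction for smoothness: in a set closed under differentiation every member can be
  differentiated forever. The smoothness proofs below consist in exhibiting such a set.\<close>

lemma smooth_fun_coinduct:
  assumes "f \<in> S"
    and S: "\<And>g. g \<in> S \<Longrightarrow> \<exists>g'\<in>S. \<forall>x. (g has_field_derivative g' x) (at x)"
  shows "smooth_fun f"
proof -
  have "(deriv ^^ n) f \<in> S" for n
  proof (induction n)
    case (Suc n)
    then obtain g' where g': "g' \<in> S" "\<And>x. ((deriv ^^ n) f has_field_derivative g' x) (at x)"
      using S by blast
    have "deriv ((deriv ^^ n) f) = g'"
      using g'(2) by (intro ext DERIV_imp_deriv)
    then show ?case using g'(1) by simp
  qed (simp add: assms)
  then show ?thesis
    using S unfolding smooth_fun_def field_differentiable_def by blast
qed

lemma smooth_fun_has_deriv: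
  assumes "smooth_fun f"
  shows "(f has_field_derivative deriv f x) (at x)"
proof -
  have "f field_differentiable (at x)"
    using assms unfolding smooth_fun_def by (metis funpow_0)
  then show ?thesis by (rule field_differentiable_derivI)
qed

lemma smooth_fun_deriv:
  assumes "smooth_fun f"
  shows "smooth_fun (deriv f)"
proof -
  have "(deriv ^^ n) (deriv f) = (deriv ^^ Suc n) f" for n
    by (simp add: funpow_swap1)
  then show ?thesis using assms unfolding smooth_fun_def by metis
qed

lemma smooth_fun_continuous: "smooth_fun f \<Longrightarrow> continuous_on S f"
  by (meson DERIV_isCont continuous_at_imp_continuous_on smooth_fun_has_deriv)

text \<open>By the Leibniz rule the derivative of a product is a sum of two products, so sums have
  to be included to obtain a set closed under differentiation.\<close>

inductive_set product_sums :: "(real \<Rightarrow> real) set" where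
  prod: "smooth_fun f \<Longrightarrow> smooth_fun g \<Longrightarrow> (\<lambda>x. f x * g x) \<in> product_sums"
| add: "u \<in> product_sums \<Longrightarrow> v \<in> product_sums \<Longrightarrow> (\<lambda>x. u x + v x) \<in> product_sums"

lemma smooth_fun_product_sums:
  assumes "f \<in> product_sums"
  shows "smooth_fun f"
  using assms
proof (rule smooth_fun_coinduct)
  fix g assume "g \<in> product_sums"
  then show "\<exists>g'\<in>product_sums. \<forall>x. (g has_field_derivative g' x) (at x)"
  proof induction
    case (prod f g)
    have "(\<lambda>x. deriv f x * g x + f x * deriv g x) \<in> product_sums"
      using prod by (intro product_sums.intros smooth_fun_deriv)
    then show ?case
      using prod by (intro bexI[of _ "\<lambda>x. deriv f x * g x + f x * deriv g x"])
        (auto intro!: derivative_eq_intros smooth_fun_has_deriv)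
  next
    case (add u v)
    then obtain u' v' where "u' \<in> product_sums" "v' \<in> product_sums"
      and d: "\<forall>x. (u has_field_derivative u' x) (at x)" "\<forall>x. (v has_field_derivative v' x) (at x)"
      by blast
    then have "(\<lambda>x. u' x + v' x) \<in> product_sums" by (intro product_sums.intros)
    then show ?case
      using d by (intro bexI[of _ "\<lambda>x. u' x + v' x"]) (auto intro!: DERIV_add)
  qed
qed

lemma smooth_fun_mult: "smooth_fun f \<Longrightarrow> smooth_fun g \<Longrightarrow> smooth_fun (\<lambda>x. f x * g x)"
  by (rule smooth_fun_product_sums[OF product_sums.prod])

lemma smooth_fun_const: "smooth_fun (\<lambda>_. c)"
  by (rule smooth_fun_coinduct[of _ "range (\<lambda>c _. c)"]) (auto intro!: derivative_eq_intros)

lemma smooth_fun_add: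
  assumes "smooth_fun f" "smooth_fun g"
  shows "smooth_fun (\<lambda>x. f x + g x)"
  using smooth_fun_product_sums[OF product_sums.add[OF
        product_sums.prod[OF assms(1) smooth_fun_const[of 1]]
        product_sums.prod[OF assms(2) smooth_fun_const[of 1]]]] by simp

lemma smooth_fun_sum:
  "(\<And>i. i \<in> I \<Longrightarrow> smooth_fun (f i)) \<Longrightarrow> smooth_fun (\<lambda>x. \<Sum>i\<in>I. f i x)"
  by (induction I rule: infinite_finite_induct) (auto simp: smooth_fun_const smooth_fun_add)

lemma smooth_fun_affine:
  assumes "smooth_fun f"
  shows "smooth_fun (\<lambda>x. f (a * x + b))"
proof (rule smooth_fun_coinduct)
  let ?S = "{\<lambda>x. c * g (a * x + b) |c g. smooth_fun g}"
  show "(\<lambda>x. f (a * x + b)) \<in> ?S"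
    using assms by (auto intro!: exI[of _ 1] exI[of _ f])
  fix h assume "h \<in> ?S"
  then obtain c g where h: "h = (\<lambda>x. c * g (a * x + b))" and g: "smooth_fun g" by blast
  have "(h has_field_derivative (c * a) * deriv g (a * x + b)) (at x)" for x
  proof -
    have "((\<lambda>x. g (a * x + b)) has_field_derivative deriv g (a * x + b) * a) (at x)"
      by (rule DERIV_chain2[OF smooth_fun_has_deriv[OF g]]) (auto intro!: derivative_eq_intros)
    from DERIV_cmult[OF this, of c] show ?thesis
      unfolding h by (simp add: mult_ac)
  qed
  moreover have "(\<lambda>x. (c * a) * deriv g (a * x + b)) \<in> ?S"
    using smooth_fun_deriv[OF g] by blast
  ultimately show "\<exists>h'\<in>?S. \<forall>x. (h has_field_derivative h' x) (at x)"
    by (intro bexI[of _ "\<lambda>x. (c * a) * deriv g (a * x + b)"] allI)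
qed

lemma smooth_fun_sinb: "smooth_fun (sinb k)"
proof (rule smooth_fun_coinduct)
  let ?S = "{\<lambda>x. c * sinb k x + d * cosb k x |c d. True}"
  show "sinb k \<in> ?S"
    by (rule CollectI, rule exI[of _ 1], rule exI[of _ 0]) simp
  fix h assume "h \<in> ?S"
  then obtain c d where h: "h = (\<lambda>x. c * sinb k x + d * cosb k x)" by blast
  have "(h has_field_derivative (- d * freq k) * sinb k x + (c * freq k) * cosb k x) (at x)" for x
    unfolding h by (auto intro!: derivative_eq_intros sinb_deriv cosb_deriv)
  moreover have "(\<lambda>x. (- d * freq k) * sinb k x + (c * freq k) * cosb k x) \<in> ?S" by blast
  ultimately show "\<exists>h'\<in>?S. \<forall>x. (h has_field_derivative h' x) (at x)"
    by (intro bexI[of _ "\<lambda>x. (- d * freq k) * sinb k x + (c * freq k) * cosb k x"] allI)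
qed

text \<open>For \<open>p = 1\<close> this is the classical smooth function that is flat at 0. The
  polynomial is a parameter because differentiation replaces \<open>p\<close> by
  \<open>p - pderiv p\<close> multiplied with the square of the variable, so that the family is
  closed under differentiation.\<close>

definition flat :: "real poly \<Rightarrow> real \<Rightarrow> real" where
  "flat p x = (if x > 0 then poly p (1 / x) * exp (- (1 / x)) else 0)"

text \<open>The power \<open>y ^ m\<close> is carried along so that the induction can pass from
  \<open>pCons a q\<close> with \<open>m\<close> to \<open>q\<close> with
  \<open>Suc m\<close>.\<close>

lemma poly_mult_exp_tendsto_0: "((\<lambda>y. y ^ m * poly q y * exp (- y)) \<longlongrightarrow> (0::real)) at_top"
proof (induction q arbitrary: m)
  case (pCons a q)
  have "((\<lambda>y. y ^ m / exp y) \<longlongrightarrow> (0::real)) at_top"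
    by (rule tendsto_power_div_exp_0)
  then have "((\<lambda>y. a * (y ^ m / exp y) + y ^ Suc m * poly q y * exp (- y)) \<longlongrightarrow> a * 0 + 0) at_top"
    by (intro tendsto_add tendsto_mult tendsto_const pCons.IH)
  then show ?case
    by (simp add: algebra_simps exp_minus divide_inverse)
qed simp

lemma flat_deriv: "(flat p has_field_derivative flat (pCons 0 (pCons 0 (p - pderiv p))) x) (at x)"
proof -
  consider "x > 0" | "x < 0" | "x = 0" by linarith
  then show ?thesis
  proof cases
    case 1
    have "((\<lambda>x. poly p (1 / x) * exp (- (1 / x))) has_field_derivative
        flat (pCons 0 (pCons 0 (p - pderiv p))) x) (at x)"
      using 1 by (auto simp: flat_def field_simps power2_eq_square
          intro!: derivative_eq_intros DERIV_chain'[where g = "poly p"] poly_DERIV)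
    then show ?thesis
      by (rule has_field_derivative_transform_within_open[of _ _ _ "{0<..}"])
        (use 1 in \<open>auto simp: flat_def\<close>)
  next
    case 2
    have "((\<lambda>x. 0) has_field_derivative flat (pCons 0 (pCons 0 (p - pderiv p))) x) (at x)"
      using 2 by (simp add: flat_def)
    then show ?thesis
      by (rule has_field_derivative_transform_within_open[of _ _ _ "{..<0}"])
        (use 2 in \<open>auto simp: flat_def\<close>)
  next
    case 3
    have "((\<lambda>y. (flat p y - flat p 0) / (y - 0)) \<longlongrightarrow> 0) (at 0)"
      unfolding filterlim_at_split
    proof
      have "eventually (\<lambda>y. (flat p y - flat p 0) / (y - 0) = 0) (at_left (0::real))"
        using eventually_at_left_real[of "-1" 0] by (auto simp: flat_def elim!: eventually_mono)
      then show "((\<lambda>y. (flat p y - flat p 0) / (y - 0)) \<longlongrightarrow> 0) (at_left 0)"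
        by (rule tendsto_eventually)
      \<comment> \<open>Inverting the variable moves the right-hand limit at 0 to infinity, where
        the exponential beats every polynomial.\<close>
      have "((\<lambda>y. y ^ 1 * poly p y * exp (- y)) \<longlongrightarrow> 0) at_top"
        by (rule poly_mult_exp_tendsto_0)
      moreover have "eventually (\<lambda>y. y ^ 1 * poly p y * exp (- y)
          = (flat p (inverse y) - flat p 0) / (inverse y - 0)) at_top"
        using eventually_gt_at_top[of "0::real"]
        by eventually_elim (simp add: flat_def field_simps)
      ultimately have "((\<lambda>y. (flat p (inverse y) - flat p 0) / (inverse y - 0)) \<longlongrightarrow> 0) at_top"
        by (rule Lim_transform_eventually)
      then show "((\<lambda>y. (flat p y - flat p 0) / (y - 0)) \<longlongrightarrow> 0) (at_right 0)"
        by (subst filterlim_at_right_to_top)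
    qed
    then show ?thesis
      using 3 by (simp add: has_field_derivative_iff flat_def)
  qed
qed

lemma smooth_fun_flat: "smooth_fun (flat p)"
  by (rule smooth_fun_coinduct[of _ "range flat"]) (use flat_deriv in auto)

lemma flat_one: "flat 1 t = (if t > 0 then exp (- (1 / t)) else 0)"
  by (simp add: flat_def)

lemma flat_one_bounds: "0 \<le> flat 1 t" "flat 1 t \<le> 1"
  by (auto simp: flat_one)

lemma flat_one_deriv: "(flat 1 has_field_derivative flat [:0, 0, 1:] t) (at t)"
  using flat_deriv[of 1 t] by (simp add: one_pCons)

lemma flat_two: "flat [:0, 0, 1:] t = (if t > 0 then (1 / t)\<^sup>2 * exp (- (1 / t)) else 0)"
  by (simp add: flat_def power2_eq_square)

text \<open>With \<open>t = m * x - 1\<close> the weight \<open>1 + t\<close> is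
  \<open>m * x\<close>: the product is the derivative of one factor of the cutoff, weighted by the
  distance to the endpoint. In \<open>y = 1 / t\<close> it reads
  \<open>(y ^ 2 + y) * exp (- y)\<close>, and the quadratic Taylor bound of the exponential gives
  2.\<close>

lemma flat_two_bounds: "0 \<le> (1 + t) * flat [:0, 0, 1:] t" "(1 + t) * flat [:0, 0, 1:] t \<le> 2"
proof -
  show "0 \<le> (1 + t) * flat [:0, 0, 1:] t"
    by (auto simp: flat_two)
  show "(1 + t) * flat [:0, 0, 1:] t \<le> 2"
  proof (cases "t > 0")
    case True
    define y where "y = 1 / t"
    have y: "y > 0" "t = 1 / y" using True by (auto simp: y_def)
    have "(1 + t) * flat [:0, 0, 1:] t = (1 + t) * (y\<^sup>2 * exp (- y))"
      using True by (simp add: flat_two y_def)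
    also have "(1 + t) * (y\<^sup>2 * exp (- y)) = (y\<^sup>2 + y) * exp (- y)"
      using y by (simp add: field_simps power2_eq_square)
    also have "\<dots> \<le> (2 * exp y) * exp (- y)"
      using exp_lower_Taylor_quadratic[of y] y by (intro mult_right_mono) auto
    finally show ?thesis by (simp add: mult.assoc mult_exp_exp)
  qed (simp add: flat_two)
qed

lemma inverse_tendsto_0_at_top: "((\<lambda>t. 1 / t) \<longlongrightarrow> (0::real)) at_top"
  using tendsto_inverse_0_at_top[OF filterlim_ident] by (simp add: inverse_eq_divide)

lemma flat_one_tendsto: "(flat 1 \<longlongrightarrow> 1) at_top"
proof -
  have "((\<lambda>t. exp (- (1 / t))) \<longlongrightarrow> exp (- (0::real))) at_top"
    by (intro tendsto_intros inverse_tendsto_0_at_top)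
  moreover have "eventually (\<lambda>t. exp (- (1 / t)) = flat 1 t) at_top"
    using eventually_gt_at_top[of 0] by eventually_elim (simp add: flat_one)
  ultimately show ?thesis by (auto intro: Lim_transform_eventually)
qed

lemma flat_two_tendsto: "((\<lambda>t. (1 + t) * flat [:0, 0, 1:] t) \<longlongrightarrow> 0) at_top"
proof -
  have "((\<lambda>t. ((1 / t)\<^sup>2 + 1 / t) * exp (- (1 / t))) \<longlongrightarrow> (0\<^sup>2 + 0) * exp (- (0::real))) at_top"
    by (intro tendsto_intros inverse_tendsto_0_at_top)
  moreover have "eventually (\<lambda>t. ((1 / t)\<^sup>2 + 1 / t) * exp (- (1 / t)) = (1 + t) * flat [:0, 0, 1:] t) at_top"
    using eventually_gt_at_top[of 0]
    by eventually_elim (simp add: flat_two field_simps power2_eq_square)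
  ultimately show ?thesis by (auto intro: Lim_transform_eventually)
qed

text \<open>It vanishes outside the interval from \<open>1 / m\<close> to \<open>1 - 1 / m\<close>
  and tends to 1 at every point of the open unit interval as \<open>m\<close> grows.\<close>

definition cutoff :: "real \<Rightarrow> real \<Rightarrow> real" where
  "cutoff m x = flat 1 (m * x - 1) * flat 1 (m * (1 - x) - 1)"

definition cutoff' :: "real \<Rightarrow> real \<Rightarrow> real" where
  "cutoff' m x = m * flat [:0, 0, 1:] (m * x - 1) * flat 1 (m * (1 - x) - 1)
     - m * flat [:0, 0, 1:] (m * (1 - x) - 1) * flat 1 (m * x - 1)"

lemma smooth_fun_cutoff: "smooth_fun (cutoff m)"
proof -
  have "smooth_fun (\<lambda>x. flat 1 (m * x + (-1)) * flat 1 ((- m) * x + (m - 1)))"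
    by (intro smooth_fun_mult smooth_fun_affine smooth_fun_flat)
  then show ?thesis
    by (simp add: cutoff_def[abs_def] algebra_simps)
qed

lemma cutoff_deriv: "(cutoff m has_field_derivative cutoff' m x) (at x)"
proof -
  have 1: "((\<lambda>x. flat 1 (m * x - 1)) has_field_derivative flat [:0, 0, 1:] (m * x - 1) * m) (at x)"
    by (rule DERIV_chain2[OF flat_one_deriv]) (auto intro!: derivative_eq_intros)
  have 2: "((\<lambda>x. flat 1 (m * (1 - x) - 1)) has_field_derivative
      flat [:0, 0, 1:] (m * (1 - x) - 1) * (- m)) (at x)"
    by (rule DERIV_chain2[OF flat_one_deriv]) (auto intro!: derivative_eq_intros)
  show ?thesis
    using DERIV_mult[OF 1 2] by (simp add: cutoff_def[abs_def] cutoff'_def algebra_simps)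
qed

lemma cutoff_bounds: "0 \<le> cutoff m x" "cutoff m x \<le> 1"
  by (auto simp: cutoff_def flat_one_bounds intro!: mult_le_one)

section \<open>Approximation by test functions\<close>

lemma test_function_iff:
  "test_function \<phi> \<longleftrightarrow> smooth_fun \<phi> \<and> compact (closure {x. \<phi> x \<noteq> 0}) \<and> closure {x. \<phi> x \<noteq> 0} \<subseteq> {0<..<1}"
  by (simp add: test_function_def smooth_fun_def)

lemma test_function_outside: "test_function \<phi> \<Longrightarrow> x \<notin> {0<..<1} \<Longrightarrow> \<phi> x = 0"
  using closure_subset[of "{x. \<phi> x \<noteq> 0}"] by (auto simp: test_function_iff)

lemma test_function_cutoff:
  assumes "smooth_fun f" "m > 0"
  shows "test_function (\<lambda>x. f x * cutoff m x)"
proof -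
  have sub: "{x. f x * cutoff m x \<noteq> 0} \<subseteq> {1 / m..1 - 1 / m}"
  proof
    fix x assume "x \<in> {x. f x * cutoff m x \<noteq> 0}"
    then have "m * x - 1 > 0" "m * (1 - x) - 1 > 0"
      by (auto simp: cutoff_def flat_one split: if_splits)
    then show "x \<in> {1 / m..1 - 1 / m}"
      using assms(2) by (auto simp: field_simps)
  qed
  then have cl: "closure {x. f x * cutoff m x \<noteq> 0} \<subseteq> {1 / m..1 - 1 / m}"
    by (rule closure_minimal) simp
  moreover have "{1 / m..1 - 1 / m} \<subseteq> {0<..<1}"
  proof -
    have "1 / m > 0" using assms(2) by simp
    then show ?thesis
      by (intro subsetI) (simp only: atLeastAtMost_iff greaterThanLessThan_iff, linarith)
  qed
  moreover have "compact (closure {x. f x * cutoff m x \<noteq> 0})"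
    using bounded_subset[OF bounded_closed_interval sub] by (simp add: compact_closure)
  ultimately show ?thesis
    using assms by (auto simp: test_function_iff smooth_fun_mult smooth_fun_cutoff)
qed

lemma square_int_smooth: "smooth_fun f \<Longrightarrow> square_int f"
  by (intro square_int_continuous smooth_fun_continuous)

text \<open>The derivative of \<open>cutoff m\<close> is of order \<open>m\<close> near the
  endpoints. The boundary values save the product: \<open>f\<close> is at most \<open>L\<close>
  times the distance to either endpoint, so \<open>f * cutoff' m\<close> stays bounded and tends to
  0 at every interior point.\<close>

lemma test_function_approx:
  assumes f: "smooth_fun f" "f 0 = 0" "f 1 = 0"
  obtains \<phi> where "\<And>n. test_function (\<phi> n)" "(\<lambda>n. L2_of (\<phi> n)) \<longlonglongrightarrow> L2_of f"
    "(\<lambda>n. L2_of (deriv (\<phi> n))) \<longlonglongrightarrow> L2_of (deriv f)"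
proof -
  define \<phi> where "\<phi> n x = f x * cutoff (real (Suc n)) x" for n x
  have test: "test_function (\<phi> n)" for n
    unfolding \<phi>_def by (rule test_function_cutoff[OF f(1)]) simp
  have sm: "smooth_fun (\<phi> n)" for n
    using test by (simp add: test_function_iff)
  have d: "deriv (\<phi> n) = (\<lambda>x. deriv f x * cutoff (real (Suc n)) x + f x * cutoff' (real (Suc n)) x)" for n
  proof
    fix x
    show "deriv (\<phi> n) x = deriv f x * cutoff (real (Suc n)) x + f x * cutoff' (real (Suc n)) x"
      unfolding \<phi>_def
      using DERIV_mult[OF smooth_fun_has_deriv[OF f(1)] cutoff_deriv, of "real (Suc n)" x]
      by (intro DERIV_imp_deriv) (simp add: algebra_simps)
  qed
  have "continuous_on {0..1} (deriv f)"
    by (intro smooth_fun_continuous smooth_fun_deriv f)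
  then obtain L where L: "\<And>x. x \<in> {0..1} \<Longrightarrow> \<bar>deriv f x\<bar> \<le> L"
    using compact_imp_bounded[OF compact_continuous_image[OF _ compact_Icc], of 0 1 "deriv f"]
    unfolding bounded_iff by fastforce
  have L0: "0 \<le> L" using L[of 0] by simp
  have lip: "\<bar>f x - f y\<bar> \<le> L * \<bar>x - y\<bar>" if "x \<in> {0..1}" "y \<in> {0..1}" for x y
    using field_differentiable_bound[of "{0..1}" f "deriv f" L x y] that L
      smooth_fun_has_deriv[OF f(1)] by (auto intro: has_field_derivative_at_within)
  have fx: "\<bar>f x\<bar> \<le> L * x" "\<bar>f x\<bar> \<le> L * (1 - x)" if "x \<in> {0<..<1}" for x
    using lip[of x 0] lip[of x 1] that f by auto
  have inf: "filterlim (\<lambda>n. real (Suc n) * c - 1) at_top sequentially" if "c > 0" for c :: real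
  proof -
    have "filterlim (\<lambda>n. c * real (Suc n)) at_top sequentially"
      by (intro filterlim_tendsto_pos_mult_at_top[OF tendsto_const that]
          filterlim_compose[OF filterlim_real_sequentially filterlim_Suc])
    from filterlim_tendsto_add_at_top[OF tendsto_const[of "-1"] this]
    show ?thesis by (simp add: mult.commute)
  qed
  have lim1: "(\<lambda>n. cutoff (real (Suc n)) x) \<longlonglongrightarrow> 1" if "x \<in> {0<..<1}" for x
  proof -
    have "(\<lambda>n. flat 1 (real (Suc n) * x - 1) * flat 1 (real (Suc n) * (1 - x) - 1)) \<longlonglongrightarrow> 1 * 1"
      using that by (intro tendsto_mult filterlim_compose[OF flat_one_tendsto] inf) auto
    then show ?thesis by (simp add: cutoff_def)
  qed
  have half: "\<bar>f x * (m * flat [:0, 0, 1:] (m * c - 1) * flat 1 s)\<bar>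
      \<le> L * ((1 + (m * c - 1)) * flat [:0, 0, 1:] (m * c - 1))"
    if "\<bar>f x\<bar> \<le> L * c" "m > 0" for x m c s
  proof -
    have d0: "0 \<le> flat [:0, 0, 1:] (m * c - 1)"
      by (simp add: flat_two)
    have "\<bar>f x * (m * flat [:0, 0, 1:] (m * c - 1) * flat 1 s)\<bar>
      = \<bar>f x\<bar> * (m * flat [:0, 0, 1:] (m * c - 1)) * flat 1 s"
      using d0 that flat_one_bounds[of s] by (simp add: abs_mult)
    also have "\<dots> \<le> \<bar>f x\<bar> * (m * flat [:0, 0, 1:] (m * c - 1)) * 1"
      using d0 that flat_one_bounds[of s] by (intro mult_left_mono) auto
    also have "\<dots> \<le> (L * c) * (m * flat [:0, 0, 1:] (m * c - 1)) * 1"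
      using d0 that by (intro mult_right_mono) auto
    finally show ?thesis by (simp add: algebra_simps)
  qed
  have cut': "\<bar>f x * cutoff' (real (Suc n)) x\<bar>
      \<le> L * ((1 + (real (Suc n) * x - 1)) * flat [:0, 0, 1:] (real (Suc n) * x - 1))
        + L * ((1 + (real (Suc n) * (1 - x) - 1)) * flat [:0, 0, 1:] (real (Suc n) * (1 - x) - 1))"
    if "x \<in> {0<..<1}" for x n
    unfolding cutoff'_def right_diff_distrib[of "f x"]
    by (rule order_trans[OF abs_triangle_ineq4 add_mono[OF half half]]) (use fx[OF that] in auto)
  have lim2: "(\<lambda>n. f x * cutoff' (real (Suc n)) x) \<longlonglongrightarrow> 0" if "x \<in> {0<..<1}" for x
  proof (rule Lim_null_comparison)
    show "\<forall>\<^sub>F n in sequentially. norm (f x * cutoff' (real (Suc n)) x)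
      \<le> L * ((1 + (real (Suc n) * x - 1)) * flat [:0, 0, 1:] (real (Suc n) * x - 1))
        + L * ((1 + (real (Suc n) * (1 - x) - 1)) * flat [:0, 0, 1:] (real (Suc n) * (1 - x) - 1))"
      using cut'[OF that] by simp
    have "(\<lambda>n. L * ((1 + (real (Suc n) * x - 1)) * flat [:0, 0, 1:] (real (Suc n) * x - 1))
        + L * ((1 + (real (Suc n) * (1 - x) - 1)) * flat [:0, 0, 1:] (real (Suc n) * (1 - x) - 1)))
        \<longlonglongrightarrow> L * 0 + L * 0"
      using that by (intro tendsto_add tendsto_mult tendsto_const
          filterlim_compose[OF flat_two_tendsto] inf) auto
    then show "(\<lambda>n. L * ((1 + (real (Suc n) * x - 1)) * flat [:0, 0, 1:] (real (Suc n) * x - 1))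
        + L * ((1 + (real (Suc n) * (1 - x) - 1)) * flat [:0, 0, 1:] (real (Suc n) * (1 - x) - 1)))
        \<longlonglongrightarrow> 0" by simp
  qed
  have conv1: "(\<lambda>n. L2_of (\<phi> n)) \<longlonglongrightarrow> L2_of f"
  proof (rule L2_tendsto_dominated[where h = "\<lambda>_. L"])
    show "AE x in unit_measure. (\<lambda>n. \<phi> n x) \<longlonglongrightarrow> f x"
    proof (rule AE_I2)
      fix x assume "x \<in> space unit_measure"
      then have "(\<lambda>n. f x * cutoff (real (Suc n)) x) \<longlonglongrightarrow> f x * 1"
        by (intro tendsto_mult tendsto_const lim1) simp
      then show "(\<lambda>n. \<phi> n x) \<longlonglongrightarrow> f x" by (simp add: \<phi>_def)
    qed
    show "AE x in unit_measure. \<bar>\<phi> n x - f x\<bar> \<le> L" for n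
    proof (rule AE_I2)
      fix x assume x: "x \<in> space unit_measure"
      have "\<bar>\<phi> n x - f x\<bar> = \<bar>f x\<bar> * (1 - cutoff (real (Suc n)) x)"
        using cutoff_bounds[of "real (Suc n)" x]
        by (simp add: \<phi>_def right_diff_distrib[of "f x" _ 1, simplified, symmetric] abs_mult)
      also have "\<dots> \<le> \<bar>f x\<bar> * 1"
        using cutoff_bounds[of "real (Suc n)" x] by (intro mult_left_mono) auto
      also have "\<dots> \<le> L"
        using fx(1)[of x] x L0 mult_left_mono[of x 1 L] by simp
      finally show "\<bar>\<phi> n x - f x\<bar> \<le> L" .
    qed
  qed (auto intro: square_int_smooth sm f square_int_const)
  have conv2: "(\<lambda>n. L2_of (deriv (\<phi> n))) \<longlonglongrightarrow> L2_of (deriv f)"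
  \<comment> \<open>\<open>2 * L\<close> for the derivative of the cutoff at each of the two ends,
    and \<open>L\<close> for \<open>deriv f\<close> times one minus the cutoff.\<close>
  proof (rule L2_tendsto_dominated[where h = "\<lambda>_. 5 * L"])
    show "AE x in unit_measure. (\<lambda>n. deriv (\<phi> n) x) \<longlonglongrightarrow> deriv f x"
    proof (rule AE_I2)
      fix x assume "x \<in> space unit_measure"
      then have "(\<lambda>n. deriv f x * cutoff (real (Suc n)) x + f x * cutoff' (real (Suc n)) x)
          \<longlonglongrightarrow> deriv f x * 1 + 0"
        by (intro tendsto_add tendsto_mult tendsto_const lim1 lim2) auto
      then show "(\<lambda>n. deriv (\<phi> n) x) \<longlonglongrightarrow> deriv f x" by (simp add: d)
    qed
    show "AE x in unit_measure. \<bar>deriv (\<phi> n) x - deriv f x\<bar> \<le> 5 * L" for n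
    proof (rule AE_I2)
      fix x assume x: "x \<in> space unit_measure"
      have "deriv (\<phi> n) x - deriv f x
          = f x * cutoff' (real (Suc n)) x - deriv f x * (1 - cutoff (real (Suc n)) x)"
        by (simp add: d algebra_simps)
      also have "\<bar>\<dots>\<bar> \<le> \<bar>f x * cutoff' (real (Suc n)) x\<bar> + \<bar>deriv f x * (1 - cutoff (real (Suc n)) x)\<bar>"
        by (rule abs_triangle_ineq4)
      also have "\<bar>deriv f x * (1 - cutoff (real (Suc n)) x)\<bar> \<le> L * 1"
        using cutoff_bounds[of "real (Suc n)" x] L[of x] x L0
        by (simp only: abs_mult) (intro mult_mono, auto)
      also have "\<bar>f x * cutoff' (real (Suc n)) x\<bar> \<le> L * 2 + L * 2"
        using x by (intro order_trans[OF cut'] add_mono mult_left_mono flat_two_bounds L0) simp_all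
      finally show "\<bar>deriv (\<phi> n) x - deriv f x\<bar> \<le> 5 * L" by simp
    qed
  qed (auto intro: square_int_smooth smooth_fun_deriv sm f square_int_const)
  show thesis using that[OF test conv1 conv2] .
qed

section \<open>Integration by parts and weak derivatives\<close>

lemma inner_by_parts:
  assumes g: "\<And>x. (g has_field_derivative g' x) (at x)" "continuous_on {0..1} g'"
    and \<phi>: "test_function \<phi>"
  shows "inner (L2_of g) (L2_of (deriv \<phi>)) = - inner (L2_of g') (L2_of \<phi>)"
proof -
  have s: "smooth_fun \<phi>" using \<phi> by (simp add: test_function_iff)
  have cg: "continuous_on {0..1} g"
    using g(1) by (meson DERIV_isCont continuous_at_imp_continuous_on)
  have c: "continuous_on {0..1} \<phi>" "continuous_on {0..1} (deriv \<phi>)"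
    by (intro smooth_fun_continuous smooth_fun_deriv s)+
  have sq: "square_int g" "square_int g'" "square_int \<phi>" "square_int (deriv \<phi>)"
    by (intro square_int_continuous cg g c)+
  have "(\<integral>x. g x * deriv \<phi> x + g' x * \<phi> x \<partial>unit_measure) = g 1 * \<phi> 1 - g 0 * \<phi> 0"
  proof (rule integral_derivative_unit)
    show "((\<lambda>x. g x * \<phi> x) has_field_derivative g x * deriv \<phi> x + g' x * \<phi> x) (at x)" for x
      using DERIV_mult[OF g(1) smooth_fun_has_deriv[OF s], of x] by (simp add: algebra_simps)
    show "continuous_on {0..1} (\<lambda>x. g x * deriv \<phi> x + g' x * \<phi> x)"
      by (intro continuous_intros cg g c)
  qed
  also have "\<dots> = 0"
    using test_function_outside[OF \<phi>, of 0] test_function_outside[OF \<phi>, of 1] by simp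
  finally show ?thesis
    using sq by (simp add: inner_L2_of square_int_mult)
qed

text \<open>Every \<open>sinb k\<close> vanishes at both ends and is thus a limit of test functions,
  and the sines are total. Uniqueness of weak derivatives rests on this.\<close>

lemma test_functions_total:
  assumes "\<And>\<phi>. test_function \<phi> \<Longrightarrow> inner w (L2_of \<phi>) = 0"
  shows "w = 0"
proof (rule esin_total)
  fix k
  obtain \<phi> where \<phi>: "\<And>n. test_function (\<phi> n)" "(\<lambda>n. L2_of (\<phi> n)) \<longlonglongrightarrow> L2_of (sinb k)"
    using test_function_approx[OF smooth_fun_sinb] by (metis sinb_0 sinb_1)
  have "(\<lambda>n. inner w (L2_of (\<phi> n))) \<longlonglongrightarrow> inner w (L2_of (sinb k))"
    by (intro tendsto_inner tendsto_const \<phi>)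
  then show "inner w (esin k) = 0"
    using assms \<phi>(1) by (simp add: esin_def LIMSEQ_const_iff)
qed

lemma weak_deriv_eq:
  assumes "has_weak_deriv v w"
  shows "weak_deriv v = w"
  unfolding weak_deriv_def
proof (rule the_equality, rule assms)
  fix w' assume "has_weak_deriv v w'"
  then have "w' - w = 0"
    using assms by (intro test_functions_total) (auto simp: has_weak_deriv_def inner_diff_left)
  then show "w' = w" by simp
qed

lemma has_weak_deriv_weak_deriv: "v \<in> H1 \<Longrightarrow> has_weak_deriv v (weak_deriv v)"
  using weak_deriv_eq by (auto simp: H1_def)

lemma has_weak_deriv_diff:
  "has_weak_deriv v w \<Longrightarrow> has_weak_deriv v' w' \<Longrightarrow> has_weak_deriv (v - v') (w - w')"
  by (simp add: has_weak_deriv_def inner_diff_left)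

lemma has_weak_deriv_classical:
  assumes "\<And>x. (g has_field_derivative g' x) (at x)" "continuous_on {0..1} g'"
  shows "has_weak_deriv (L2_of g) (L2_of g')"
  using inner_by_parts[OF assms] by (simp add: has_weak_deriv_def)

lemma has_weak_deriv_smooth: "smooth_fun f \<Longrightarrow> has_weak_deriv (L2_of f) (L2_of (deriv f))"
  by (intro has_weak_deriv_classical smooth_fun_has_deriv smooth_fun_continuous smooth_fun_deriv)

text \<open>The boundary condition sits in \<open>v\<close>, which is approximated by test functions
  in the norm of \<open>H1\<close>; hence \<open>g\<close> is free at the endpoints and may be a
  cosine.\<close>

lemma inner_weak_deriv_H1_0:
  assumes v: "v \<in> H1_0"
    and g: "\<And>x. (g has_field_derivative g' x) (at x)" "continuous_on {0..1} g'"
  shows "inner (L2_of g) (weak_deriv v) = - inner (L2_of g') v"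
proof -
  have vH: "v \<in> H1" using v by (simp add: H1_0_def)
  have "\<forall>n. \<exists>\<phi>. test_function \<phi> \<and> H1_norm (v - L2_of \<phi>) < inverse (real (Suc n))"
    using v unfolding H1_0_def by simp
  then obtain \<phi> where \<phi>: "\<And>n. test_function (\<phi> n)"
      "\<And>n. H1_norm (v - L2_of (\<phi> n)) < inverse (real (Suc n))"
    by metis
  have wd: "weak_deriv (v - L2_of (\<phi> n)) = weak_deriv v - L2_of (deriv (\<phi> n))" for n
    using \<phi>(1)[of n] by (intro weak_deriv_eq has_weak_deriv_diff has_weak_deriv_weak_deriv vH
        has_weak_deriv_smooth) (simp add: test_function_iff)
  have "norm (v - L2_of (\<phi> n)) \<le> inverse (real (Suc n))"
    "norm (weak_deriv v - L2_of (deriv (\<phi> n))) \<le> inverse (real (Suc n))" for n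
  proof -
    show "norm (v - L2_of (\<phi> n)) \<le> inverse (real (Suc n))"
      using real_sqrt_sum_squares_ge1[of "norm (v - L2_of (\<phi> n))"] \<phi>(2)[of n]
      unfolding H1_norm_def by (meson less_imp_le order_trans)
    show "norm (weak_deriv v - L2_of (deriv (\<phi> n))) \<le> inverse (real (Suc n))"
      using real_sqrt_sum_squares_ge2[of "norm (weak_deriv v - L2_of (deriv (\<phi> n)))"] \<phi>(2)[of n]
      unfolding H1_norm_def wd by (meson less_imp_le order_trans)
  qed
  then have "(\<lambda>n. v - L2_of (\<phi> n)) \<longlonglongrightarrow> 0" "(\<lambda>n. weak_deriv v - L2_of (deriv (\<phi> n))) \<longlonglongrightarrow> 0"
    by (auto intro!: Lim_null_comparison[OF _ LIMSEQ_inverse_real_of_nat])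
  then have l: "(\<lambda>n. v - (v - L2_of (\<phi> n))) \<longlonglongrightarrow> v - 0"
      "(\<lambda>n. weak_deriv v - (weak_deriv v - L2_of (deriv (\<phi> n)))) \<longlonglongrightarrow> weak_deriv v - 0"
    by (intro tendsto_diff tendsto_const; simp)+
  have "(\<lambda>n. inner (L2_of g) (L2_of (deriv (\<phi> n)))) \<longlonglongrightarrow> inner (L2_of g) (weak_deriv v)"
    using l(2) by (intro tendsto_inner tendsto_const) simp
  moreover have "(\<lambda>n. - inner (L2_of g') (L2_of (\<phi> n))) \<longlonglongrightarrow> - inner (L2_of g') v"
    using l(1) by (intro tendsto_minus tendsto_inner tendsto_const) simp
  ultimately show ?thesis
    unfolding inner_by_parts[OF g \<phi>(1)] by (rule LIMSEQ_unique)
qed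

section \<open>The Dirichlet Laplacian in the sine basis\<close>

text \<open>Two integrations by parts, each borrowing the boundary condition from a different
  factor: the one on \<open>p = weak_deriv v\<close> uses that the sine is a limit of test
  functions, the one on \<open>v\<close> tests with a cosine and uses
  \<open>v \<in> H1_0\<close>.\<close>

lemma coef_op_A:
  assumes "v \<in> dom_A"
  shows "coef (op_A v) k = lam k * coef v k"
proof -
  define p where "p = weak_deriv v"
  have p: "p \<in> H1" and v: "v \<in> H1_0"
    using assms by (auto simp: dom_A_def H2_def p_def)
  define q where "q = weak_deriv p"
  obtain \<phi> where \<phi>: "\<And>n. test_function (\<phi> n)" "(\<lambda>n. L2_of (\<phi> n)) \<longlonglongrightarrow> L2_of (sinb k)"
      "(\<lambda>n. L2_of (deriv (\<phi> n))) \<longlonglongrightarrow> L2_of (deriv (sinb k))"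
    using test_function_approx[OF smooth_fun_sinb sinb_0 sinb_1] by metis
  have ds: "deriv (sinb k) = (\<lambda>x. freq k * cosb k x)"
    by (intro ext DERIV_imp_deriv sinb_deriv)
  have "inner p (L2_of (deriv (\<phi> n))) = - inner q (L2_of (\<phi> n))" for n
    using has_weak_deriv_weak_deriv[OF p] \<phi>(1) by (simp add: has_weak_deriv_def q_def)
  moreover have "(\<lambda>n. inner p (L2_of (deriv (\<phi> n)))) \<longlonglongrightarrow> inner p (freq k *\<^sub>R ecos k)"
    using \<phi>(3) unfolding ds by (intro tendsto_inner tendsto_const) (simp add: L2_of_scale ecos_def)
  moreover have "(\<lambda>n. - inner q (L2_of (\<phi> n))) \<longlonglongrightarrow> - inner q (esin k)"
    unfolding esin_def by (intro tendsto_minus tendsto_inner tendsto_const \<phi>)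
  ultimately have 1: "freq k * inner p (ecos k) = - inner q (esin k)"
    using LIMSEQ_unique by fastforce
  have "inner (L2_of (cosb k)) p = - inner (L2_of (\<lambda>x. - (freq k * sinb k x))) v"
    unfolding p_def by (intro inner_weak_deriv_H1_0 v cosb_deriv continuous_intros)
  then have 2: "inner p (ecos k) = freq k * inner v (esin k)"
    by (simp add: ecos_def esin_def L2_of_uminus L2_of_scale square_int_scale inner_commute)
  show ?thesis
    using 1 2 by (simp add: coef_def op_A_def q_def[symmetric] p_def[symmetric] lam_def power2_eq_square)
qed

lemma freq_ge_1: "1 \<le> freq k"
proof -
  have "1 * 1 \<le> real (Suc k) * pi"
    using pi_gt3 by (intro mult_mono) auto
  then show ?thesis by (simp add: freq_def)
qed

text \<open>The candidate for the weak derivative is the cosine series \<open>p\<close>, whose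
  coefficients are square summable because \<open>freq k\<close> is at most \<open>lam k\<close>.
  Integration by parts in each term identifies the weak derivatives of \<open>v\<close> and of
  \<open>p\<close>. For the boundary condition, the partial sums converge in the norm of
  \<open>H1\<close>, and each of them is a limit of test functions.\<close>

lemma
  assumes g: "\<And>k. coef g k = lam k * coef v k"
  shows dom_A_I: "v \<in> dom_A" and op_A_eq: "op_A v = g"
proof -
  define a where "a k = freq k * coef v k" for k
  have "\<bar>a k\<bar> \<le> 1 * \<bar>coef g k\<bar>" for k
  proof -
    have "\<bar>a k\<bar> * 1 \<le> \<bar>a k\<bar> * freq k"
      using freq_ge_1 by (intro mult_left_mono) auto
    then show ?thesis
      by (simp add: a_def g lam_def abs_mult power2_eq_square mult_ac abs_of_pos)
  qed
  then have asum: "summable (\<lambda>k. (a k)\<^sup>2)" by (rule summable_square_bound)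
  define p where "p = (\<Sum>k. a k *\<^sub>R ecos k)"
  have psums: "(\<lambda>k. a k *\<^sub>R ecos k) sums p"
    unfolding p_def by (intro summable_sums summable_orthonormal inner_ecos asum)
  have s: "inner (esin k) (L2_of (deriv \<phi>)) = - (freq k * inner (ecos k) (L2_of \<phi>))"
    if "test_function \<phi>" for k \<phi>
    using inner_by_parts[OF sinb_deriv _ that, of k]
    by (simp add: continuous_intros esin_def ecos_def L2_of_scale)
  have c: "inner (ecos k) (L2_of (deriv \<phi>)) = freq k * inner (esin k) (L2_of \<phi>)"
    if "test_function \<phi>" for k \<phi>
    using inner_by_parts[OF cosb_deriv _ that, of k]
    by (simp add: continuous_intros esin_def ecos_def L2_of_scale L2_of_uminus square_int_scale)
  have vp: "has_weak_deriv v p"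
    unfolding has_weak_deriv_def
  proof (intro allI impI)
    fix \<phi> assume \<phi>: "test_function \<phi>"
    have "(\<lambda>k. inner (coef v k *\<^sub>R esin k) (L2_of (deriv \<phi>))) sums inner v (L2_of (deriv \<phi>))"
      by (rule bounded_linear.sums[OF bounded_linear_inner_left coef_sums])
    moreover have "(\<lambda>k. - inner (a k *\<^sub>R ecos k) (L2_of \<phi>)) sums (- inner p (L2_of \<phi>))"
      by (intro sums_minus bounded_linear.sums[OF bounded_linear_inner_left psums])
    moreover have "- inner (a k *\<^sub>R ecos k) (L2_of \<phi>) = inner (coef v k *\<^sub>R esin k) (L2_of (deriv \<phi>))" for k
      by (simp add: s[OF \<phi>] a_def)
    ultimately show "inner v (L2_of (deriv \<phi>)) = - inner p (L2_of \<phi>)"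
      using sums_unique2 by fastforce
  qed
  have pg: "has_weak_deriv p (- g)"
    unfolding has_weak_deriv_def
  proof (intro allI impI)
    fix \<phi> assume \<phi>: "test_function \<phi>"
    have "(\<lambda>k. inner (a k *\<^sub>R ecos k) (L2_of (deriv \<phi>))) sums inner p (L2_of (deriv \<phi>))"
      by (rule bounded_linear.sums[OF bounded_linear_inner_left psums])
    moreover have "(\<lambda>k. inner (coef g k *\<^sub>R esin k) (L2_of \<phi>)) sums inner g (L2_of \<phi>)"
      by (rule bounded_linear.sums[OF bounded_linear_inner_left coef_sums])
    moreover have "inner (coef g k *\<^sub>R esin k) (L2_of \<phi>) = inner (a k *\<^sub>R ecos k) (L2_of (deriv \<phi>))" for k
      by (simp add: c[OF \<phi>] a_def g lam_def power2_eq_square)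
    ultimately show "inner p (L2_of (deriv \<phi>)) = - inner (- g) (L2_of \<phi>)"
      using sums_unique2 by fastforce
  qed
  have wv: "weak_deriv v = p" "weak_deriv p = - g"
    using vp pg by (auto intro: weak_deriv_eq)
  have "v \<in> H1_0"
    unfolding H1_0_def
  proof (intro CollectI conjI allI impI)
    show "v \<in> H1" using vp by (auto simp: H1_def)
    fix \<epsilon> :: real assume \<epsilon>: "\<epsilon> > 0"
    define F where "F N x = (\<Sum>k<N. coef v k * sinb k x)" for N x
    have smF: "smooth_fun (F N)" for N
      unfolding F_def by (intro smooth_fun_sum smooth_fun_mult smooth_fun_const smooth_fun_sinb)
    have dF: "deriv (F N) = (\<lambda>x. \<Sum>k<N. a k * cosb k x)" for N
    proof
      fix x
      have "(F N has_field_derivative (\<Sum>k<N. coef v k * (freq k * cosb k x))) (at x)"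
        unfolding F_def by (intro DERIV_sum DERIV_cmult sinb_deriv)
      then show "deriv (F N) x = (\<Sum>k<N. a k * cosb k x)"
        by (simp add: DERIV_imp_deriv a_def mult_ac)
    qed
    have "(\<lambda>N. L2_of (F N)) \<longlonglongrightarrow> v"
      using coef_sums[of v] unfolding sums_def F_def
      by (simp add: L2_of_sum square_int_scale L2_of_scale esin_def)
    moreover have "(\<lambda>N. L2_of (deriv (F N))) \<longlonglongrightarrow> p"
      using psums unfolding sums_def dF
      by (simp add: L2_of_sum square_int_scale L2_of_scale ecos_def)
    \<comment> \<open>A quarter each: function and derivative are approximated first by a partial
      sum and then by a test function.\<close>
    ultimately have "\<forall>\<^sub>F N in sequentially. dist (L2_of (F N)) v < \<epsilon> / 4 \<and> dist (L2_of (deriv (F N))) p < \<epsilon> / 4"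
      using \<epsilon> by (intro eventually_conj tendstoD) auto
    then obtain N where N: "dist (L2_of (F N)) v < \<epsilon> / 4" "dist (L2_of (deriv (F N))) p < \<epsilon> / 4"
      by (auto simp: eventually_sequentially)
    have F01: "F N 0 = 0" "F N 1 = 0" by (simp_all add: F_def)
    obtain \<phi> where \<phi>: "\<And>n. test_function (\<phi> n)" "(\<lambda>n. L2_of (\<phi> n)) \<longlonglongrightarrow> L2_of (F N)"
        "(\<lambda>n. L2_of (deriv (\<phi> n))) \<longlonglongrightarrow> L2_of (deriv (F N))"
      using test_function_approx[OF smF F01] by metis
    have "\<forall>\<^sub>F n in sequentially. dist (L2_of (\<phi> n)) (L2_of (F N)) < \<epsilon> / 4
        \<and> dist (L2_of (deriv (\<phi> n))) (L2_of (deriv (F N))) < \<epsilon> / 4"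
      using \<epsilon> by (intro eventually_conj tendstoD \<phi>) auto
    then obtain n where n: "dist (L2_of (\<phi> n)) (L2_of (F N)) < \<epsilon> / 4"
        "dist (L2_of (deriv (\<phi> n))) (L2_of (deriv (F N))) < \<epsilon> / 4"
      by (auto simp: eventually_sequentially)
    have "weak_deriv (v - L2_of (\<phi> n)) = p - L2_of (deriv (\<phi> n))"
      using \<phi>(1)[of n] by (intro weak_deriv_eq has_weak_deriv_diff vp has_weak_deriv_smooth)
        (simp add: test_function_iff)
    then have "H1_norm (v - L2_of (\<phi> n)) \<le> dist v (L2_of (\<phi> n)) + dist p (L2_of (deriv (\<phi> n)))"
      unfolding H1_norm_def dist_norm by (simp add: sqrt_sum_squares_le_sum)
    also have "\<dots> < \<epsilon>"
      using n N dist_triangle[of v "L2_of (\<phi> n)" "L2_of (F N)"]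
        dist_triangle[of p "L2_of (deriv (\<phi> n))" "L2_of (deriv (F N))"]
      by (simp add: dist_commute)
    finally show "\<exists>\<phi>. test_function \<phi> \<and> H1_norm (v - L2_of \<phi>) < \<epsilon>"
      using \<phi>(1) by blast
  qed
  then show "v \<in> dom_A"
    using vp pg wv by (auto simp: dom_A_def H2_def H1_def)
  show "op_A v = g"
    by (simp add: op_A_def wv)
qed

section \<open>The continuously differentiable representative of an element of the domain\<close>

definition ser :: "L2 \<Rightarrow> real \<Rightarrow> real" where
  "ser v x = (\<Sum>k. coef v k * sinb k x)"

definition ser' :: "L2 \<Rightarrow> real \<Rightarrow> real" where
  "ser' v x = (\<Sum>k. coef v k * (freq k * cosb k x))"

definition par :: "L2 \<Rightarrow> nat \<Rightarrow> real \<Rightarrow> real" where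
  "par v N x = (\<Sum>k<N. coef v k * sinb k x)"

definition par' :: "L2 \<Rightarrow> nat \<Rightarrow> real \<Rightarrow> real" where
  "par' v N x = (\<Sum>k<N. coef v k * (freq k * cosb k x))"

text \<open>On the domain, \<open>par\<close> and \<open>par'\<close> converge uniformly, but these
  sums are only known to converge in norm. Integrations by parts are therefore done on partial sums
  before passing to the limit.\<close>

definition par'' :: "L2 \<Rightarrow> nat \<Rightarrow> real \<Rightarrow> real" where
  "par'' v N x = (\<Sum>k<N. coef v k * (- lam k * sinb k x))"

lemma par_deriv: "(par v N has_field_derivative par' v N x) (at x)"
  unfolding par_def par'_def by (intro DERIV_sum DERIV_cmult sinb_deriv)

lemma par'_deriv: "(par' v N has_field_derivative par'' v N x) (at x)"
proof -
  have "((\<lambda>x. coef v k * (freq k * cosb k x)) has_field_derivative coef v k * (freq k * (- (freq k * sinb k x)))) (at x)" for k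
    by (intro DERIV_cmult cosb_deriv)
  then have "(par' v N has_field_derivative (\<Sum>k<N. coef v k * (freq k * (- (freq k * sinb k x))))) (at x)"
    unfolding par'_def by (intro DERIV_sum)
  then show ?thesis
    by (simp add: par''_def lam_def power2_eq_square mult_ac)
qed

lemma continuous_on_par [continuous_intros]:
  "continuous_on S (par v N)" "continuous_on S (par' v N)" "continuous_on S (par'' v N)"
  unfolding par_def[abs_def] par'_def[abs_def] par''_def[abs_def] by (intro continuous_intros)+

lemma par_ends [simp]: "par v N 0 = 0" "par v N 1 = 0"
  by (simp_all add: par_def)

lemma summable_inverse_freq: "summable (\<lambda>k. (1 / freq k)\<^sup>2)"
proof (rule summable_comparison_test'[where N = 0])
  show "summable (\<lambda>k. inverse ((real (Suc k)) ^ 2))"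
    using inverse_power_summable[of 2, where 'a = real] summable_Suc_iff[of "\<lambda>n. inverse (real n ^ 2)"]
    by simp
  fix k :: nat
  have "real (Suc k) * 1 \<le> freq k"
    unfolding freq_def using pi_gt3 by (intro mult_left_mono) auto
  then have "(real (Suc k))\<^sup>2 \<le> (freq k)\<^sup>2"
    by (intro power_mono) auto
  then show "norm ((1 / freq k)\<^sup>2) \<le> inverse ((real (Suc k)) ^ 2)"
    by (simp add: power_divide inverse_eq_divide frac_le del: of_nat_Suc)
qed

text \<open>The term is the coefficient of \<open>op_A v\<close> divided by \<open>freq k\<close>,
  up to sign; the product of two square summable sequences is summable. This is the embedding of the
  domain into the continuously differentiable functions.\<close>

lemma summable_freq_coef:
  assumes "v \<in> dom_A"
  shows "summable (\<lambda>k. \<bar>coef v k\<bar> * freq k)"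
proof (rule summable_comparison_test'[where N = 0])
  show "summable (\<lambda>k. (coef (op_A v) k)\<^sup>2 + (1 / freq k)\<^sup>2)"
    by (intro summable_add summable_coef summable_inverse_freq)
  fix k
  have "\<bar>coef v k\<bar> * freq k = \<bar>coef (op_A v) k\<bar> * (1 / freq k)"
    by (simp add: coef_op_A[OF assms] lam_def abs_mult power2_eq_square)
  moreover have "2 * (\<bar>coef (op_A v) k\<bar> * (1 / freq k)) \<le> (coef (op_A v) k)\<^sup>2 + (1 / freq k)\<^sup>2"
    using sum_squares_bound[of "\<bar>coef (op_A v) k\<bar>" "1 / freq k"] by (simp add: mult.assoc)
  moreover have "0 \<le> \<bar>coef v k\<bar> * freq k"
    by (simp add: less_imp_le)
  ultimately show "norm (\<bar>coef v k\<bar> * freq k) \<le> (coef (op_A v) k)\<^sup>2 + (1 / freq k)\<^sup>2"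
    by simp
qed

lemma uniform_limit_sine_series:
  assumes "summable (\<lambda>k. \<bar>a k\<bar>)"
  shows "uniform_limit UNIV (\<lambda>N x. \<Sum>k<N. a k * sinb k x) (\<lambda>x. \<Sum>k. a k * sinb k x) sequentially"
    and "\<And>x. summable (\<lambda>k. a k * sinb k x)"
proof -
  have b: "norm (a k * sinb k x) \<le> \<bar>a k\<bar> * sqrt 2" for k x
    using abs_sinb_le[of k x] by (auto simp: abs_mult intro!: mult_left_mono)
  have s: "summable (\<lambda>k. \<bar>a k\<bar> * sqrt 2)"
    by (intro summable_mult2 assms)
  show "uniform_limit UNIV (\<lambda>N x. \<Sum>k<N. a k * sinb k x) (\<lambda>x. \<Sum>k. a k * sinb k x) sequentially"
    by (rule Weierstrass_m_test[OF b s])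
  show "summable (\<lambda>k. a k * sinb k x)" for x
    by (rule summable_comparison_test'[OF s b])
qed

lemma uniform_limit_eventually_le:
  fixes f :: "nat \<Rightarrow> real \<Rightarrow> real"
  assumes "uniform_limit UNIV f g sequentially"
  obtains N where "\<And>n x. n \<ge> N \<Longrightarrow> \<bar>f n x - g x\<bar> \<le> 1"
proof -
  have "\<forall>\<^sub>F n in sequentially. \<forall>x\<in>UNIV. dist (f n x) (g x) < 1"
    using assms by (rule uniform_limitD) simp
  then show thesis
    using that unfolding eventually_sequentially dist_real_def by (metis UNIV_I less_imp_le)
qed

lemma L2_of_sine_series:
  assumes "summable (\<lambda>k. \<bar>a k\<bar>)" "summable (\<lambda>k. (a k)\<^sup>2)"
  shows "L2_of (\<lambda>x. \<Sum>k. a k * sinb k x) = synth a" "square_int (\<lambda>x. \<Sum>k. a k * sinb k x)"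
proof -
  note ul = uniform_limit_sine_series(1)[OF assms(1)]
  have "continuous_on UNIV (\<lambda>x. \<Sum>k. a k * sinb k x)"
    by (rule uniform_limit_theorem[OF _ ul]) (auto intro!: always_eventually continuous_intros)
  then show sq: "square_int (\<lambda>x. \<Sum>k. a k * sinb k x)"
    by (intro square_int_continuous) (rule continuous_on_subset, auto)
  obtain N where N: "\<And>n x. n \<ge> N \<Longrightarrow> \<bar>(\<Sum>k<n. a k * sinb k x) - (\<Sum>k. a k * sinb k x)\<bar> \<le> 1"
    using uniform_limit_eventually_le[OF ul] by metis
  \<comment> \<open>The uniform error is at most 1 only from index \<open>N\<close> on; the shift by
    \<open>N\<close> makes the constant 1 a majorant for all \<open>n\<close> and is undone
    afterwards.\<close>
  have "(\<lambda>n. L2_of (\<lambda>x. \<Sum>k<n + N. a k * sinb k x)) \<longlonglongrightarrow> L2_of (\<lambda>x. \<Sum>k. a k * sinb k x)"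
  proof (rule L2_tendsto_dominated[where h = "\<lambda>_. 1"])
    show "AE x in unit_measure. (\<lambda>n. \<Sum>k<n + N. a k * sinb k x) \<longlonglongrightarrow> (\<Sum>k. a k * sinb k x)"
      by (intro AE_I2 LIMSEQ_ignore_initial_segment summable_LIMSEQ uniform_limit_sine_series(2)[OF assms(1)])
  qed (auto intro!: AE_I2 N square_int_sum square_int_scale sq square_int_const)
  moreover have "L2_of (\<lambda>x. \<Sum>k<n. a k * sinb k x) = (\<Sum>k<n. a k *\<^sub>R esin k)" for n
    by (simp add: L2_of_sum square_int_scale L2_of_scale esin_def)
  ultimately have "(\<lambda>n. \<Sum>k<n + N. a k *\<^sub>R esin k) \<longlonglongrightarrow> L2_of (\<lambda>x. \<Sum>k. a k * sinb k x)"
    by simp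
  then have "(\<lambda>n. \<Sum>k<n. a k *\<^sub>R esin k) \<longlonglongrightarrow> L2_of (\<lambda>x. \<Sum>k. a k * sinb k x)"
    by (rule LIMSEQ_offset)
  then show "L2_of (\<lambda>x. \<Sum>k. a k * sinb k x) = synth a"
    unfolding synth_def sums_def[symmetric] by (rule sums_unique)
qed

context
  fixes v assumes v: "v \<in> dom_A"
begin

lemma summable_abs_coef: "summable (\<lambda>k. \<bar>coef v k\<bar>)"
proof (rule summable_comparison_test'[OF summable_freq_coef[OF v]])
  fix k show "norm \<bar>coef v k\<bar> \<le> \<bar>coef v k\<bar> * freq k"
    using mult_left_mono[OF freq_ge_1[of k], of "\<bar>coef v k\<bar>"] by simp
qed

lemma L2_of_ser: "L2_of (ser v) = v" "square_int (ser v)"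
  using L2_of_sine_series[OF summable_abs_coef summable_coef] by (simp_all add: ser_def[abs_def])

lemma uniform_limit_par: "uniform_limit UNIV (par v) (ser v) sequentially"
  unfolding par_def[abs_def] ser_def[abs_def]
  by (rule uniform_limit_sine_series[OF summable_abs_coef])

lemma uniform_limit_par': "uniform_limit UNIV (par' v) (ser' v) sequentially"
  unfolding par'_def[abs_def] ser'_def[abs_def]
proof (rule Weierstrass_m_test)
  show "summable (\<lambda>k. (\<bar>coef v k\<bar> * freq k) * sqrt 2)"
    by (intro summable_mult2 summable_freq_coef v)
  show "norm (coef v k * (freq k * cosb k x)) \<le> (\<bar>coef v k\<bar> * freq k) * sqrt 2" for k x
    unfolding real_norm_def abs_mult mult.assoc[symmetric]
    using abs_cosb_le[of k x] by (intro mult_mono) (auto simp: less_imp_le)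
qed

lemma ser_deriv: "(ser v has_field_derivative ser' v x) (at x)"
proof -
  have d: "((\<lambda>x. coef v k * sinb k x) has_field_derivative coef v k * (freq k * cosb k x)) (at x within UNIV)"
    for k x by (intro DERIV_cmult sinb_deriv)
  have "uniformly_convergent_on UNIV (\<lambda>N x. \<Sum>k<N. coef v k * (freq k * cosb k x))"
    using uniform_limit_par' unfolding par'_def[abs_def] uniformly_convergent_on_def by blast
  from has_field_derivative_series'(2)[OF convex_UNIV d this, of 0 x] show ?thesis
    by (simp add: ser_def[abs_def] ser'_def)
qed

lemma continuous_on_ser': "continuous_on S (ser' v)"
proof -
  have "continuous_on UNIV (ser' v)"
    by (rule uniform_limit_theorem[OF _ uniform_limit_par']) (auto intro!: always_eventually continuous_intros)
  then show ?thesis by (rule continuous_on_subset) simp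
qed

lemma continuous_on_ser: "continuous_on S (ser v)"
  using ser_deriv by (meson DERIV_isCont continuous_at_imp_continuous_on)

lemma par_tendsto: "(\<lambda>N. par v N x) \<longlonglongrightarrow> ser v x" "(\<lambda>N. par' v N x) \<longlonglongrightarrow> ser' v x"
  using uniform_limit_par uniform_limit_par' by (auto intro: tendsto_uniform_limitI)

lemma par''_tendsto: "(\<lambda>N. L2_of (par'' v N)) \<longlonglongrightarrow> - op_A v"
proof -
  have "L2_of (par'' v N) = (\<Sum>k<N. - (coef (op_A v) k *\<^sub>R esin k))" for N
  proof -
    have "par'' v N = (\<lambda>x. \<Sum>k<N. (- coef (op_A v) k) * sinb k x)"
      unfolding par''_def[abs_def] by (simp add: coef_op_A[OF v] mult_ac)
    then have "L2_of (par'' v N) = (\<Sum>k<N. L2_of (\<lambda>x. (- coef (op_A v) k) * sinb k x))"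
      by (simp only: L2_of_sum square_int_scale square_int_sinb)
    also have "\<dots> = (\<Sum>k<N. (- coef (op_A v) k) *\<^sub>R esin k)"
      by (subst L2_of_scale) (auto simp: esin_def)
    finally show ?thesis by simp
  qed
  then show ?thesis
    using sums_minus[OF coef_sums[of "op_A v"]] by (simp add: sums_def)
qed

text \<open>
  Testing with \<open>j (u)\<close>, where \<open>j\<close> is smooth, increasing and vanishes exactly on the
  non-negative half line, is the weak maximum principle.
\<close>

lemma op_A_inner_flat_nonneg: "0 \<le> inner (op_A v) (L2_of (\<lambda>x. - flat 1 (- ser v x)))"
proof -
  define j where "j s = - flat 1 (- s)" for s
  have jd: "(j has_field_derivative flat [:0, 0, 1:] (- s)) (at s)" for s
    unfolding j_def by (rule derivative_eq_intros DERIV_chain2[OF flat_one_deriv] | simp)+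
  have jc: "continuous_on S j" for S
    using jd by (meson DERIV_isCont continuous_at_imp_continuous_on)
  have j2c: "continuous_on S (\<lambda>s. flat [:0, 0, 1:] (- s))" for S
    by (rule continuous_on_compose2[OF smooth_fun_continuous[OF smooth_fun_flat, of UNIV]])
      (auto intro!: continuous_intros)
  have jpar: "continuous_on {0..1} (\<lambda>x. j (par v N x))" for N
    by (rule continuous_on_compose2[OF jc[of UNIV] continuous_on_par(1)]) simp
  have le: "inner (L2_of (par'' v N)) (L2_of (\<lambda>x. j (par v N x))) \<le> 0" for N
  proof -
    let ?q = "\<lambda>x. flat [:0, 0, 1:] (- par v N x) * (par' v N x)\<^sup>2"
    have c: "continuous_on {0..1} ?q"
      by (intro continuous_intros continuous_on_compose2[OF j2c[of UNIV] continuous_on_par(1)]) simp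
    have "(\<integral>x. par'' v N x * j (par v N x) + ?q x \<partial>unit_measure)
        = par' v N 1 * j (par v N 1) - par' v N 0 * j (par v N 0)"
    proof (rule integral_derivative_unit)
      fix x
      show "((\<lambda>x. par' v N x * j (par v N x)) has_field_derivative par'' v N x * j (par v N x) + ?q x) (at x)"
        using DERIV_mult[OF par'_deriv DERIV_chain2[OF jd par_deriv]]
        by (simp add: algebra_simps power2_eq_square)
    qed (intro continuous_intros jpar c)
    \<comment> \<open>No boundary term remains: the partial sums vanish at both ends and
      \<open>j 0\<close> is 0.\<close>
    also have "\<dots> = 0" by (simp add: j_def flat_one)
    finally have "(\<integral>x. par'' v N x * j (par v N x) \<partial>unit_measure) = - (\<integral>x. ?q x \<partial>unit_measure)"
      using integrable_continuous_unit[OF c]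
        integrable_continuous_unit[OF continuous_on_mult[OF continuous_on_par(3)[of _ v N] jpar]] by simp
    moreover have "0 \<le> (\<integral>x. ?q x \<partial>unit_measure)"
      by (intro Bochner_Integration.integral_nonneg) (auto simp: flat_two)
    ultimately show ?thesis
      by (subst inner_L2_of) (auto intro!: square_int_continuous continuous_intros jpar)
  qed
  have "(\<lambda>N. L2_of (\<lambda>x. j (par v N x))) \<longlonglongrightarrow> L2_of (\<lambda>x. j (ser v x))"
  proof (rule L2_tendsto_dominated[where h = "\<lambda>_. 1"])
    show "square_int (\<lambda>x. j (par v N x))" for N
      by (intro square_int_continuous jpar)
    show "square_int (\<lambda>x. j (ser v x))"
      by (intro square_int_continuous, rule continuous_on_compose2[OF jc[of UNIV] continuous_on_ser]) simp
    have "isCont j s" for s using jd by (rule DERIV_isCont)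
    then show "AE x in unit_measure. (\<lambda>N. j (par v N x)) \<longlonglongrightarrow> j (ser v x)"
      by (intro AE_I2 isCont_tendsto_compose[OF _ par_tendsto(1)])
    show "AE x in unit_measure. \<bar>j (par v N x) - j (ser v x)\<bar> \<le> 1" for N
    proof (rule AE_I2)
      fix x show "\<bar>j (par v N x) - j (ser v x)\<bar> \<le> 1"
        using flat_one_bounds[of "- par v N x"] flat_one_bounds[of "- ser v x"]
        by (simp add: j_def abs_le_iff)
    qed
  qed (rule square_int_const)
  from tendsto_inner[OF par''_tendsto this]
  have "inner (- op_A v) (L2_of (\<lambda>x. j (ser v x))) \<le> 0"
    by (rule LIMSEQ_le_const2) (use le in auto)
  then show ?thesis by (simp add: j_def)
qed

text \<open>
  The second derivative vanishes almost everywhere on the zero set of the first one: the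
  functions \<open>1 / (1 + (u' / \<epsilon>)\<^sup>2)\<close> tend to the indicator of that set, while
  \<open>\<epsilon> arctan (u' / \<epsilon>)\<close>, whose derivative is \<open>u'' / (1 + (u' / \<epsilon>)\<^sup>2)\<close>, tends to 0 uniformly.
\<close>

lemma op_A_critical_bound:
  assumes \<epsilon>: "\<epsilon> > 0"
  shows "\<bar>inner (op_A v) (L2_of (\<lambda>x. sinb k x / (1 + (ser' v x / \<epsilon>)\<^sup>2)))\<bar> \<le> \<epsilon> * (2 * freq k * sqrt 2)"
proof -
  define \<beta> where "\<beta> s = 1 / (1 + (s / \<epsilon>)\<^sup>2)" for s
  have pos: "1 + (s / \<epsilon>)\<^sup>2 > 0" for s
    by (simp add: add_pos_nonneg)
  then have nz: "1 + (s / \<epsilon>)\<^sup>2 \<noteq> 0" for s by (metis less_irrefl)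
  have \<beta>: "0 \<le> \<beta> s" "\<beta> s \<le> 1" for s
    using pos[of s] by (simp_all add: \<beta>_def)
  have \<beta>c: "continuous_on S \<beta>" for S
    unfolding \<beta>_def using \<epsilon> nz by (intro continuous_intros) auto
  have \<beta>par: "continuous_on {0..1} (\<lambda>x. \<beta> (par' v N x) * sinb k x)" for N
    by (intro continuous_intros continuous_on_compose2[OF \<beta>c[of UNIV] continuous_on_par(2)]) simp
  have ad: "((\<lambda>s. \<epsilon> * arctan (s / \<epsilon>)) has_field_derivative \<beta> s) (at s)" for s
    unfolding \<beta>_def using \<epsilon> by (auto intro!: derivative_eq_intros simp: divide_simps)
  have ac: "continuous_on S (\<lambda>s. \<epsilon> * arctan (s / \<epsilon>))" for S
    using ad by (meson DERIV_isCont continuous_at_imp_continuous_on)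
  have le: "\<bar>inner (L2_of (par'' v N)) (L2_of (\<lambda>x. \<beta> (par' v N x) * sinb k x))\<bar> \<le> \<epsilon> * (2 * freq k * sqrt 2)" for N
  proof -
    let ?q = "\<lambda>x. \<epsilon> * arctan (par' v N x / \<epsilon>) * (freq k * cosb k x)"
    have c: "continuous_on {0..1} ?q"
      by (intro continuous_intros continuous_on_compose2[OF ac[of UNIV] continuous_on_par(2)]) (use \<epsilon> in auto)
    have "(\<integral>x. par'' v N x * (\<beta> (par' v N x) * sinb k x) + ?q x \<partial>unit_measure)
        = \<epsilon> * arctan (par' v N 1 / \<epsilon>) * sinb k 1 - \<epsilon> * arctan (par' v N 0 / \<epsilon>) * sinb k 0"
    proof (rule integral_derivative_unit)
      fix x
      show "((\<lambda>x. \<epsilon> * arctan (par' v N x / \<epsilon>) * sinb k x) has_field_derivative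
          par'' v N x * (\<beta> (par' v N x) * sinb k x) + ?q x) (at x)"
        using DERIV_mult[OF DERIV_chain2[OF ad par'_deriv[of v N x]] sinb_deriv[of k x]]
        by (simp add: algebra_simps)
    qed (intro continuous_intros \<beta>par c)
    then have "(\<integral>x. par'' v N x * (\<beta> (par' v N x) * sinb k x) \<partial>unit_measure) = - (\<integral>x. ?q x \<partial>unit_measure)"
      using integrable_continuous_unit[OF c]
        integrable_continuous_unit[OF continuous_on_mult[OF continuous_on_par(3)[of _ v N] \<beta>par]] by simp
    moreover have "\<bar>\<integral>x. ?q x \<partial>unit_measure\<bar> \<le> (\<integral>x. \<epsilon> * (2 * freq k * sqrt 2) \<partial>unit_measure)"
    proof (rule order_trans[OF integral_abs_bound integral_mono])
      fix x
      \<comment> \<open>The constant 2 exceeds \<pi> / 2. As arctan is bounded, the integral is of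
        order \<open>\<epsilon>\<close> however large \<open>par'\<close> is, uniformly in
        \<open>N\<close>.\<close>
      have "\<bar>arctan (par' v N x / \<epsilon>)\<bar> \<le> 2"
        using arctan_bounded[of "par' v N x / \<epsilon>"] pi_less_4 by (simp add: abs_le_iff)
      then have "\<bar>?q x\<bar> \<le> \<epsilon> * 2 * (freq k * sqrt 2)"
        unfolding abs_mult using \<epsilon> abs_cosb_le[of k x] by (intro mult_mono) (auto simp: less_imp_le)
      then show "\<bar>?q x\<bar> \<le> \<epsilon> * (2 * freq k * sqrt 2)" by (simp add: mult_ac)
    qed (use integrable_continuous_unit[OF c] in auto)
    ultimately show ?thesis
      by (subst inner_L2_of)
        (auto intro!: square_int_continuous continuous_intros \<beta>par simp: measure_unit_measure)
  qed
  have "(\<lambda>N. L2_of (\<lambda>x. \<beta> (par' v N x) * sinb k x)) \<longlonglongrightarrow> L2_of (\<lambda>x. \<beta> (ser' v x) * sinb k x)"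
  proof (rule L2_tendsto_dominated[where h = "\<lambda>_. 1 * sqrt 2"])
    show "square_int (\<lambda>x. \<beta> (par' v N x) * sinb k x)" for N
      by (intro square_int_continuous \<beta>par)
    show "square_int (\<lambda>x. \<beta> (ser' v x) * sinb k x)"
      by (intro square_int_continuous continuous_intros
          continuous_on_compose2[OF \<beta>c[of UNIV] continuous_on_ser']) simp
    have "isCont \<beta> s" for s using \<beta>c[of UNIV] by (simp add: continuous_on_eq_continuous_at)
    then show "AE x in unit_measure. (\<lambda>N. \<beta> (par' v N x) * sinb k x) \<longlonglongrightarrow> \<beta> (ser' v x) * sinb k x"
      by (intro AE_I2 tendsto_mult tendsto_const isCont_tendsto_compose[OF _ par_tendsto(2)])
    show "AE x in unit_measure. \<bar>\<beta> (par' v N x) * sinb k x - \<beta> (ser' v x) * sinb k x\<bar> \<le> 1 * sqrt 2" for N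
    proof (rule AE_I2)
      fix x
      have "\<bar>\<beta> (par' v N x) - \<beta> (ser' v x)\<bar> \<le> 1"
        using \<beta>[of "par' v N x"] \<beta>[of "ser' v x"] by (simp add: abs_le_iff)
      then show "\<bar>\<beta> (par' v N x) * sinb k x - \<beta> (ser' v x) * sinb k x\<bar> \<le> 1 * sqrt 2"
        unfolding left_diff_distrib[symmetric] abs_mult using abs_sinb_le[of k x]
        by (intro mult_mono) auto
    qed
  qed (rule square_int_const)
  from tendsto_rabs[OF tendsto_inner[OF par''_tendsto this]]
  have "\<bar>inner (- op_A v) (L2_of (\<lambda>x. \<beta> (ser' v x) * sinb k x))\<bar> \<le> \<epsilon> * (2 * freq k * sqrt 2)"
    by (rule LIMSEQ_le_const2) (use le in auto)
  then show ?thesis by (simp add: \<beta>_def)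
qed

text \<open>Letting \<open>\<epsilon>\<close> tend to 0 in the preceding bound shows that
  \<open>op_A v\<close>, multiplied by the indicator of the critical set, is orthogonal to every
  sine; such a function is 0.\<close>

lemma op_A_zero_on_critical: "AE x in unit_measure. ser' v x = 0 \<longrightarrow> rep_L2 (op_A v) x = 0"
proof -
  define q where "q = rep_L2 (op_A v)"
  define crit where "crit x = (if ser' v x = 0 then 1 else 0 :: real)" for x
  have q: "square_int q" "op_A v = L2_of q" by (simp_all add: q_def square_int_rep)
  have serm: "ser' v \<in> borel_measurable unit_measure"
    by (rule borel_measurable_unit_continuous[OF continuous_on_ser'])
  then have critm: "crit \<in> borel_measurable unit_measure"
    unfolding crit_def by measurable
  have sqcrit: "square_int (\<lambda>x. crit x * f x)" if "square_int f" for f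
  proof (rule square_int_mono[OF _ that])
    show "(\<lambda>x. crit x * f x) \<in> borel_measurable unit_measure"
      by (intro borel_measurable_times critm square_int_measurable that)
  qed (simp add: crit_def)
  have "inner (L2_of (\<lambda>x. crit x * q x)) (esin k) = 0" for k
  proof -
    define \<epsilon> where "\<epsilon> n = inverse (real (Suc n))" for n
    have \<epsilon>: "\<epsilon> n > 0" "\<epsilon> \<longlonglongrightarrow> 0" for n
      using LIMSEQ_inverse_real_of_nat by (auto simp: \<epsilon>_def[abs_def])
    have sqn: "square_int (\<lambda>x. sinb k x / (1 + (ser' v x / \<epsilon> n)\<^sup>2))" for n
    proof (intro square_int_continuous continuous_intros continuous_on_ser' ballI)
      fix x have "1 + (ser' v x / \<epsilon> n)\<^sup>2 > 0" by (simp add: add_pos_nonneg)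
      then show "1 + (ser' v x / \<epsilon> n)\<^sup>2 \<noteq> 0" by simp
    qed (use \<epsilon>(1)[of n] in auto)
    have "(\<lambda>n. L2_of (\<lambda>x. sinb k x / (1 + (ser' v x / \<epsilon> n)\<^sup>2))) \<longlonglongrightarrow> L2_of (\<lambda>x. crit x * sinb k x)"
    proof (rule L2_tendsto_dominated[where h = "\<lambda>_. 2 * sqrt 2"])
      show "AE x in unit_measure. (\<lambda>n. sinb k x / (1 + (ser' v x / \<epsilon> n)\<^sup>2)) \<longlonglongrightarrow> crit x * sinb k x"
      proof (rule AE_I2)
        fix x
        show "(\<lambda>n. sinb k x / (1 + (ser' v x / \<epsilon> n)\<^sup>2)) \<longlonglongrightarrow> crit x * sinb k x"
        proof (cases "ser' v x = 0")
          case False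
          have "(\<lambda>n. (\<epsilon> n)\<^sup>2 * sinb k x / ((\<epsilon> n)\<^sup>2 + (ser' v x)\<^sup>2)) \<longlonglongrightarrow> 0\<^sup>2 * sinb k x / (0\<^sup>2 + (ser' v x)\<^sup>2)"
            using False by (intro tendsto_intros \<epsilon>) auto
          moreover have "(\<epsilon> n)\<^sup>2 * sinb k x / ((\<epsilon> n)\<^sup>2 + (ser' v x)\<^sup>2) = sinb k x / (1 + (ser' v x / \<epsilon> n)\<^sup>2)" for n
          proof -
            have "(\<epsilon> n)\<^sup>2 + (ser' v x)\<^sup>2 > 0" "1 + (ser' v x / \<epsilon> n)\<^sup>2 > 0"
              using \<epsilon>(1)[of n] by (auto intro: add_pos_nonneg)
            then show ?thesis using \<epsilon>(1)[of n] by (simp add: field_simps)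
          qed
          ultimately show ?thesis using False by (simp add: crit_def)
        qed (simp add: crit_def)
      qed
      show "AE x in unit_measure. \<bar>sinb k x / (1 + (ser' v x / \<epsilon> n)\<^sup>2) - crit x * sinb k x\<bar> \<le> 2 * sqrt 2" for n
      proof (rule AE_I2)
        fix x
        have "\<bar>sinb k x / (1 + (ser' v x / \<epsilon> n)\<^sup>2)\<bar> \<le> \<bar>sinb k x\<bar> / 1"
          unfolding abs_divide by (intro divide_left_mono) (auto simp: add_pos_nonneg)
        moreover have "\<bar>crit x * sinb k x\<bar> \<le> \<bar>sinb k x\<bar>" by (auto simp: crit_def)
        ultimately show "\<bar>sinb k x / (1 + (ser' v x / \<epsilon> n)\<^sup>2) - crit x * sinb k x\<bar> \<le> 2 * sqrt 2"
          using abs_sinb_le[of k x] by linarith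
      qed
    qed (auto intro!: sqn sqcrit square_int_const)
    from tendsto_rabs[OF tendsto_inner[OF tendsto_const this]]
    have "(\<lambda>n. \<bar>inner (op_A v) (L2_of (\<lambda>x. sinb k x / (1 + (ser' v x / \<epsilon> n)\<^sup>2)))\<bar>)
      \<longlonglongrightarrow> \<bar>inner (op_A v) (L2_of (\<lambda>x. crit x * sinb k x))\<bar>" .
    moreover have "(\<lambda>n. \<epsilon> n * (2 * freq k * sqrt 2)) \<longlonglongrightarrow> 0 * (2 * freq k * sqrt 2)"
      by (intro tendsto_intros \<epsilon>)
    ultimately have "\<bar>inner (op_A v) (L2_of (\<lambda>x. crit x * sinb k x))\<bar> \<le> 0 * (2 * freq k * sqrt 2)"
      by (rule LIMSEQ_le) (use op_A_critical_bound[OF \<epsilon>(1)] in auto)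
    then have "inner (L2_of q) (L2_of (\<lambda>x. crit x * sinb k x)) = 0"
      by (simp add: q)
    then show ?thesis
      by (simp add: esin_def inner_L2_of sqcrit q mult_ac)
  qed
  then have "L2_of (\<lambda>x. crit x * q x) = 0" by (rule esin_total)
  then have "AE x in unit_measure. crit x * q x = 0"
    by (simp add: L2_of_eq_zero_iff sqcrit q)
  then show ?thesis
    by eventually_elim (auto simp: crit_def q_def)
qed

end

section \<open>The heat semigroup\<close>

text \<open>The inverse of \<open>1 + h A\<close>, that is, one implicit Euler step of length
  \<open>h\<close>.\<close>

definition resolvent :: "real \<Rightarrow> L2 \<Rightarrow> L2" where
  "resolvent h v = synth (\<lambda>k. 1 / (1 + h * lam k) * coef v k)"

definition heat :: "real \<Rightarrow> L2 \<Rightarrow> L2" where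
  "heat t v = synth (\<lambda>k. exp (- lam k * t) * coef v k)"

lemma resolvent_factor: "0 \<le> h \<Longrightarrow> 0 < 1 + h * lam k" "0 \<le> h \<Longrightarrow> \<bar>1 / (1 + h * lam k)\<bar> \<le> 1"
proof -
  assume "0 \<le> h"
  then have "0 \<le> h * lam k" by (simp add: less_imp_le)
  then show "0 < 1 + h * lam k" "\<bar>1 / (1 + h * lam k)\<bar> \<le> 1" by simp_all
qed

lemma coef_resolvent: "0 \<le> h \<Longrightarrow> coef (resolvent h v) k = 1 / (1 + h * lam k) * coef v k"
  unfolding resolvent_def
  by (rule coef_synth, rule summable_square_bound[of _ 1 v], subst abs_mult,
      intro mult_right_mono resolvent_factor) auto

lemma coef_heat: "0 \<le> t \<Longrightarrow> coef (heat t v) k = exp (- lam k * t) * coef v k"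
  unfolding heat_def
  by (rule coef_synth, rule summable_square_bound[of _ 1 v], subst abs_mult, intro mult_right_mono)
    (auto simp: less_imp_le)

text \<open>The equation for \<open>g\<close> is \<open>g + h A g = v\<close>. Tested with
  \<open>J\<close>, which is negative exactly where \<open>g\<close> is, it gives
  \<open>inner g J \<le> inner v J \<le> 0\<close>, writing \<open>J\<close> for its class. The
  integrand of the left-hand side is non-negative, hence 0, and \<open>g\<close> has no negative
  part.\<close>

lemma nonneg_resolvent:
  assumes h: "h > 0" and v: "nonneg_L2 v"
  shows "nonneg_L2 (resolvent h v)"
proof -
  define g where "g = resolvent h v"
  have cg: "coef g k = 1 / (1 + h * lam k) * coef v k" for k
    using coef_resolvent[of h v k] h by (simp add: g_def)
  have eq: "coef ((1 / h) *\<^sub>R (v - g)) k = lam k * coef g k" for k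
  proof -
    have "coef v k = (1 + h * lam k) * coef g k"
      using h resolvent_factor(1)[of h k] by (simp add: cg)
    then show ?thesis using h by (simp add: field_simps)
  qed
  have dom: "g \<in> dom_A" and op: "op_A g = (1 / h) *\<^sub>R (v - g)"
    using dom_A_I[OF eq] op_A_eq[OF eq] by auto
  define J where "J x = - flat 1 (- ser g x)" for x
  have Jc: "continuous_on {0..1} J"
    unfolding J_def
    by (intro continuous_intros continuous_on_compose2[OF smooth_fun_continuous[OF smooth_fun_flat, of UNIV]]
        continuous_on_ser[OF dom]) auto
  have Jsq: "square_int J" by (rule square_int_continuous[OF Jc])
  have "0 \<le> inner ((1 / h) *\<^sub>R (v - g)) (L2_of J)"
    using op_A_inner_flat_nonneg[OF dom] by (simp only: op J_def[abs_def])
  then have "inner g (L2_of J) \<le> inner v (L2_of J)"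
    using h by (simp add: inner_diff_left zero_le_divide_iff)
  moreover have "nonneg_L2 (L2_of (\<lambda>x. - J x))"
    using Jsq by (simp add: nonneg_L2_of square_int_uminus) (simp add: J_def flat_one_bounds)
  then have "0 \<le> inner v (L2_of (\<lambda>x. - J x))"
    by (rule inner_nonneg_L2[OF v])
  then have "inner v (L2_of J) \<le> 0"
    using Jsq by (simp add: L2_of_uminus)
  ultimately have "inner (L2_of (ser g)) (L2_of J) \<le> 0"
    by (simp add: L2_of_ser[OF dom])
  then have le: "(\<integral>x. ser g x * J x \<partial>unit_measure) \<le> 0"
    unfolding inner_L2_of[OF L2_of_ser(2)[OF dom] Jsq] .
  have nn: "0 \<le> ser g x * J x" for x
    by (cases "ser g x < 0") (auto simp: J_def flat_one mult_nonpos_nonneg)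
  have "(\<integral>x. ser g x * J x \<partial>unit_measure) = 0"
    by (intro antisym le Bochner_Integration.integral_nonneg nn)
  then have "AE x in unit_measure. ser g x * J x = 0"
    using nn by (subst (asm) integral_nonneg_eq_0_iff_AE)
      (auto intro!: square_int_mult L2_of_ser[OF dom] Jsq)
  then have "AE x in unit_measure. 0 \<le> ser g x"
    by eventually_elim (auto simp: J_def flat_one split: if_splits)
  then have "nonneg_L2 (L2_of (ser g))"
    unfolding nonneg_L2_of[OF L2_of_ser(2)[OF dom]] .
  then show ?thesis
    unfolding L2_of_ser(1)[OF dom] unfolding g_def .
qed

text \<open>The heat semigroup is the limit of the implicit Euler scheme.\<close>

lemma nonneg_heat:
  assumes t: "t \<ge> 0" and v: "nonneg_L2 v"
  shows "nonneg_L2 (heat t v)"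
proof (cases "t = 0")
  case True
  then have "heat t v = v" by (simp add: heat_def)
  with v show ?thesis by simp
next
  case False
  define R where "R n = (resolvent (t / real (Suc n)) ^^ Suc n) v" for n
  have pos: "t / real (Suc n) > 0" for n
    using False t by simp
  have nn: "nonneg_L2 ((resolvent (t / real (Suc n)) ^^ m) v)" for n m
    by (induction m) (auto intro: nonneg_resolvent[OF pos] v simp del: of_nat_Suc)
  have cR: "coef ((resolvent (t / real (Suc n)) ^^ m) v) k
      = (1 / (1 + t / real (Suc n) * lam k)) ^ m * coef v k" for n m k
    by (induction m) (simp_all add: coef_resolvent less_imp_le[OF pos] del: of_nat_Suc)
  have "R \<longlonglongrightarrow> heat t v"
  proof (rule L2_tendsto_coef)
    fix k
    have "(\<lambda>n. (1 + (lam k * t) / real n) ^ n) \<longlonglongrightarrow> exp (lam k * t)"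
      by (rule tendsto_exp_limit_sequentially)
    then have "(\<lambda>n. (1 + (lam k * t) / real (Suc n)) ^ Suc n) \<longlonglongrightarrow> exp (lam k * t)"
      by (rule LIMSEQ_Suc)
    then have "(\<lambda>n. inverse ((1 + (lam k * t) / real (Suc n)) ^ Suc n) * coef v k)
        \<longlonglongrightarrow> inverse (exp (lam k * t)) * coef v k"
      by (intro tendsto_mult tendsto_inverse tendsto_const) auto
    moreover have "coef (R n) k = inverse ((1 + (lam k * t) / real (Suc n)) ^ Suc n) * coef v k" for n
      unfolding R_def cR by (simp add: power_one_over inverse_eq_divide mult.commute[of t] del: of_nat_Suc power_Suc)
    ultimately show "(\<lambda>n. coef (R n) k) \<longlonglongrightarrow> coef (heat t v) k"
      using t by (simp add: coef_heat exp_minus)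
  next
    show "\<forall>\<^sub>F n in sequentially. \<forall>k. \<bar>coef (R n) k\<bar> \<le> \<bar>coef v k\<bar>"
    proof (intro always_eventually allI)
      fix n k
      have "\<bar>1 / (1 + t / real (Suc n) * lam k)\<bar> ^ Suc n \<le> 1"
        by (intro power_le_one resolvent_factor less_imp_le[OF pos]) auto
      then show "\<bar>coef (R n) k\<bar> \<le> \<bar>coef v k\<bar>"
        unfolding R_def cR abs_mult power_abs[symmetric]
        by (intro mult_left_le_one_le) (auto simp: power_abs)
    qed
    show "summable (\<lambda>k. \<bar>coef v k\<bar>\<^sup>2)" by (simp add: summable_coef)
  qed simp
  then show ?thesis
    by (rule nonneg_L2_tendsto) (auto simp: R_def nn simp del: funpow.simps of_nat_Suc)
qed

lemma inner_heat_sums: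
  "t \<ge> 0 \<Longrightarrow> (\<lambda>k. coef g k * coef f k * exp (- lam k * t)) sums inner (heat t g) f"
  using inner_coef_sums[of "heat t g" f] by (simp add: coef_heat mult_ac)

lemma inner_heat_commute:
  assumes "t \<ge> 0"
  shows "inner (heat t g) f = inner g (heat t f)"
proof -
  have "(\<lambda>k. coef g k * coef f k * exp (- lam k * t)) sums inner (heat t f) g"
    using inner_heat_sums[OF assms, of f g] by (simp only: mult.commute[of "coef f _" "coef g _"])
  from sums_unique2[OF inner_heat_sums[OF assms] this] show ?thesis
    by (simp only: inner_commute[of g])
qed

lemma heat_tendsto_0: "((\<lambda>t. heat t v) \<longlongrightarrow> v) (at_right 0)"
proof (rule L2_tendsto_coef)
  fix k
  have "((\<lambda>t. exp (- lam k * t) * coef v k) \<longlongrightarrow> exp (- lam k * 0) * coef v k) (at_right 0)"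
    by (intro tendsto_intros)
  moreover have "\<forall>\<^sub>F t in at_right 0. exp (- lam k * t) * coef v k = coef (heat t v) k"
    using eventually_at_right_less[of "0::real"] by eventually_elim (simp add: coef_heat)
  ultimately show "((\<lambda>t. coef (heat t v) k) \<longlongrightarrow> coef v k) (at_right 0)"
    by (auto intro: Lim_transform_eventually)
next
  show "\<forall>\<^sub>F t in at_right 0. \<forall>k. \<bar>coef (heat t v) k\<bar> \<le> \<bar>coef v k\<bar>"
    using eventually_at_right_less[of "0::real"]
    by eventually_elim (auto simp: coef_heat abs_mult less_imp_le intro!: mult_left_le_one_le)
  show "summable (\<lambda>k. \<bar>coef v k\<bar>\<^sup>2)" by (simp add: summable_coef)
qed simp

text \<open>The first eigenfunction is positive on the open interval, so a non-negative function
  orthogonal to it vanishes.\<close>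

lemma nonneg_coef_0:
  assumes "nonneg_L2 v" "coef v 0 = 0"
  shows "v = 0"
proof -
  obtain f where f: "square_int f" "v = L2_of f"
    by (rule L2_cases)
  have spos: "sinb 0 x > 0" if "0 < x" "x < 1" for x
    using that by (simp add: sinb_def freq_def sin_gt_zero)
  have "AE x in unit_measure. 0 \<le> f x * sinb 0 x"
    using assms(1) AE_space unfolding f(2) nonneg_L2_of[OF f(1)]
    by eventually_elim (use spos in \<open>auto simp: less_imp_le\<close>)
  moreover have "(\<integral>x. f x * sinb 0 x \<partial>unit_measure) = 0"
    using assms(2) f by (simp add: coef_def esin_def inner_L2_of)
  ultimately have "AE x in unit_measure. f x * sinb 0 x = 0"
    by (subst (asm) integral_nonneg_eq_0_iff_AE) (auto intro: square_int_mult f)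
  then have "AE x in unit_measure. f x = 0"
    using AE_space
  proof eventually_elim
    case (elim x)
    then show ?case using spos[of x] by simp
  qed
  then show ?thesis using f by (simp add: L2_of_eq_zero_iff)
qed

text \<open>
  With \<open>q = exp (- \<pi>\<^sup>2 t)\<close> the function \<open>t \<mapsto> inner (heat t g) f\<close> is the power series
  \<open>\<Sum>k. a k * q ^ (k + 1)\<^sup>2\<close>, so that accumulating zeros force all \<open>a k\<close> to vanish.
\<close>

lemma heat_inner_zeros:
  assumes zeros: "\<And>n. inner (heat (s n) g) f = 0" "\<And>n. s n > 0" "\<And>n. s n \<noteq> s0"
    and s0: "s \<longlonglongrightarrow> s0" "s0 > 0"
  shows "coef g 0 * coef f 0 = 0"
proof -
  define a where "a k = coef g k * coef f k" for k
  define idx where "idx k = (Suc k)\<^sup>2" for k :: nat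
  have mono: "strict_mono idx"
    by (rule strict_monoI) (simp add: idx_def power_strict_mono)
  \<comment> \<open>Only squares occur as exponents; \<open>c\<close> fills the gaps with 0 to
    obtain an ordinary power series.\<close>
  define c where "c m = (if m \<in> range idx then a (inv idx m) else 0)" for m
  have c_idx: "c (idx k) = a k" for k
    using strict_mono_imp_inj_on[OF mono] by (simp add: c_def)
  have "summable a"
    unfolding a_def using inner_coef_sums[of g f] by (rule sums_summable)
  then obtain K where K: "\<And>k. \<bar>a k\<bar> \<le> K"
    using summable_imp_Bseq[of a] unfolding Bseq_def by auto
  have Kc: "\<bar>c m\<bar> \<le> K" for m
    using K[of "inv idx m"] K[of 0] by (auto simp: c_def intro: order_trans[OF abs_ge_zero])
  have summ: "summable (\<lambda>m. complex_of_real (c m) * z ^ m)" if "norm z < 1" for z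
  proof (rule summable_comparison_test'[where N = 0])
    show "summable (\<lambda>m. K * norm z ^ m)"
      using that by (intro summable_mult summable_geometric) simp
    show "norm (complex_of_real (c m) * z ^ m) \<le> K * norm z ^ m" for m
      using Kc[of m] by (simp add: norm_mult norm_power mult_right_mono)
  qed
  define F where "F z = (\<Sum>m. complex_of_real (c m) * z ^ m)" for z
  have Fs: "(\<lambda>m. complex_of_real (c m) * z ^ m) sums F z" if "norm z < 1" for z
    unfolding F_def by (intro summable_sums summ that)
  have hol: "F holomorphic_on ball 0 1"
    by (rule power_series_holomorphic[where a = "\<lambda>m. complex_of_real (c m)"]) (use Fs in simp)
  define q where "q t = exp (- (pi\<^sup>2 * t))" for t :: real
  have q01: "0 < q t" "q t < 1" if "t > 0" for t
    using that by (auto simp: q_def)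
  have qpow: "q t ^ idx k = exp (- lam k * t)" for t k
  proof -
    have "real (idx k) * pi\<^sup>2 = lam k"
      by (simp add: idx_def lam_def freq_def power_mult_distrib del: of_nat_Suc)
    then show ?thesis
      by (simp add: q_def exp_of_nat_mult[symmetric] mult.assoc[symmetric])
  qed
  have Fq: "F (complex_of_real (q t)) = complex_of_real (inner (heat t g) f)" if "t > 0" for t
  proof -
    have "(\<lambda>k. a k * q t ^ idx k) sums inner (heat t g) f"
      using inner_heat_sums[of t g f] that by (simp add: qpow a_def)
    then have "(\<lambda>k. c (idx k) * q t ^ idx k) sums inner (heat t g) f"
      by (simp add: c_idx)
    then have "(\<lambda>m. c m * q t ^ m) sums inner (heat t g) f"
      by (subst (asm) sums_mono_reindex[OF mono]) (auto simp: c_def)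
    then have "(\<lambda>m. complex_of_real (c m * q t ^ m)) sums complex_of_real (inner (heat t g) f)"
      by (rule sums_of_real)
    then have "(\<lambda>m. complex_of_real (c m) * complex_of_real (q t) ^ m) sums complex_of_real (inner (heat t g) f)"
      by simp
    moreover have "norm (complex_of_real (q t)) < 1"
      using q01[OF that] by simp
    ultimately show ?thesis using Fs sums_unique2 by blast
  qed
  have Fzero: "F w = 0" if "w \<in> ball 0 1" for w
  proof (rule analytic_continuation[OF hol open_ball connected_ball _ _ _ _ that])
    let ?U = "range (\<lambda>n. complex_of_real (q (s n)))"
    show "?U \<subseteq> ball 0 1"
      using q01[OF zeros(2)] by (auto simp: less_imp_le)
    \<comment> \<open>Here \<open>s0 > 0\<close> matters: the zeros accumulate inside the disc of
      convergence and not at its boundary point 1.\<close>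
    show "complex_of_real (q s0) \<in> ball 0 1"
      using q01[OF s0(2)] by auto
    show "F z = 0" if "z \<in> ?U" for z
      using that Fq zeros(1,2) by auto
    show "complex_of_real (q s0) islimpt ?U"
      unfolding islimpt_sequential
    proof (intro exI conjI allI)
      have "(\<lambda>n. q (s n)) \<longlonglongrightarrow> q s0"
        unfolding q_def by (intro tendsto_intros s0)
      then show "(\<lambda>n. complex_of_real (q (s n))) \<longlonglongrightarrow> complex_of_real (q s0)"
        by (rule tendsto_of_real)
      show "complex_of_real (q (s n)) \<in> ?U - {complex_of_real (q s0)}" for n
        using zeros(3)[of n] by (auto simp: q_def)
    qed
  qed
  have "Abs_fps (\<lambda>m. complex_of_real (c m)) = 0"
  proof (rule eval_fps_eqD)
    have "1 \<le> fps_conv_radius (Abs_fps (\<lambda>m. complex_of_real (c m)))"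
      unfolding fps_conv_radius_def fps_nth_Abs_fps by (intro conv_radius_geI_ex') (auto intro!: summ)
    then show "0 < fps_conv_radius (Abs_fps (\<lambda>m. complex_of_real (c m)))"
      by (rule less_le_trans[rotated]) simp
    have "\<forall>\<^sub>F z in nhds 0. z \<in> ball (0::complex) 1"
      by (intro eventually_nhds_in_open) auto
    then show "\<forall>\<^sub>F z in nhds 0. eval_fps (Abs_fps (\<lambda>m. complex_of_real (c m))) z = eval_fps 0 z"
      by eventually_elim (use Fzero in \<open>simp add: eval_fps_def F_def\<close>)
  qed simp
  \<comment> \<open>The exponent 1 belongs to \<open>k = 0\<close>, the coefficient that detects
    non-zero non-negative functions.\<close>
  then have "c 1 = 0"
    by (metis fps_nth_Abs_fps fps_zero_nth of_real_eq_0_iff)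
  moreover have "idx 0 = 1" by (simp add: idx_def)
  ultimately show ?thesis using c_idx[of 0] by (simp add: a_def)
qed

section \<open>Absolutely continuous curves\<close>

text \<open>Tagged divisions are finite sets of pairs of a tag and an interval, whereas absolute
  continuity speaks of numbered families; an enumeration of the set translates one into the
  other.\<close>

lemma abs_continuous_on_intervals:
  fixes u :: "real \<Rightarrow> 'a::metric_space"
  assumes ac: "abs_continuous_on a b u" and e: "e > 0"
  shows "\<exists>\<delta>>0. \<forall>P :: (real \<times> real set) set. finite P \<longrightarrow>
      (\<forall>x K. (x, K) \<in> P \<longrightarrow> (\<exists>p q. a \<le> p \<and> p \<le> q \<and> q \<le> b \<and> K = {p..q})) \<longrightarrow>
      disjoint_family_on (\<lambda>(x, K). {Inf K<..<Sup K}) P \<longrightarrow>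
      (\<Sum>(x, K)\<in>P. Sup K - Inf K) < \<delta> \<longrightarrow> (\<Sum>(x, K)\<in>P. dist (u (Inf K)) (u (Sup K))) < e"
proof -
  obtain \<delta> where \<delta>: "\<delta> > 0" and *: "\<And>(n::nat) (p::nat \<Rightarrow> real) q.
      (\<forall>i<n. a \<le> p i \<and> p i \<le> q i \<and> q i \<le> b) \<and>
      disjoint_family_on (\<lambda>i. {p i<..<q i}) {..<n} \<and> (\<Sum>i<n. q i - p i) < \<delta>
      \<Longrightarrow> (\<Sum>i<n. dist (u (p i)) (u (q i))) < e"
    using ac e unfolding abs_continuous_on_def by meson
  show ?thesis
  proof (intro exI[of _ \<delta>] conjI \<delta> allI impI)
    fix P :: "(real \<times> real set) set"
    assume fin: "finite P"
      and iv': "\<forall>x K. (x, K) \<in> P \<longrightarrow> (\<exists>p q. a \<le> p \<and> p \<le> q \<and> q \<le> b \<and> K = {p..q})"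
      and disj: "disjoint_family_on (\<lambda>(x, K). {Inf K<..<Sup K}) P"
      and len: "(\<Sum>(x, K)\<in>P. Sup K - Inf K) < \<delta>"
    have iv: "\<And>x K. (x, K) \<in> P \<Longrightarrow> \<exists>p q. a \<le> p \<and> p \<le> q \<and> q \<le> b \<and> K = {p..q}"
      using iv' by blast
    obtain h where h: "bij_betw h {..<card P} P"
      using ex_bij_betw_nat_finite[OF fin] by (auto simp: atLeast0LessThan)
    define p where "p i = Inf (snd (h i))" for i
    define q where "q i = Sup (snd (h i))" for i
    have mem: "h i \<in> P" if "i < card P" for i
      using h that by (auto simp: bij_betw_def)
    have "\<forall>i<card P. a \<le> p i \<and> p i \<le> q i \<and> q i \<le> b"
    proof (intro allI impI)
      fix i assume "i < card P"
      then have "(fst (h i), snd (h i)) \<in> P" using mem by simp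
      from iv[OF this] show "a \<le> p i \<and> p i \<le> q i \<and> q i \<le> b"
        by (auto simp: p_def q_def)
    qed
    moreover have "disjoint_family_on (\<lambda>i. {p i<..<q i}) {..<card P}"
      unfolding disjoint_family_on_def
    proof (intro ballI impI)
      fix i j assume ij: "i \<in> {..<card P}" "j \<in> {..<card P}" "i \<noteq> j"
      then have "h i \<noteq> h j"
        using h by (auto simp: bij_betw_def inj_on_def)
      then show "{p i<..<q i} \<inter> {p j<..<q j} = {}"
        using disj mem[of i] mem[of j] ij unfolding disjoint_family_on_def p_def q_def
        by (metis (mono_tags, lifting) case_prod_beta lessThan_iff)
    qed
    moreover have "(\<Sum>i<card P. q i - p i) = (\<Sum>(x, K)\<in>P. Sup K - Inf K)"
      unfolding p_def q_def
      by (subst sum.reindex_bij_betw[OF h, symmetric]) (auto simp: case_prod_beta)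
    moreover have "(\<Sum>i<card P. dist (u (p i)) (u (q i))) = (\<Sum>(x, K)\<in>P. dist (u (Inf K)) (u (Sup K)))"
      unfolding p_def q_def
      by (subst sum.reindex_bij_betw[OF h, symmetric]) (auto simp: case_prod_beta)
    ultimately show "(\<Sum>(x, K)\<in>P. dist (u (Inf K)) (u (Sup K))) < e"
      using *[of "card P" p q] len by simp
  qed
qed

lemma sum_lengths_le_measure:
  fixes P :: "(real \<times> real set) set"
  assumes fin: "finite P" and disj: "disjoint_family_on (\<lambda>(x, K). {Inf K<..<Sup K}) P"
    and iv: "\<And>x K. (x, K) \<in> P \<Longrightarrow> \<exists>p q. p \<le> q \<and> K = {p..q} \<and> K \<subseteq> T"
    and T: "open T" "emeasure lborel T < ennreal d"
  shows "(\<Sum>(x, K)\<in>P. Sup K - Inf K) < d"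
proof -
  have nn: "0 \<le> Sup K - Inf K" if "(x, K) \<in> P" for x K
    using iv[OF that] by auto
  have "ennreal (\<Sum>(x, K)\<in>P. Sup K - Inf K) = (\<Sum>(x, K)\<in>P. ennreal (Sup K - Inf K))"
    using nn by (subst sum_ennreal[symmetric]) (auto simp: case_prod_beta)
  also have "\<dots> = (\<Sum>i\<in>P. emeasure lborel ((\<lambda>(x, K). {Inf K<..<Sup K}) i))"
    using nn by (intro sum.cong) (auto simp: case_prod_beta)
  also have "\<dots> = emeasure lborel (\<Union>i\<in>P. (\<lambda>(x, K). {Inf K<..<Sup K}) i)"
    by (rule sum_emeasure[OF _ disj fin]) auto
  also have "\<dots> \<le> emeasure lborel T"
  proof (rule emeasure_mono)
    show "(\<Union>i\<in>P. (\<lambda>(x, K). {Inf K<..<Sup K}) i) \<subseteq> T"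
    proof
      fix y assume "y \<in> (\<Union>i\<in>P. (\<lambda>(x, K). {Inf K<..<Sup K}) i)"
      then obtain x K where xK: "(x, K) \<in> P" "Inf K < y" "y < Sup K" by auto
      with iv[OF xK(1)] show "y \<in> T" by auto
    qed
  qed (use T in simp)
  also have "\<dots> < ennreal d" by (rule T)
  finally have "ennreal (\<Sum>(x, K)\<in>P. Sup K - Inf K) < ennreal d" .
  moreover have "0 \<le> (\<Sum>(x, K)\<in>P. Sup K - Inf K)"
    using nn by (intro sum_nonneg) auto
  ultimately show ?thesis
    by (simp only: ennreal_less_iff)
qed

text \<open>
  In a fine tagged division, the intervals tagged at differentiability points contribute
  almost non-negative increments, and those tagged in the exceptional null set have small
  total length, hence small total variation.
\<close>

lemma abs_continuous_nondecreasing: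
  fixes u :: "real \<Rightarrow> 'a::metric_space" and F :: "real \<Rightarrow> real"
  assumes ab: "a \<le> b" and ac: "abs_continuous_on a b u" and C: "0 \<le> C"
    and ctrl: "\<And>p q. a \<le> p \<Longrightarrow> p \<le> q \<Longrightarrow> q \<le> b \<Longrightarrow> \<bar>F q - F p\<bar> \<le> C * (dist (u p) (u q) + (q - p))"
    and deriv: "AE t in lborel. a < t \<and> t < b \<longrightarrow> (\<exists>D\<ge>0. (F has_field_derivative D) (at t))"
  shows "F a \<le> F b"
proof -
  define good where "good t \<longleftrightarrow> (\<exists>D\<ge>0. (F has_field_derivative D) (at t))" for t
  define N where "N = {t\<in>{a..b}. \<not> good t}"
  have "negligible N"
  proof -
    have "AE t in lborel. \<not> (a < t \<and> t < b \<and> \<not> good t)"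
      using deriv by eventually_elim (auto simp: good_def)
    then obtain M where M: "{t \<in> space lborel. \<not> \<not> (a < t \<and> t < b \<and> \<not> good t)} \<subseteq> M"
        "M \<in> sets lborel" "emeasure lborel M = 0"
      by (auto elim!: AE_E)
    have "M \<in> null_sets lebesgue"
      using M by (intro null_sets_completionI) (auto simp: null_sets_def)
    then have "negligible (M \<union> {a, b})"
      by (simp add: negligible_iff_null_sets negligible_Un negligible_insert)
    moreover have "N \<subseteq> M \<union> {a, b}"
    proof
      fix x assume x: "x \<in> N"
      then have "x = a \<or> x = b \<or> (a < x \<and> x < b)" by (auto simp: N_def)
      then show "x \<in> M \<union> {a, b}" using M(1) x by (auto simp: N_def)
    qed
    ultimately show ?thesis by (rule negligible_subset)
  qed
  have "F a \<le> F b + e * (b - a + 2 * C)" if e: "e > 0" for e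
  proof -
    obtain \<delta> where \<delta>: "\<delta> > 0" and ac\<delta>: "\<forall>P :: (real \<times> real set) set. finite P \<longrightarrow>
      (\<forall>x K. (x, K) \<in> P \<longrightarrow> (\<exists>p q. a \<le> p \<and> p \<le> q \<and> q \<le> b \<and> K = {p..q})) \<longrightarrow>
      disjoint_family_on (\<lambda>(x, K). {Inf K<..<Sup K}) P \<longrightarrow>
      (\<Sum>(x, K)\<in>P. Sup K - Inf K) < \<delta> \<longrightarrow> (\<Sum>(x, K)\<in>P. dist (u (Inf K)) (u (Sup K))) < e"
      using abs_continuous_on_intervals[OF ac e] by blast
    have Nl: "N \<in> sets lebesgue"
      using \<open>negligible N\<close> by (simp add: negligible_imp_sets)
    \<comment> \<open>The measure lies below \<open>\<delta>\<close> to make absolute continuity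
      applicable and below \<open>e\<close> because the lengths enter \<open>ctrl\<close> as
      well.\<close>
    obtain T where T: "open T" "N \<subseteq> T" "T - N \<in> lmeasurable" "emeasure lebesgue (T - N) < ennreal (min \<delta> e)"
      using sets_lebesgue_outer_open[OF Nl, of "min \<delta> e"] \<delta> e by auto
    have Tsm: "emeasure lborel T < ennreal (min \<delta> e)"
    proof -
      have "emeasure lborel T = emeasure lebesgue T"
        using T(1) by (simp add: emeasure_completion)
      also have "\<dots> = emeasure lebesgue ((T - N) \<union> N)"
        using T(2) by (simp add: Un_absorb2)
      also have "\<dots> = emeasure lebesgue (T - N)"
        using \<open>negligible N\<close> T(3)
        by (intro emeasure_Un_null_set) (auto simp: negligible_iff_null_sets)
      finally show ?thesis using T(4) by simp
    qed
    \<comment> \<open>Straddle estimate: the tag lies between \<open>p\<close> and \<open>q\<close>,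
      so the two one-sided errors add up to \<open>e * (q - p)\<close>, and the derivative itself
      contributes a non-negative term.\<close>
    have "\<exists>d>0. \<forall>p q. p \<le> x \<and> x \<le> q \<and> p \<in> ball x d \<and> q \<in> ball x d \<longrightarrow> F q - F p \<ge> - e * (q - p)"
      if gx: "good x" for x
    proof -
      obtain D where D: "D \<ge> 0" "(F has_field_derivative D) (at x)"
        using gx by (auto simp: good_def)
      then have "(F has_derivative (\<lambda>h. h * D)) (at x)"
        by (simp add: has_field_derivative_def mult_commute_abs)
      then obtain d where d: "d > 0" "\<And>y. norm (y - x) < d \<Longrightarrow> norm (F y - F x - (y - x) * D) \<le> e * norm (y - x)"
        using e unfolding has_derivative_at_alt by metis
      have "F q - F p \<ge> - e * (q - p)" if "p \<le> x" "x \<le> q" "p \<in> ball x d" "q \<in> ball x d" for p q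
      proof -
        have "F q - F x - (q - x) * D \<ge> - (e * (q - x))"
          using d(2)[of q] that by (auto simp: dist_real_def abs_le_iff)
        moreover have "F p - F x - (p - x) * D \<le> e * (x - p)"
          using d(2)[of p] that by (auto simp: dist_real_def abs_le_iff)
        moreover have "0 \<le> (q - p) * D" using that D by simp
        ultimately show ?thesis by (simp add: algebra_simps)
      qed
      then show ?thesis using d(1) by blast
    qed
    then obtain d where d: "\<And>x. good x \<Longrightarrow> d x > 0"
        "\<And>x p q. good x \<Longrightarrow> p \<le> x \<Longrightarrow> x \<le> q \<Longrightarrow> p \<in> ball x (d x) \<Longrightarrow> q \<in> ball x (d x) \<Longrightarrow> F q - F p \<ge> - e * (q - p)"
      by metis
    \<comment> \<open>The last case concerns only points outside \<open>{a..b}\<close>, where no tag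
      lies.\<close>
    define \<gamma> where "\<gamma> x = (if x \<in> N then T else if good x then ball x (d x) else UNIV)" for x
    have "gauge \<gamma>"
      using T d(1) by (auto simp: gauge_def \<gamma>_def)
    then obtain P where P: "P tagged_division_of {a..b}" "\<gamma> fine P"
      using fine_division_exists_real by blast
    have finP: "finite P" using P(1) by (rule tagged_division_of_finite)
    have PK: "\<exists>p q. a \<le> p \<and> p \<le> x \<and> x \<le> q \<and> q \<le> b \<and> K = {p..q}" if xK: "(x, K) \<in> P" for x K
    proof -
      obtain p q where K: "K = cbox p q" using tagged_division_ofD(4)[OF P(1) xK] by blast
      then show ?thesis
        using tagged_division_ofD(2,3)[OF P(1) xK] by (auto intro!: exI[of _ p] exI[of _ q])
    qed
    have Pdisj: "disjoint_family_on (\<lambda>(x, K). {Inf K<..<Sup K}) P"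
      unfolding disjoint_family_on_def
    proof (intro ballI impI)
      fix i j assume ij: "i \<in> P" "j \<in> P" "i \<noteq> j"
      obtain x K y L where i: "i = (x, K)" and j: "j = (y, L)" by fastforce
      have "interior K \<inter> interior L = {}"
        using tagged_division_ofD(5)[OF P(1)] ij i j by blast
      moreover obtain p q p' q' where "p \<le> q" "K = {p..q}" "p' \<le> q'" "L = {p'..q'}"
        using PK ij i j by (meson order_trans)
      ultimately show "(case i of (x, K) \<Rightarrow> {Inf K<..<Sup K}) \<inter> (case j of (x, K) \<Rightarrow> {Inf K<..<Sup K}) = {}"
        using i j by simp
    qed
    define P1 where "P1 = {i\<in>P. fst i \<in> N}"
    define P2 where "P2 = {i\<in>P. fst i \<notin> N}"
    have fin: "finite P1" "finite P2" using finP by (auto simp: P1_def P2_def)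
    have P1disj: "disjoint_family_on (\<lambda>(x, K). {Inf K<..<Sup K}) P1"
      by (rule disjoint_family_on_mono[OF _ Pdisj]) (auto simp: P1_def)
    have split: "(\<Sum>i\<in>P. f i) = (\<Sum>i\<in>P1. f i) + (\<Sum>i\<in>P2. f i)" for f :: "_ \<Rightarrow> real"
    proof -
      have "P = P1 \<union> P2" "P1 \<inter> P2 = {}" by (auto simp: P1_def P2_def)
      then show ?thesis using fin by (metis sum.union_disjoint)
    qed
    have len1: "(\<Sum>(x, K)\<in>P1. Sup K - Inf K) < min \<delta> e"
    proof (rule sum_lengths_le_measure[OF fin(1) P1disj _ T(1) Tsm])
      fix x K assume "(x, K) \<in> P1"
      then have "(x, K) \<in> P" "x \<in> N" by (auto simp: P1_def)
      moreover have "K \<subseteq> T"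
        using fineD[OF P(2) \<open>(x, K) \<in> P\<close>] \<open>x \<in> N\<close> by (simp add: \<gamma>_def)
      ultimately show "\<exists>p q. p \<le> q \<and> K = {p..q} \<and> K \<subseteq> T"
        using PK by (meson order_trans)
    qed
    have var1: "(\<Sum>(x, K)\<in>P1. dist (u (Inf K)) (u (Sup K))) < e"
    proof (rule ac\<delta>[rule_format, OF fin(1) _ P1disj])
      fix x K assume "(x, K) \<in> P1"
      then have "(x, K) \<in> P" by (simp add: P1_def)
      from PK[OF this] obtain p q where "a \<le> p" "p \<le> x" "x \<le> q" "q \<le> b" "K = {p..q}"
        by blast
      then show "\<exists>p q. a \<le> p \<and> p \<le> q \<and> q \<le> b \<and> K = {p..q}"
        by (intro exI[of _ p] exI[of _ q]) auto
    qed (use len1 in simp)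
    \<comment> \<open>At these tags no derivative is available; \<open>ctrl\<close> charges the
      increments of \<open>F\<close> to the variation of \<open>u\<close> and to the total length,
      both of which are below \<open>e\<close>.\<close>
    have "(\<Sum>(x, K)\<in>P1. F (Sup K) - F (Inf K)) \<ge> (\<Sum>(x, K)\<in>P1. - (C * (dist (u (Inf K)) (u (Sup K)) + (Sup K - Inf K))))"
    proof (rule sum_mono)
      fix i assume "i \<in> P1"
      then obtain x K where i: "i = (x, K)" "(x, K) \<in> P" by (cases i) (auto simp: P1_def)
      then obtain p q where "a \<le> p" "p \<le> q" "q \<le> b" "K = {p..q}"
        using PK by (meson order_trans)
      then show "(case i of (x, K) \<Rightarrow> - (C * (dist (u (Inf K)) (u (Sup K)) + (Sup K - Inf K))))
          \<le> (case i of (x, K) \<Rightarrow> F (Sup K) - F (Inf K))"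
        using ctrl[of p q] i by (simp add: abs_le_iff)
    qed
    moreover have "(\<Sum>(x, K)\<in>P1. - (C * (dist (u (Inf K)) (u (Sup K)) + (Sup K - Inf K))))
        = - (C * ((\<Sum>(x, K)\<in>P1. dist (u (Inf K)) (u (Sup K))) + (\<Sum>(x, K)\<in>P1. Sup K - Inf K)))"
      by (simp add: sum_negf sum_distrib_left[symmetric] sum.distrib[symmetric] case_prod_beta)
    moreover have "C * ((\<Sum>(x, K)\<in>P1. dist (u (Inf K)) (u (Sup K))) + (\<Sum>(x, K)\<in>P1. Sup K - Inf K)) \<le> C * (e + e)"
      using var1 len1 by (intro mult_left_mono C add_mono) auto
    ultimately have s1: "(\<Sum>(x, K)\<in>P1. F (Sup K) - F (Inf K)) \<ge> - (C * (e + e))" by linarith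
    have "(\<Sum>(x, K)\<in>P2. F (Sup K) - F (Inf K)) \<ge> (\<Sum>(x, K)\<in>P2. - e * (Sup K - Inf K))"
    proof (rule sum_mono)
      fix i assume "i \<in> P2"
      then obtain x K where i: "i = (x, K)" "(x, K) \<in> P" "x \<notin> N" by (cases i) (auto simp: P2_def)
      then obtain p q where pq: "a \<le> p" "p \<le> x" "x \<le> q" "q \<le> b" "K = {p..q}"
        using PK by meson
      have good: "good x" using i(3) pq by (auto simp: N_def)
      have "K \<subseteq> ball x (d x)"
        using fineD[OF P(2) i(2)] i(3) good by (simp add: \<gamma>_def)
      moreover have "p \<in> K" "q \<in> K" using pq by auto
      ultimately have "p \<in> ball x (d x)" "q \<in> ball x (d x)" by blast+
      then show "(case i of (x, K) \<Rightarrow> - e * (Sup K - Inf K)) \<le> (case i of (x, K) \<Rightarrow> F (Sup K) - F (Inf K))"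
        using d(2)[OF good pq(2,3)] i pq by simp
    qed
    moreover have "(\<Sum>(x, K)\<in>P2. - e * (Sup K - Inf K)) = - e * (\<Sum>(x, K)\<in>P2. Sup K - Inf K)"
      by (simp add: sum_distrib_left case_prod_beta)
    moreover have "(\<Sum>(x, K)\<in>P2. Sup K - Inf K) \<le> b - a"
    proof -
      have "(\<Sum>(x, K)\<in>P. Sup K - Inf K) = b - a"
        using additive_tagged_division_1[OF ab P(1), of "\<lambda>x. x"] .
      moreover have "0 \<le> (\<Sum>(x, K)\<in>P1. Sup K - Inf K)"
        using PK by (intro sum_nonneg) (fastforce simp: P1_def)
      ultimately show ?thesis using split[of "\<lambda>(x, K). Sup K - Inf K"] by linarith
    qed
    then have "e * (\<Sum>(x, K)\<in>P2. Sup K - Inf K) \<le> e * (b - a)"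
      using e by (intro mult_left_mono) auto
    ultimately have s2: "(\<Sum>(x, K)\<in>P2. F (Sup K) - F (Inf K)) \<ge> - (e * (b - a))" by simp
    have "F b - F a = (\<Sum>(x, K)\<in>P. F (Sup K) - F (Inf K))"
      using additive_tagged_division_1[OF ab P(1), of F] by simp
    then have "F b - F a \<ge> - (C * (e + e)) - e * (b - a)"
      using s1 s2 split[of "\<lambda>(x, K). F (Sup K) - F (Inf K)"] by linarith
    then show ?thesis by (simp add: algebra_simps)
  qed
  note est = this
  show ?thesis
  proof (rule field_le_epsilon)
    fix e :: real assume e: "e > 0"
    have pos: "b - a + 2 * C + 1 > 0" using ab C by linarith
    have "F a \<le> F b + e / (b - a + 2 * C + 1) * (b - a + 2 * C)"
      using e pos by (intro est divide_pos_pos)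
    also have "e / (b - a + 2 * C + 1) * (b - a + 2 * C) = e * ((b - a + 2 * C) / (b - a + 2 * C + 1))"
      by simp
    also have "\<dots> \<le> e * 1"
      using e pos by (intro mult_left_mono) (simp_all add: divide_le_eq_1)
    finally show "F a \<le> F b + e" by simp
  qed
qed

lemma abs_continuous_on_lipschitz:
  fixes u :: "real \<Rightarrow> 'a::metric_space"
  assumes L: "0 \<le> L" "\<And>p q. a \<le> p \<Longrightarrow> p \<le> q \<Longrightarrow> q \<le> b \<Longrightarrow> dist (u p) (u q) \<le> L * (q - p)"
  shows "abs_continuous_on a b u"
  unfolding abs_continuous_on_def
proof (intro allI impI)
  fix \<epsilon> :: real assume \<epsilon>: "\<epsilon> > 0"
  show "\<exists>\<delta>>0. \<forall>(n::nat) p q. (\<forall>i<n. a \<le> p i \<and> p i \<le> q i \<and> q i \<le> b) \<and>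
      disjoint_family_on (\<lambda>i. {p i<..<q i}) {..<n} \<and> (\<Sum>i<n. q i - p i) < \<delta> \<longrightarrow>
      (\<Sum>i<n. dist (u (p i)) (u (q i))) < \<epsilon>"
  proof (intro exI[of _ "\<epsilon> / (L + 1)"] conjI allI impI)
    show "0 < \<epsilon> / (L + 1)" using \<epsilon> L(1) by simp
    fix n :: nat and p q :: "nat \<Rightarrow> real"
    assume A: "(\<forall>i<n. a \<le> p i \<and> p i \<le> q i \<and> q i \<le> b) \<and>
      disjoint_family_on (\<lambda>i. {p i<..<q i}) {..<n} \<and> (\<Sum>i<n. q i - p i) < \<epsilon> / (L + 1)"
    have "(\<Sum>i<n. dist (u (p i)) (u (q i))) \<le> (\<Sum>i<n. L * (q i - p i))"
      using A by (intro sum_mono L(2)) auto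
    also have "\<dots> = L * (\<Sum>i<n. q i - p i)" by (simp add: sum_distrib_left)
    also have "\<dots> \<le> (L + 1) * (\<Sum>i<n. q i - p i)"
      using A by (intro mult_right_mono sum_nonneg) auto
    also have "\<dots> < \<epsilon>"
      using A L(1) by (auto simp: pos_less_divide_eq mult.commute)
    finally show "(\<Sum>i<n. dist (u (p i)) (u (q i))) < \<epsilon>" .
  qed
qed


lemma lipschitz_continuous_on:
  fixes u :: "real \<Rightarrow> 'a::metric_space"
  assumes "\<And>p q. p \<in> S \<Longrightarrow> q \<in> S \<Longrightarrow> p \<le> q \<Longrightarrow> dist (u p) (u q) \<le> L * (q - p)" "0 \<le> L"
  shows "continuous_on S u"
proof (rule lipschitz_on_continuous_on, rule lipschitz_onI)
  fix p q assume "p \<in> S" "q \<in> S"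
  then show "dist (u p) (u q) \<le> L * dist p q"
    using assms(1)[of p q] assms(1)[of q p] by (cases "p \<le> q") (auto simp: dist_real_def dist_commute)
qed fact

section \<open>Comparison with the heat semigroup\<close>

lemma heat_add: "s \<ge> 0 \<Longrightarrow> t \<ge> 0 \<Longrightarrow> heat (s + t) v = heat s (heat t v)"
  by (rule coef_eqI) (simp add: coef_heat exp_add[symmetric] algebra_simps)

lemma norm_heat_le:
  assumes "t \<ge> 0"
  shows "norm (heat t v) \<le> norm v"
  using norm_le_coef[of "heat t v" 1 v] assms
  by (simp add: coef_heat abs_mult less_imp_le mult_left_le_one_le)

text \<open>The smoothing effect: applying the operator to a heat flow is bounded uniformly in
  \<open>k\<close> after a time \<open>\<delta>\<close>, at the price of a factor
  \<open>1 / \<delta>\<close>.\<close>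

lemma lam_exp_le: "\<delta> > 0 \<Longrightarrow> \<delta> \<le> s \<Longrightarrow> lam k * exp (- lam k * s) \<le> 1 / \<delta>"
proof -
  assume \<delta>: "\<delta> > 0" "\<delta> \<le> s"
  have "lam k * \<delta> \<le> lam k * s" using \<delta> by (intro mult_left_mono) (auto simp: less_imp_le)
  also have "\<dots> \<le> exp (lam k * s)" using exp_ge_add_one_self[of "lam k * s"] by linarith
  finally show ?thesis using \<delta> by (simp add: exp_minus field_simps)
qed

lemma heat_vector_derivative:
  assumes "s < c"
  shows "((\<lambda>s. heat (c - s) f) has_vector_derivative synth (\<lambda>k. lam k * exp (- lam k * (c - s)) * coef f k)) (at s)"
proof -
  \<comment> \<open>Half of the distance to \<open>c\<close>, so that on a whole neighbourhood of
    \<open>s\<close> the remaining time stays above \<open>\<delta>\<close> and one bound serves all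
    difference quotients.\<close>
  define \<delta> where "\<delta> = (c - s) / 2"
  have \<delta>: "\<delta> > 0" "s < c - \<delta>" using assms by (auto simp: \<delta>_def field_simps)
  have b: "\<bar>lam k * exp (- lam k * (c - r)) * coef f k\<bar> \<le> 1 / \<delta> * \<bar>coef f k\<bar>" if "r < c - \<delta>" for r k
    using mult_right_mono[OF lam_exp_le[of \<delta> "c - r" k], of "\<bar>coef f k\<bar>"] that \<delta>
    by (simp add: abs_mult abs_of_pos)
  have cf: "coef (synth (\<lambda>k. lam k * exp (- lam k * (c - r)) * coef f k)) k = lam k * exp (- lam k * (c - r)) * coef f k"
    if "r < c - \<delta>" for r k
    by (rule coef_synth[OF summable_square_bound[OF b[OF that]]])
  show ?thesis
  proof (rule vector_derivative_coef[where S = "{..<c - \<delta>}" and B = "\<lambda>k. 1 / \<delta> * \<bar>coef f k\<bar>"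
        and x' = "\<lambda>s. synth (\<lambda>k. lam k * exp (- lam k * (c - s)) * coef f k)"])
    fix k r assume r: "r \<in> {..<c - \<delta>}"
    have "((\<lambda>r. exp (- lam k * (c - r)) * coef f k) has_field_derivative
        lam k * exp (- lam k * (c - r)) * coef f k) (at r)"
      by (auto intro!: derivative_eq_intros)
    then have "((\<lambda>r. coef (heat (c - r) f) k) has_field_derivative
        lam k * exp (- lam k * (c - r)) * coef f k) (at r)"
      by (rule has_field_derivative_transform_within_open[of _ _ _ "{..<c - \<delta>}"])
        (use r \<delta> in \<open>auto simp: coef_heat\<close>)
    then show "((\<lambda>r. coef (heat (c - r) f) k) has_field_derivative
        coef (synth (\<lambda>k. lam k * exp (- lam k * (c - r)) * coef f k)) k) (at r)"
      using cf r by simp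
    show "\<bar>coef (synth (\<lambda>k. lam k * exp (- lam k * (c - r)) * coef f k)) k\<bar> \<le> 1 / \<delta> * \<bar>coef f k\<bar>"
      using b cf r by simp
  next
    show "summable (\<lambda>k. (1 / \<delta> * \<bar>coef f k\<bar>)\<^sup>2)"
      by (rule summable_square_bound[of _ "1 / \<delta>" f]) (use \<delta> in simp)
  qed (use \<delta> in auto)
qed

lemma heat_lipschitz:
  assumes "\<delta> > 0" "p \<le> q" "q \<le> c - \<delta>"
  shows "norm (heat (c - q) f - heat (c - p) f) \<le> 1 / \<delta> * (q - p) * norm f"
proof (rule norm_le_coef)
  fix k
  have "norm (exp (- lam k * (c - q)) - exp (- lam k * (c - p))) \<le> 1 / \<delta> * norm (q - p)"
  proof (rule field_differentiable_bound[of "{..c - \<delta>}" "\<lambda>r. exp (- lam k * (c - r))"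
        "\<lambda>r. lam k * exp (- lam k * (c - r))"])
    show "((\<lambda>r. exp (- lam k * (c - r))) has_field_derivative lam k * exp (- lam k * (c - r))) (at r within {..c - \<delta>})" for r
      by (auto intro!: derivative_eq_intros)
    show "norm (lam k * exp (- lam k * (c - r))) \<le> 1 / \<delta>" if "r \<in> {..c - \<delta>}" for r
      using lam_exp_le[of \<delta> "c - r" k] that assms by (simp add: abs_mult abs_of_pos)
  qed (use assms in auto)
  then have "\<bar>exp (- lam k * (c - q)) - exp (- lam k * (c - p))\<bar> * \<bar>coef f k\<bar> \<le> 1 / \<delta> * (q - p) * \<bar>coef f k\<bar>"
    using assms by (intro mult_right_mono) auto
  then show "\<bar>coef (heat (c - q) f - heat (c - p) f) k\<bar> \<le> 1 / \<delta> * (q - p) * \<bar>coef f k\<bar>"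
    using assms by (simp add: coef_heat left_diff_distrib[symmetric] abs_mult)
qed (use assms in simp)

text \<open>The function \<open>F s = exp (- \<Omega> s) * inner (u s) (heat (c - s) f)\<close> has,
  by symmetry of the operator, a derivative that pairs the non-negative residual of \<open>u\<close>
  with a non-negative function. Ending at \<open>c = T2 + \<delta>\<close> keeps the backward
  solution Lipschitz in time up to \<open>T2\<close>, so that the increments of \<open>F\<close> are
  controlled by those of \<open>u\<close>.\<close>

lemma heat_comparison_smoothed:
  assumes T: "T1 < T2" and cu: "continuous_on {T1..T2} u" and ac: "abs_continuous_on T1 T2 u"
    and \<Omega>: "\<And>t. (\<Omega> has_field_derivative \<omega> t) (at t)" "continuous_on UNIV \<omega>"
    and eq: "AE t in lborel. T1 < t \<and> t < T2 \<longrightarrow> (\<exists>u'. (u has_vector_derivative u') (at t) \<and>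
        u t \<in> dom_A \<and> nonneg_L2 (u' + op_A (u t) - \<omega> t *\<^sub>R u t))"
    and f: "nonneg_L2 f" and \<delta>: "\<delta> > 0"
  shows "exp (- \<Omega> T1) * inner (u T1) (heat (T2 + \<delta> - T1) f) \<le> exp (- \<Omega> T2) * inner (u T2) (heat \<delta> f)"
proof -
  define c where "c = T2 + \<delta>"
  define F where "F s = exp (- \<Omega> s) * inner (u s) (heat (c - s) f)" for s
  have \<Omega>c: "continuous_on S \<Omega>" for S
    using \<Omega>(1) by (meson DERIV_isCont continuous_at_imp_continuous_on)
  have "bounded (u ` {T1..T2})"
    by (intro compact_imp_bounded compact_continuous_image cu) simp
  then obtain Mu where Mu: "\<And>s. s \<in> {T1..T2} \<Longrightarrow> norm (u s) \<le> Mu"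
    unfolding bounded_iff by fastforce
  have Mu0: "0 \<le> Mu" using order_trans[OF norm_ge_zero Mu[of T1]] T by simp
  have "bounded ((\<lambda>s. exp (- \<Omega> s)) ` {T1..T2})"
    by (intro compact_imp_bounded compact_continuous_image continuous_intros \<Omega>c) simp
  then obtain ME where "\<forall>x\<in>(\<lambda>s. exp (- \<Omega> s)) ` {T1..T2}. norm x \<le> ME"
    unfolding bounded_iff by blast
  then have ME: "exp (- \<Omega> s) \<le> ME" if "s \<in> {T1..T2}" for s
    using that by auto
  have ME0: "0 \<le> ME" using order_trans[OF exp_ge_zero ME[of T1]] T by simp
  have "bounded ((\<lambda>s. exp (- \<Omega> s) * \<omega> s) ` {T1..T2})"
    by (intro compact_imp_bounded compact_continuous_image continuous_intros \<Omega>c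
        continuous_on_subset[OF \<Omega>(2)]) auto
  then obtain MD where "\<forall>x\<in>(\<lambda>s. exp (- \<Omega> s) * \<omega> s) ` {T1..T2}. norm x \<le> MD"
    unfolding bounded_iff by blast
  then have MD: "\<bar>exp (- \<Omega> s) * \<omega> s\<bar> \<le> MD" if "s \<in> {T1..T2}" for s
    using that by auto
  have MD0: "0 \<le> MD" using order_trans[OF abs_ge_zero MD[of T1]] T by simp
  have ed: "((\<lambda>s. exp (- \<Omega> s)) has_field_derivative - (exp (- \<Omega> s) * \<omega> s)) (at s)" for s
    by (auto intro!: derivative_eq_intros \<Omega>(1))
  \<comment> \<open>It collects the factors of \<open>dist (u p) (u q)\<close> and of
    \<open>q - p\<close> when the increment of the product of three factors is split into
    three.\<close>
  define C where "C = ME * norm f + (MD * Mu * norm f + ME * (Mu * (1 / \<delta> * norm f)))"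
  have C0: "0 \<le> C" using ME0 MD0 Mu0 \<delta> by (simp add: C_def)
  have "F T1 \<le> F T2"
  proof (rule abs_continuous_nondecreasing[OF less_imp_le[OF T] ac C0])
    fix p q assume pq: "T1 \<le> p" "p \<le> q" "q \<le> T2"
    let ?E = "\<lambda>s. exp (- \<Omega> s)" and ?H = "\<lambda>s. heat (c - s) f"
    have H: "norm (?H p) \<le> norm f" "norm (?H q) \<le> norm f"
      using pq \<delta> by (auto simp: c_def intro!: norm_heat_le)
    have Hd: "norm (?H q - ?H p) \<le> 1 / \<delta> * (q - p) * norm f"
      using pq by (intro heat_lipschitz[OF \<delta>]) (auto simp: c_def)
    have Ed: "\<bar>?E q - ?E p\<bar> \<le> MD * (q - p)"
    proof -
      have "norm (?E q - ?E p) \<le> MD * norm (q - p)"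
        by (rule field_differentiable_bound[of "{T1..T2}" _ "\<lambda>s. - (exp (- \<Omega> s) * \<omega> s)"])
          (use pq MD ed in \<open>auto intro: has_field_derivative_at_within\<close>)
      then show ?thesis using pq by simp
    qed
    have "F q - F p = ?E q * inner (u q - u p) (?H q) + ((?E q - ?E p) * inner (u p) (?H q)
        + ?E p * inner (u p) (?H q - ?H p))"
      by (simp add: F_def inner_diff_left inner_diff_right algebra_simps)
    also have "\<bar>\<dots>\<bar> \<le> \<bar>?E q * inner (u q - u p) (?H q)\<bar> + (\<bar>(?E q - ?E p) * inner (u p) (?H q)\<bar>
        + \<bar>?E p * inner (u p) (?H q - ?H p)\<bar>)"
      by linarith
    also have "\<bar>?E q * inner (u q - u p) (?H q)\<bar> \<le> ME * (dist (u p) (u q) * norm f)"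
    proof -
      have "\<bar>inner (u q - u p) (?H q)\<bar> \<le> dist (u p) (u q) * norm f"
        by (rule order_trans[OF Cauchy_Schwarz_ineq2])
          (use H in \<open>auto simp: dist_norm norm_minus_commute intro!: mult_left_mono\<close>)
      then show ?thesis
        unfolding abs_mult using ME[of q] pq ME0 by (intro mult_mono) auto
    qed
    also have "\<bar>(?E q - ?E p) * inner (u p) (?H q)\<bar> \<le> (MD * (q - p)) * (Mu * norm f)"
    proof -
      have "\<bar>inner (u p) (?H q)\<bar> \<le> Mu * norm f"
        by (rule order_trans[OF Cauchy_Schwarz_ineq2 mult_mono]) (use H Mu[of p] Mu0 pq in auto)
      then show ?thesis
        unfolding abs_mult using Ed pq MD0 by (intro mult_mono) auto
    qed
    also have "\<bar>?E p * inner (u p) (?H q - ?H p)\<bar> \<le> ME * (Mu * (1 / \<delta> * (q - p) * norm f))"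
    proof -
      have "\<bar>inner (u p) (?H q - ?H p)\<bar> \<le> Mu * (1 / \<delta> * (q - p) * norm f)"
        by (rule order_trans[OF Cauchy_Schwarz_ineq2 mult_mono]) (use Hd Mu[of p] Mu0 pq in auto)
      then show ?thesis
        unfolding abs_mult using ME[of p] pq ME0 by (intro mult_mono) auto
    qed
    also have "ME * (dist (u p) (u q) * norm f)
        + ((MD * (q - p)) * (Mu * norm f) + ME * (Mu * (1 / \<delta> * (q - p) * norm f)))
      = (ME * norm f) * dist (u p) (u q)
        + (MD * Mu * norm f + ME * (Mu * (1 / \<delta> * norm f))) * (q - p)"
      by (simp add: algebra_simps)
    also have "\<dots> \<le> C * dist (u p) (u q) + C * (q - p)"
      using ME0 MD0 Mu0 \<delta> pq
      by (intro add_mono mult_right_mono) (auto simp: C_def intro!: mult_nonneg_nonneg add_nonneg_nonneg)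
    finally show "\<bar>F q - F p\<bar> \<le> C * (dist (u p) (u q) + (q - p))"
      by (simp add: algebra_simps)
  next
    show "AE t in lborel. T1 < t \<and> t < T2 \<longrightarrow> (\<exists>D\<ge>0. (F has_field_derivative D) (at t))"
      using eq
    proof eventually_elim
      case (elim t)
      show ?case
      proof
        assume t: "T1 < t \<and> t < T2"
        with elim obtain u' where u': "(u has_vector_derivative u') (at t)" "u t \<in> dom_A"
          and nn: "nonneg_L2 (u' + op_A (u t) - \<omega> t *\<^sub>R u t)" by blast
        have tc: "t < c" using t \<delta> by (simp add: c_def)
        define h where "h = heat (c - t) f"
        define g where "g = synth (\<lambda>k. lam k * exp (- lam k * (c - t)) * coef f k)"
        have h': "((\<lambda>s. heat (c - s) f) has_vector_derivative g) (at t)"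
          unfolding g_def by (rule heat_vector_derivative[OF tc])
        have cg: "coef g k = lam k * coef h k" for k
        proof -
          have bb: "\<bar>lam k * exp (- lam k * (c - t)) * coef f k\<bar> \<le> 1 / (c - t) * \<bar>coef f k\<bar>" for k
            using mult_right_mono[OF lam_exp_le[of "c - t" "c - t" k], of "\<bar>coef f k\<bar>"] tc
            by (simp add: abs_mult abs_of_pos)
          show ?thesis
            unfolding g_def h_def coef_synth[OF summable_square_bound[OF bb]] using tc by (simp add: coef_heat)
        qed
        have sym: "inner (u t) g = inner (op_A (u t)) h"
        proof -
          have "(\<lambda>k. coef (u t) k * coef g k) sums inner (op_A (u t)) h"
            using inner_coef_sums[of "op_A (u t)" h] by (simp add: coef_op_A[OF u'(2)] cg mult_ac)
          then show ?thesis using inner_coef_sums[of "u t" g] sums_unique2 by blast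
        qed
        have "((\<lambda>s. inner (u s) (heat (c - s) f)) has_derivative
            (\<lambda>r. inner (u t) (r *\<^sub>R g) + inner (r *\<^sub>R u') h)) (at t)"
          unfolding h_def using u'(1) h' unfolding has_vector_derivative_def
          by (rule has_derivative_inner)
        then have "((\<lambda>s. inner (u s) (heat (c - s) f)) has_field_derivative (inner (u t) g + inner u' h)) (at t)"
          unfolding has_field_derivative_def by (rule has_derivative_eq_rhs) (auto simp: algebra_simps)
        from DERIV_mult[OF ed this]
        have "(F has_field_derivative exp (- \<Omega> t) * inner (u' + op_A (u t) - \<omega> t *\<^sub>R u t) h) (at t)"
          unfolding F_def[abs_def] h_def[symmetric]
          by (rule DERIV_cong) (simp add: h_def[symmetric] sym inner_add_left inner_diff_left algebra_simps)
        moreover have "0 \<le> inner (u' + op_A (u t) - \<omega> t *\<^sub>R u t) h"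
          using tc by (intro inner_nonneg_L2 nn) (simp add: h_def nonneg_heat f)
        ultimately show "\<exists>D\<ge>0. (F has_field_derivative D) (at t)"
          by (intro exI[of _ "exp (- \<Omega> t) * inner (u' + op_A (u t) - \<omega> t *\<^sub>R u t) h"]) simp
      qed
    qed
  qed
  then show ?thesis by (simp add: F_def c_def)
qed

lemma heat_comparison:
  assumes T: "T1 < T2" and cu: "continuous_on {T1..T2} u" and ac: "abs_continuous_on T1 T2 u"
    and \<Omega>: "\<And>t. (\<Omega> has_field_derivative \<omega> t) (at t)" "continuous_on UNIV \<omega>"
    and eq: "AE t in lborel. T1 < t \<and> t < T2 \<longrightarrow> (\<exists>u'. (u has_vector_derivative u') (at t) \<and>
        u t \<in> dom_A \<and> nonneg_L2 (u' + op_A (u t) - \<omega> t *\<^sub>R u t))"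
  shows "nonneg_L2 (u T2 - exp (\<Omega> T2 - \<Omega> T1) *\<^sub>R heat (T2 - T1) (u T1))"
proof (rule nonneg_L2_dual)
  fix f assume f: "nonneg_L2 f"
  define z where "z = exp (- \<Omega> T2) *\<^sub>R u T2 - exp (- \<Omega> T1) *\<^sub>R heat (T2 - T1) (u T1)"
  have "0 \<le> inner z (heat \<delta> f)" if \<delta>: "\<delta> > 0" for \<delta>
  proof -
    have eqT: "T2 + \<delta> - T1 = (T2 - T1) + \<delta>" by simp
    have "heat (T2 + \<delta> - T1) f = heat (T2 - T1) (heat \<delta> f)"
      unfolding eqT using T \<delta> by (intro heat_add) auto
    then show ?thesis
      using heat_comparison_smoothed[OF T cu ac \<Omega> eq f \<delta>] T
      by (simp add: z_def inner_diff_left inner_heat_commute)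
  qed
  then have "\<forall>\<^sub>F \<delta> in at_right 0. 0 \<le> inner z (heat \<delta> f)"
    using eventually_at_right_less[of "0::real"] by (auto elim!: eventually_mono)
  then have "0 \<le> inner z f"
    by (intro tendsto_lowerbound[OF tendsto_inner[OF tendsto_const heat_tendsto_0]]) auto
  then have "0 \<le> exp (\<Omega> T2) * inner z f" by simp
  also have "\<dots> = inner (u T2 - exp (\<Omega> T2 - \<Omega> T1) *\<^sub>R heat (T2 - T1) (u T1)) f"
    by (simp add: z_def inner_diff_left right_diff_distrib mult.assoc[symmetric] exp_add[symmetric])
  finally show "0 \<le> inner (u T2 - exp (\<Omega> T2 - \<Omega> T1) *\<^sub>R heat (T2 - T1) (u T1)) f" .
qed

section \<open>Linear problems\<close>

definition antideriv :: "(real \<Rightarrow> real) \<Rightarrow> real \<Rightarrow> real" where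
  "antideriv f t = (LBINT y=0..t. f y)"

lemma antideriv_deriv:
  assumes "continuous_on UNIV f"
  shows "(antideriv f has_field_derivative f t) (at t)"
proof -
  define a where "a = min 0 t - 1"
  define c where "c = max 0 t + 1"
  have "((\<lambda>u. LBINT y=ereal 0..ereal u. f y) has_vector_derivative f t) (at t within {a..c})"
    by (rule interval_integral_FTC2)
      (auto simp: a_def c_def intro: continuous_on_subset[OF assms])
  moreover have "at t within {a..c} = at t"
    by (rule at_within_interior) (auto simp: a_def c_def)
  ultimately show ?thesis
    by (simp add: antideriv_def[abs_def] has_real_derivative_iff_has_vector_derivative zero_ereal_def)
qed

text \<open>Both \<open>z\<close> and \<open>- z\<close> are compared with the supersolution
  \<open>Y\<close>, a constant level plus an exponentially decaying part; multiplied by the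
  integrating factor \<open>exp (M r)\<close>, the difference to \<open>Y\<close> is non-increasing
  and starts non-positive.\<close>

lemma ode_bound:
  fixes z :: "real \<Rightarrow> real"
  assumes st: "s \<le> t" and M: "\<And>r. (M has_field_derivative \<mu> r) (at r)" and \<mu>: "\<And>r. \<mu>0 \<le> \<mu> r" "0 < \<mu>0"
    and z: "\<And>r. (z has_field_derivative z' r) (at r)" "\<And>r. s \<le> r \<Longrightarrow> r \<le> t \<Longrightarrow> \<bar>z' r + \<mu> r * z r\<bar> \<le> \<eta>"
  shows "\<bar>z t\<bar> \<le> \<eta> / \<mu>0 + \<bar>z s\<bar> * exp (- \<mu>0 * (t - s))"
proof -
  define Y where "Y r = \<eta> / \<mu>0 + \<bar>z s\<bar> * exp (- \<mu>0 * (r - s))" for r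
  have \<eta>: "0 \<le> \<eta>" using z(2)[of s] st by auto
  have Yd: "(Y has_field_derivative - (\<mu>0 * (\<bar>z s\<bar> * exp (- \<mu>0 * (r - s))))) (at r)" for r
    unfolding Y_def by (auto intro!: derivative_eq_intros)
  have Y0: "0 \<le> Y r" for r using \<eta> \<mu> by (simp add: Y_def)
  have Ys: "\<eta> \<le> - (\<mu>0 * (\<bar>z s\<bar> * exp (- \<mu>0 * (r - s)))) + \<mu> r * Y r" for r
  proof -
    have "\<mu>0 * Y r \<le> \<mu> r * Y r" by (intro mult_right_mono \<mu> Y0)
    moreover have "\<mu>0 * Y r = \<eta> + \<mu>0 * (\<bar>z s\<bar> * exp (- \<mu>0 * (r - s)))"
      using \<mu>(2) by (simp add: Y_def distrib_left)
    ultimately show ?thesis by linarith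
  qed
  have le: "c * z t \<le> Y t" if c: "c = 1 \<or> c = - 1" for c
  proof -
    have "exp (M t) * (c * z t - Y t) \<le> exp (M s) * (c * z s - Y s)"
    proof (rule DERIV_nonpos_imp_nonincreasing[OF st])
      fix r assume r: "s \<le> r" "r \<le> t"
      define D where "D = exp (M r) * (c * (z' r + \<mu> r * z r)
        - (- (\<mu>0 * (\<bar>z s\<bar> * exp (- \<mu>0 * (r - s)))) + \<mu> r * Y r))"
      have "((\<lambda>r. exp (M r) * (c * z r - Y r)) has_field_derivative D) (at r)"
        unfolding D_def by (auto intro!: derivative_eq_intros M z(1) Yd simp: algebra_simps)
      moreover have "c * (z' r + \<mu> r * z r) \<le> \<eta>"
        using z(2)[OF r] c by (auto simp: abs_le_iff)
      then have "D \<le> 0"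
        unfolding D_def using Ys[of r] by (intro mult_nonneg_nonpos) auto
      ultimately show "\<exists>y. ((\<lambda>r. exp (M r) * (c * z r - Y r)) has_real_derivative y) (at r) \<and> y \<le> 0"
        by blast
    qed
    also have "\<dots> \<le> 0"
    proof -
      have "c * z s \<le> \<bar>z s\<bar>" using c by auto
      also have "\<dots> \<le> Y s" using \<eta> \<mu>(2) by (simp add: Y_def)
      finally show ?thesis by (intro mult_nonneg_nonpos) auto
    qed
    finally show ?thesis by (simp add: mult_le_0_iff not_le[symmetric])
  qed
  show ?thesis
    using le[of 1] le[of "- 1"] by (simp add: Y_def abs_le_iff)
qed

lemma lam_nonzero [simp]: "lam k \<noteq> 0"
  using lam_pos[of k] by linarith

definition one :: L2 where
  "one = L2_of (\<lambda>_. 1)"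

lemma nonneg_one: "nonneg_L2 one"
  by (simp add: one_def nonneg_L2_of square_int_const)

lemma norm_one [simp]: "norm one = 1"
proof -
  have "(norm one)\<^sup>2 = 1"
    by (simp add: one_def norm_L2_of square_int_const measure_unit_measure)
  then have "(norm one)\<^sup>2 = 1\<^sup>2" by simp
  then show ?thesis by (rule power2_eq_imp_eq) simp_all
qed

text \<open>The given problem and the autonomous limit problem are both instances, with the same
  \<open>b1\<close> and \<open>\<omega>1\<close>, so that \<open>\<kappa>\<close> and
  \<open>decay\<close> agree for the two.\<close>

locale coefficients =
  fixes b \<omega> :: "real \<Rightarrow> real" and b1 \<omega>1 :: real
  assumes b_cont: "continuous_on UNIV b" and \<omega>_cont: "continuous_on UNIV \<omega>"
    and b_bounds: "\<And>t. 0 < b t" "\<And>t. b t \<le> b1"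
    and \<omega>_bounds: "\<And>t. 0 \<le> \<omega> t" "\<And>t. \<omega> t \<le> \<omega>1" and \<omega>1: "\<omega>1 < pi\<^sup>2"
begin

definition \<Omega> :: "real \<Rightarrow> real" where
  "\<Omega> = antideriv \<omega>"

definition \<beta> :: "nat \<Rightarrow> real \<Rightarrow> real" where
  "\<beta> k = antideriv (\<lambda>r. exp (lam k * r - \<Omega> r) * b r)"

text \<open>Variation of constants for \<open>y' = (\<omega> - lam k) y + b * coef one k\<close>
  with \<open>y = 0\<close> at time \<open>s\<close>. Since \<open>\<beta> k\<close> has a base
  point independent of \<open>s\<close>, the starting time enters only through
  \<open>\<beta> k s\<close>.\<close>

definition wc :: "real \<Rightarrow> real \<Rightarrow> nat \<Rightarrow> real" where
  "wc s t k = coef one k * (exp (\<Omega> t - lam k * t) * (\<beta> k t - \<beta> k s))"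

text \<open>The solution of the linear problem starting from 0 at time \<open>s\<close>.\<close>

definition W :: "real \<Rightarrow> real \<Rightarrow> L2" where
  "W s t = synth (wc s t)"

text \<open>The largest factor for which \<open>lam_gap\<close> holds; it is attained at
  \<open>k = 0\<close>.\<close>

definition \<kappa> :: real where
  "\<kappa> = 1 - \<omega>1 / pi\<^sup>2"

lemma b1_pos: "0 < b1"
  using b_bounds[of 0] by linarith

lemma \<omega>1_nonneg: "0 \<le> \<omega>1"
  using \<omega>_bounds[of 0] by linarith

lemma \<kappa>_pos: "0 < \<kappa>"
  using \<omega>1 by (simp add: \<kappa>_def)

lemma lam_gap: "\<kappa> * lam k \<le> lam k - \<omega>1"
proof -
  have "\<omega>1 / pi\<^sup>2 * pi\<^sup>2 \<le> \<omega>1 / pi\<^sup>2 * lam k"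
    using \<omega>1_nonneg by (intro mult_left_mono lam_ge) auto
  then show ?thesis by (simp add: \<kappa>_def left_diff_distrib)
qed

lemma lam_gap_pos: "0 < lam k - \<omega>1"
  using lam_gap[of k] mult_pos_pos[OF \<kappa>_pos lam_pos[of k]] by linarith

lemma \<Omega>_deriv: "(\<Omega> has_field_derivative \<omega> t) (at t)"
  unfolding \<Omega>_def by (rule antideriv_deriv[OF \<omega>_cont])

lemma \<Omega>_cont: "continuous_on S \<Omega>"
  using \<Omega>_deriv by (meson DERIV_isCont continuous_at_imp_continuous_on)

lemma \<Omega>_le:
  assumes "s \<le> t"
  shows "\<Omega> t - \<Omega> s \<le> \<omega>1 * (t - s)"
proof -
  have "(\<lambda>r. \<Omega> r - \<omega>1 * r) t \<le> (\<lambda>r. \<Omega> r - \<omega>1 * r) s"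
  proof (rule DERIV_nonpos_imp_nonincreasing[OF assms])
    fix r
    have "((\<lambda>r. \<Omega> r - \<omega>1 * r) has_real_derivative \<omega> r - \<omega>1) (at r)"
      by (auto intro!: derivative_eq_intros \<Omega>_deriv)
    then show "\<exists>y. ((\<lambda>r. \<Omega> r - \<omega>1 * r) has_real_derivative y) (at r) \<and> y \<le> 0"
      using \<omega>_bounds(2)[of r] by (intro exI[of _ "\<omega> r - \<omega>1"]) auto
  qed
  then show ?thesis by (simp add: right_diff_distrib)
qed

lemma \<beta>_deriv: "(\<beta> k has_field_derivative exp (lam k * t - \<Omega> t) * b t) (at t)"
  unfolding \<beta>_def
  by (rule antideriv_deriv[where f = "\<lambda>r. exp (lam k * r - \<Omega> r) * b r"])
    (intro continuous_intros \<Omega>_cont b_cont)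

lemma \<beta>_cont: "continuous_on S (\<beta> k)"
  using \<beta>_deriv by (meson DERIV_isCont continuous_at_imp_continuous_on)

lemma wc_deriv: "((\<lambda>t. wc s t k) has_field_derivative (\<omega> t - lam k) * wc s t k + coef one k * b t) (at t)"
proof -
  have eq: "exp (lam k * t - \<Omega> t) * b t * exp (\<Omega> t - lam k * t) = b t"
    by (simp add: mult.commute[of _ "b t"] mult.assoc exp_add[symmetric])
  have 1: "((\<lambda>t. exp (\<Omega> t - lam k * t)) has_field_derivative exp (\<Omega> t - lam k * t) * (\<omega> t - lam k)) (at t)"
    by (auto intro!: derivative_eq_intros \<Omega>_deriv)
  have 2: "((\<lambda>t. \<beta> k t - \<beta> k s) has_field_derivative exp (lam k * t - \<Omega> t) * b t) (at t)"
    using DERIV_diff[OF \<beta>_deriv DERIV_const] by simp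
  show ?thesis
    unfolding wc_def
    by (rule DERIV_cong[OF DERIV_cmult[OF DERIV_mult[OF 1 2]]]) (simp only: eq, simp add: algebra_simps)
qed

lemma wc_same [simp]: "wc s s k = 0"
  by (simp add: wc_def)

lemma damping_deriv: "((\<lambda>r. lam k * r - \<Omega> r) has_field_derivative lam k - \<omega> r) (at r)"
  by (auto intro!: derivative_eq_intros \<Omega>_deriv)

text \<open>The forcing is at most \<open>b1 * \<bar>coef one k\<bar>\<close> and the damping at
  least \<open>lam k - \<omega>1\<close>, which in turn is at least \<open>\<kappa> * lam k\<close>.
  The factor \<open>lam k\<close> gained on the left puts \<open>W s t\<close> into the domain, with
  a bound independent of both times.\<close>

lemma wc_bound:
  assumes "s \<le> t"
  shows "lam k * \<bar>wc s t k\<bar> \<le> b1 / \<kappa> * \<bar>coef one k\<bar>"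
proof -
  have "\<bar>wc s t k\<bar> \<le> b1 * \<bar>coef one k\<bar> / (lam k - \<omega>1) + \<bar>wc s s k\<bar> * exp (- (lam k - \<omega>1) * (t - s))"
  proof (rule ode_bound[OF assms damping_deriv _ lam_gap_pos wc_deriv])
    show "lam k - \<omega>1 \<le> lam k - \<omega> r" for r using \<omega>_bounds(2)[of r] by simp
    show "\<bar>(\<omega> r - lam k) * wc s r k + coef one k * b r + (lam k - \<omega> r) * wc s r k\<bar> \<le> b1 * \<bar>coef one k\<bar>" for r
    proof -
      have "(\<omega> r - lam k) * wc s r k + coef one k * b r + (lam k - \<omega> r) * wc s r k = b r * coef one k"
        by (simp add: algebra_simps)
      then show ?thesis
        using b_bounds[of r] by (simp only: abs_mult) (intro mult_right_mono, auto)
    qed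
  qed
  then have "lam k * \<bar>wc s t k\<bar> \<le> lam k * (b1 * \<bar>coef one k\<bar> / (lam k - \<omega>1))"
    by (intro mult_left_mono) (auto simp: less_imp_le)
  also have "\<dots> \<le> lam k * (b1 * \<bar>coef one k\<bar> / (\<kappa> * lam k))"
    using b1_pos \<kappa>_pos lam_gap_pos[of k] lam_gap[of k]
    by (intro mult_left_mono divide_left_mono mult_nonneg_nonneg mult_pos_pos) (auto simp: less_imp_le)
  also have "\<dots> = b1 / \<kappa> * \<bar>coef one k\<bar>"
    using \<kappa>_pos by simp
  finally show ?thesis .
qed

lemma lam_ge_1: "1 \<le> lam k"
  using freq_ge_1[of k] power_mono[of 1 "freq k" 2] by (simp add: lam_def)

lemma wc_le:
  assumes "s \<le> t"
  shows "\<bar>wc s t k\<bar> \<le> b1 / \<kappa> * \<bar>coef one k\<bar>"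
  using wc_bound[OF assms, of k] mult_right_mono[OF lam_ge_1[of k], of "\<bar>wc s t k\<bar>"] by simp

lemma coef_W: "s \<le> t \<Longrightarrow> coef (W s t) k = wc s t k"
  unfolding W_def by (rule coef_synth[OF summable_square_bound[OF wc_le]])

lemma W_same [simp]: "W s s = 0"
  by (rule coef_eqI) (simp add: coef_W)

lemma W_dom_A:
  assumes "s \<le> t"
  shows "W s t \<in> dom_A" "coef (op_A (W s t)) k = lam k * wc s t k"
proof -
  define g where "g = synth (\<lambda>k. lam k * wc s t k)"
  have "\<bar>lam k * wc s t k\<bar> \<le> b1 / \<kappa> * \<bar>coef one k\<bar>" for k
    using wc_bound[OF assms, of k] by (simp add: abs_mult abs_of_pos)
  from coef_synth[OF summable_square_bound[OF this]]
  have g: "coef g k = lam k * coef (W s t) k" for k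
    by (simp add: g_def coef_W[OF assms])
  show "W s t \<in> dom_A" by (rule dom_A_I[OF g])
  show "coef (op_A (W s t)) k = lam k * wc s t k"
    using op_A_eq[OF g] by (simp add: g coef_W[OF assms])
qed

text \<open>A Lipschitz constant of \<open>W s\<close> in time, the same for all \<open>s\<close>:
  its summands bound the terms \<open>\<omega> t *\<^sub>R W s t\<close>,
  \<open>op_A (W s t)\<close> and \<open>b t *\<^sub>R one\<close> of the derivative.\<close>

definition rate :: real where
  "rate = \<omega>1 * (b1 / \<kappa>) + b1 / \<kappa> + b1"

lemma rate_nonneg: "0 \<le> rate"
  using b1_pos \<kappa>_pos \<omega>1_nonneg by (simp add: rate_def)

lemma wc_rate:
  assumes "s \<le> t"
  shows "\<bar>(\<omega> t - lam k) * wc s t k + coef one k * b t\<bar> \<le> rate * \<bar>coef one k\<bar>"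
proof -
  have "\<bar>(\<omega> t - lam k) * wc s t k + coef one k * b t\<bar>
      \<le> \<omega> t * \<bar>wc s t k\<bar> + lam k * \<bar>wc s t k\<bar> + b t * \<bar>coef one k\<bar>"
  proof -
    have "(\<omega> t - lam k) * wc s t k + coef one k * b t
        = \<omega> t * wc s t k - lam k * wc s t k + b t * coef one k"
      by (simp add: algebra_simps)
    also have "\<bar>\<dots>\<bar> \<le> \<bar>\<omega> t * wc s t k\<bar> + \<bar>lam k * wc s t k\<bar> + \<bar>b t * coef one k\<bar>"
      by linarith
    finally show ?thesis
      using \<omega>_bounds(1)[of t] b_bounds(1)[of t] by (simp add: abs_mult abs_of_pos)
  qed
  also have "\<dots> \<le> \<omega>1 * (b1 / \<kappa> * \<bar>coef one k\<bar>) + b1 / \<kappa> * \<bar>coef one k\<bar> + b1 * \<bar>coef one k\<bar>"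
    using \<omega>_bounds b_bounds \<omega>1_nonneg
    by (intro add_mono mult_mono wc_bound wc_le assms mult_right_mono) auto
  finally show ?thesis by (simp add: rate_def algebra_simps)
qed

lemma W_vector_derivative:
  assumes "s < t"
  shows "(W s has_vector_derivative b t *\<^sub>R one + \<omega> t *\<^sub>R W s t - op_A (W s t)) (at t)"
proof (rule vector_derivative_coef[where S = "{s<..}" and B = "\<lambda>k. rate * \<bar>coef one k\<bar>"
      and x' = "\<lambda>t. b t *\<^sub>R one + \<omega> t *\<^sub>R W s t - op_A (W s t)"])
  fix k r assume r: "r \<in> {s<..}"
  have eq: "coef (b r *\<^sub>R one + \<omega> r *\<^sub>R W s r - op_A (W s r)) k = (\<omega> r - lam k) * wc s r k + coef one k * b r"
    using r by (simp add: coef_W W_dom_A algebra_simps)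
  have "((\<lambda>r. coef (W s r) k) has_field_derivative (\<omega> r - lam k) * wc s r k + coef one k * b r) (at r)"
    by (rule has_field_derivative_transform_within_open[OF wc_deriv, of "{s<..}"])
      (use r in \<open>auto simp: coef_W\<close>)
  then show "((\<lambda>r. coef (W s r) k) has_field_derivative coef (b r *\<^sub>R one + \<omega> r *\<^sub>R W s r - op_A (W s r)) k) (at r)"
    unfolding eq .
  show "\<bar>coef (b r *\<^sub>R one + \<omega> r *\<^sub>R W s r - op_A (W s r)) k\<bar> \<le> rate * \<bar>coef one k\<bar>"
    unfolding eq by (rule wc_rate) (use r in auto)
next
  show "summable (\<lambda>k. (rate * \<bar>coef one k\<bar>)\<^sup>2)"
    by (rule summable_square_bound[of _ rate one]) (use rate_nonneg in \<open>simp add: abs_mult\<close>)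
qed (use assms in auto)

lemma W_lipschitz:
  assumes "s \<le> p" "p \<le> q"
  shows "dist (W s p) (W s q) \<le> rate * (q - p)"
proof -
  have "norm (W s q - W s p) \<le> rate * (q - p) * norm one"
  proof (rule norm_le_coef)
    fix k
    have "norm (wc s q k - wc s p k) \<le> (rate * \<bar>coef one k\<bar>) * norm (q - p)"
      by (rule field_differentiable_bound[of "{s..}" _ "\<lambda>t. (\<omega> t - lam k) * wc s t k + coef one k * b t"])
        (use assms wc_rate in \<open>auto intro: has_field_derivative_at_within[OF wc_deriv]\<close>)
    then show "\<bar>coef (W s q - W s p) k\<bar> \<le> rate * (q - p) * \<bar>coef one k\<bar>"
      using assms by (simp add: coef_W mult_ac)
  qed (use assms rate_nonneg in auto)
  then show ?thesis by (simp add: dist_norm norm_minus_commute)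
qed

lemma W_abs_continuous: "s \<le> T1 \<Longrightarrow> abs_continuous_on T1 T2 (W s)"
  by (rule abs_continuous_on_lipschitz[OF rate_nonneg]) (auto intro: W_lipschitz)

text \<open>Comparison starts at time \<open>s\<close> itself, where \<open>W s s\<close> is 0, so
  the minorant provided by the heat flow is 0. The residual is the non-negative constant function
  \<open>b r *\<^sub>R one\<close>.\<close>

lemma W_nonneg:
  assumes "s \<le> t"
  shows "nonneg_L2 (W s t)"
proof (cases "s = t")
  case False
  then have st: "s < t" using assms by simp
  have "nonneg_L2 (W s t - exp (\<Omega> t - \<Omega> s) *\<^sub>R heat (t - s) (W s s))"
  proof (rule heat_comparison[OF st _ _ \<Omega>_deriv \<omega>_cont])
    show "continuous_on {s..t} (W s)"
      by (rule lipschitz_continuous_on[OF _ rate_nonneg]) (auto intro: W_lipschitz)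
    show "abs_continuous_on s t (W s)" by (rule W_abs_continuous) simp
    show "AE r in lborel. s < r \<and> r < t \<longrightarrow> (\<exists>u'. (W s has_vector_derivative u') (at r) \<and>
        W s r \<in> dom_A \<and> nonneg_L2 (u' + op_A (W s r) - \<omega> r *\<^sub>R W s r))"
    proof (intro AE_I2 impI)
      fix r assume r: "s < r \<and> r < t"
      have "nonneg_L2 (b r *\<^sub>R one)"
        using b_bounds(1)[of r] by (intro nonneg_L2_scaleR nonneg_one) simp
      then show "\<exists>u'. (W s has_vector_derivative u') (at r) \<and>
        W s r \<in> dom_A \<and> nonneg_L2 (u' + op_A (W s r) - \<omega> r *\<^sub>R W s r)"
        using r by (intro exI[of _ "b r *\<^sub>R one + \<omega> r *\<^sub>R W s r - op_A (W s r)"])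
          (auto intro: W_vector_derivative W_dom_A)
    qed
  qed
  moreover have "heat (t - s) 0 = 0" using st by (intro coef_eqI) (simp add: coef_heat)
  ultimately show ?thesis by simp
qed simp

end

section \<open>Existence of solutions leaving the origin\<close>

context coefficients
begin

text \<open>Waiting at 0 is compatible with the inclusion because \<open>H_0 0\<close> contains 0;
  from time \<open>s\<close> on the selection is 1. As \<open>s\<close> is arbitrary, zero data
  admit all these solutions.\<close>

definition leave :: "real \<Rightarrow> real \<Rightarrow> L2" where
  "leave s t = (if t \<le> s then 0 else W s t)"

lemma leave_lipschitz: "p \<le> q \<Longrightarrow> dist (leave s p) (leave s q) \<le> rate * (q - p)"
proof -
  assume pq: "p \<le> q"
  consider "q \<le> s" | "p \<le> s" "s < q" | "s < p" by linarith
  then show ?thesis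
  proof cases
    case 1
    then show ?thesis using pq rate_nonneg by (simp add: leave_def)
  next
    case 2
    then have "dist (leave s p) (leave s q) = dist (W s s) (W s q)"
      by (simp add: leave_def)
    also have "\<dots> \<le> rate * (q - s)"
      using 2 by (intro W_lipschitz) auto
    also have "\<dots> \<le> rate * (q - p)"
      using 2 rate_nonneg by (intro mult_left_mono) auto
    finally show ?thesis .
  next
    case 3
    then show ?thesis using pq by (simp add: leave_def W_lipschitz)
  qed
qed

lemma leave_dom_A: "leave s t \<in> dom_A" and op_A_leave: "t \<le> s \<Longrightarrow> op_A (leave s t) = 0"
proof -
  have "coef 0 k = lam k * coef 0 k" for k by simp
  note z = dom_A_I[OF this] op_A_eq[OF this]
  show "leave s t \<in> dom_A" "t \<le> s \<Longrightarrow> op_A (leave s t) = 0"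
    using z W_dom_A(1)[of s t] by (auto simp: leave_def)
qed

lemma leave_nonneg: "leave s t \<in> H_pos"
  using W_nonneg[of s t] by (auto simp: leave_def H_pos_def)

lemma leave_derivative:
  assumes "t \<noteq> s"
  shows "\<exists>u'. (leave s has_vector_derivative u') (at t) \<and>
    u' + op_A (leave s t) = (if t > s then b t else 0) *\<^sub>R one + \<omega> t *\<^sub>R leave s t"
proof (cases "t < s")
  case True
  have "((\<lambda>_. 0) has_vector_derivative 0) (at t)" by simp
  then have "(leave s has_vector_derivative 0) (at t)"
    by (rule has_vector_derivative_transform_within_open[of _ _ _ "{..<s}"])
      (use True in \<open>auto simp: leave_def\<close>)
  then show ?thesis
    using True by (intro exI[of _ 0]) (simp add: op_A_leave, simp add: leave_def)
next
  case False
  then have st: "s < t" using assms by simp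
  have "(leave s has_vector_derivative b t *\<^sub>R one + \<omega> t *\<^sub>R W s t - op_A (W s t)) (at t)"
    by (rule has_vector_derivative_transform_within_open[OF W_vector_derivative[OF st], of "{s<..}"])
      (use st in \<open>auto simp: leave_def\<close>)
  then show ?thesis
    using st by (intro exI[of _ "b t *\<^sub>R one + \<omega> t *\<^sub>R W s t - op_A (W s t)"]) (simp add: leave_def)
qed

lemma wc_series_square_int:
  assumes "s \<le> t"
  shows "square_int (\<lambda>x. \<Sum>k. wc s t k * sinb k x)" "L2_of (\<lambda>x. \<Sum>k. wc s t k * sinb k x) = W s t"
proof -
  have "(\<lambda>x. \<Sum>k. wc s t k * sinb k x) = ser (W s t)"
    by (simp add: ser_def[abs_def] coef_W[OF assms])
  then show "square_int (\<lambda>x. \<Sum>k. wc s t k * sinb k x)" "L2_of (\<lambda>x. \<Sum>k. wc s t k * sinb k x) = W s t"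
    using L2_of_ser[OF W_dom_A(1)[OF assms]] by simp_all
qed

text \<open>Taking the maximum with 0 changes the representative only on a null set.\<close>

definition leave_rep :: "real \<Rightarrow> real \<times> real \<Rightarrow> real" where
  "leave_rep s p = (if fst p > s then max 0 (\<Sum>k. wc s (fst p) k * sinb k (snd p)) else 0)"

lemma leave_rep_represents: "represents (\<lambda>x. leave_rep s (t, x)) (leave s t)"
proof (cases "t > s")
  case True
  define f where "f x = (\<Sum>k. wc s t k * sinb k x)" for x
  have f: "square_int f" "L2_of f = W s t"
    using wc_series_square_int[of s t] True by (simp_all add: f_def[abs_def])
  have sq: "square_int (\<lambda>x. max 0 (f x))"
    by (intro square_int_max square_int_zero f)
  have "AE x in unit_measure. 0 \<le> f x"
    using W_nonneg[of s t] True f by (simp add: nonneg_L2_of[OF f(1), symmetric])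
  then have "AE x in unit_measure. max 0 (f x) = f x"
    by eventually_elim simp
  then have "L2_of (\<lambda>x. max 0 (f x)) = W s t"
    using L2_of_eq_iff[OF sq f(1)] f(2) by simp
  then show ?thesis
    using sq True by (simp add: represents_def leave_rep_def leave_def f_def)
next
  case False
  then show ?thesis
    by (simp add: represents_def leave_rep_def leave_def L2_of_zero square_int_zero)
qed

text \<open>Every term of the series is continuous in both variables together, which settles the
  joint measurability of the representative.\<close>

lemma leave_rep_measurable: "leave_rep s \<in> borel_measurable borel"
proof -
  have wcc: "continuous_on UNIV (\<lambda>t. wc s t k)" for k
    using wc_deriv by (meson DERIV_isCont continuous_at_imp_continuous_on)
  have "(\<lambda>p. wc s (fst p) k * sinb k (snd p)) \<in> borel_measurable borel" for k
    by (intro borel_measurable_continuous_onI continuous_intros continuous_on_compose2[OF wcc]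
        continuous_on_compose2[OF continuous_on_sinb]) auto
  then have m: "(\<lambda>p. \<Sum>k. wc s (fst p) k * sinb k (snd p)) \<in> borel_measurable borel"
    by (rule borel_measurable_suminf)
  have "open {p :: real \<times> real. s < fst p}"
    by (intro open_Collect_less continuous_intros)
  then have "{p :: real \<times> real. s < fst p} \<in> sets borel" by (rule borel_open)
  then show ?thesis
    unfolding leave_rep_def[abs_def]
    by (intro measurable_If borel_measurable_max m borel_measurable_const) auto
qed

lemma leave_strong_solution: "nonneg_strong_solution b \<omega> \<tau> (leave s)"
  unfolding nonneg_strong_solution_def
proof (intro conjI allI impI leave_nonneg)
  define r where "r t = (if t > s then b t else 0) *\<^sub>R one" for t
  have bm: "b \<in> borel_measurable borel"
    by (rule borel_measurable_continuous_onI[OF b_cont])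
  have gm: "(\<lambda>t. if t > s then b t else 0) \<in> borel_measurable borel"
    using bm by measurable
  have rm: "r \<in> borel_measurable borel"
    unfolding r_def
    by (rule measurable_compose[OF gm borel_measurable_continuous_onI]) (intro continuous_intros)
  have "L2_loc \<tau> r"
    unfolding L2_loc_def
  proof (intro conjI allI impI)
    show "r \<in> borel_measurable (restrict_space lborel {\<tau>..})"
      by (rule measurable_restrict_space1) (use rm in simp)
    fix T assume "\<tau> < T"
    have "norm (r t) \<le> b1" for t
      using b_bounds[of t] b1_pos by (simp add: r_def)
    then have "norm ((norm (r t))\<^sup>2) \<le> b1\<^sup>2" for t
      using power_mono[of "norm (r t)" b1 2] by simp
    moreover have "(\<lambda>t. (norm (r t))\<^sup>2) \<in> borel_measurable borel"
    proof -
      have "(\<lambda>t. (norm (r t))\<^sup>2) = (\<lambda>t. (if t > s then b t else 0)\<^sup>2)"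
        by (simp add: r_def fun_eq_iff)
      then show ?thesis using borel_measurable_power[OF gm, of 2] by simp
    qed
    ultimately show "set_integrable lborel {\<tau>..T} (\<lambda>t. (norm (r t))\<^sup>2)"
      using b1_pos
      by (intro set_integrable_bound[OF borel_integrable_atLeastAtMost'[OF continuous_on_const[of _ "b1\<^sup>2"]]])
        (auto simp: set_borel_measurable_def)
  qed
  moreover have "selection_of_H_0 b \<tau> (leave s) r"
    unfolding selection_of_H_0_def
  proof (intro exI conjI)
    show "joint_representative \<tau> (leave_rep s) (leave s)"
      unfolding joint_representative_def
      by (intro conjI AE_I2 impI leave_rep_represents measurable_restrict_space1)
        (use leave_rep_measurable in simp)
    define rf where "rf p = (if fst p > s then b (fst p) else 0)" for p :: "real \<times> real"
    have rfm: "rf \<in> borel_measurable borel"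
      unfolding rf_def
      by (rule measurable_compose[OF borel_measurable_continuous_onI gm]) (intro continuous_intros)
    have rrep: "represents (\<lambda>x. rf (t, x)) (r t)" for t
    proof -
      have "L2_of (\<lambda>x. (if t > s then b t else 0) * 1) = r t"
        unfolding r_def one_def by (rule L2_of_scale[OF square_int_const])
      then show ?thesis
        by (cases "t > s") (simp_all add: represents_def rf_def square_int_const)
    qed
    show "joint_representative \<tau> rf r"
      unfolding joint_representative_def
      by (intro conjI AE_I2 impI rrep measurable_restrict_space1) (use rfm in simp)
    have "rf (t, x) \<in> (\<lambda>z. b t * z) ` H_0 (leave_rep s (t, x))" for t x
    proof (cases "t > s")
      case True
      \<comment> \<open>The value 1 belongs to \<open>H_0\<close> of every non-negative number, 0
        included; the maximum in \<open>leave_rep\<close> ensures non-negativity at every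
        point.\<close>
      then have "1 \<in> H_0 (leave_rep s (t, x))"
        by (auto simp: H_0_def leave_rep_def max_def)
      then show ?thesis using True by (intro image_eqI[of _ _ 1]) (auto simp: rf_def)
    next
      case False
      then have "0 \<in> H_0 (leave_rep s (t, x))" by (auto simp: H_0_def leave_rep_def)
      then show ?thesis using False by (intro image_eqI[of _ _ 0]) (auto simp: rf_def)
    qed
    then show "AE (t, x) in lborel. t > \<tau> \<and> 0 < x \<and> x < 1 \<longrightarrow>
        rf (t, x) \<in> (\<lambda>z. b t * z) ` H_0 (leave_rep s (t, x))"
      by (intro AE_I2) auto
  qed
  moreover have "AE t in lborel. t > \<tau> \<longrightarrow> (\<exists>u'. (leave s has_vector_derivative u') (at t) \<and>
      u' + op_A (leave s t) = r t + \<omega> t *\<^sub>R leave s t)"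
    using AE_lborel_singleton[of s]
    by eventually_elim (use leave_derivative in \<open>auto simp: r_def\<close>)
  moreover have "continuous_on {\<tau>..} (leave s)"
    by (rule lipschitz_continuous_on[OF leave_lipschitz rate_nonneg])
  moreover have "abs_continuous_on T1 T2 (leave s)" for T1 T2
    by (rule abs_continuous_on_lipschitz[OF rate_nonneg leave_lipschitz])
  ultimately show "strong_solution b \<omega> \<tau> (leave s)"
    unfolding strong_solution_def using leave_dom_A by auto
qed

lemma W_in_U_pos:
  assumes "\<tau> \<le> s" "s \<le> t"
  shows "W s t \<in> U_pos b \<omega> t \<tau> 0"
proof -
  have "leave s \<tau> = 0" "leave s t = W s t"
    using assms by (auto simp: leave_def)
  then show ?thesis
    unfolding U_pos_def using leave_strong_solution by (intro CollectI exI[of _ "leave s"]) auto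
qed

end

section \<open>The reaction term of a non-negative solution\<close>

text \<open>The scalar function \<open>inner (u s) \<phi>\<close> is non-negative near
  \<open>t\<close> and 0 at \<open>t\<close>, so its one-sided difference quotients have opposite
  signs.\<close>

lemma derivative_on_zero_set:
  assumes d: "(u has_vector_derivative d) (at t)"
    and nn: "eventually (\<lambda>s. nonneg_L2 (u s)) (at t)"
    and \<phi>: "nonneg_L2 \<phi>" "inner (u t) \<phi> = 0"
  shows "inner d \<phi> = 0"
proof -
  have lim: "((\<lambda>s. inner ((u s - u t) /\<^sub>R (s - t)) \<phi>) \<longlongrightarrow> inner d \<phi>) (at t)"
    using d unfolding has_vector_derivative_iff_quotient by (intro tendsto_inner tendsto_const)
  have pos: "eventually (\<lambda>s. 0 \<le> inner (u s) \<phi>) (at t)"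
    using nn by eventually_elim (intro inner_nonneg_L2 \<phi>)
  have r: "((\<lambda>s. inner ((u s - u t) /\<^sub>R (s - t)) \<phi>) \<longlongrightarrow> inner d \<phi>) (at_right t)"
    and l: "((\<lambda>s. inner ((u s - u t) /\<^sub>R (s - t)) \<phi>) \<longlongrightarrow> inner d \<phi>) (at_left t)"
    using lim by (simp_all add: filterlim_at_split)
  have "0 \<le> inner d \<phi>"
  proof (rule tendsto_lowerbound[OF r])
    have "eventually (\<lambda>s. 0 \<le> inner (u s) \<phi>) (at_right t)"
      using pos by (simp add: eventually_at_split)
    then show "\<forall>\<^sub>F s in at_right t. 0 \<le> inner ((u s - u t) /\<^sub>R (s - t)) \<phi>"
      using eventually_at_right_less[of t]
      by eventually_elim (simp add: inner_diff_left \<phi>)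
  qed simp
  moreover have "inner d \<phi> \<le> 0"
  proof (rule tendsto_upperbound[OF l])
    have "eventually (\<lambda>s. 0 \<le> inner (u s) \<phi>) (at_left t)"
      using pos by (simp add: eventually_at_split)
    moreover have "eventually (\<lambda>s. s < t) (at_left t)"
      by (simp add: eventually_at_filter)
    ultimately show "\<forall>\<^sub>F s in at_left t. inner ((u s - u t) /\<^sub>R (s - t)) \<phi> \<le> 0"
      by eventually_elim (simp add: inner_diff_left \<phi> mult_nonpos_nonneg)
  qed simp
  ultimately show ?thesis by simp
qed

text \<open>\<open>\<phi> 1\<close> and \<open>\<phi> (- 1)\<close> are the positive and the
  negative part of \<open>df\<close> on the zero set of \<open>vf\<close>. Both are orthogonal to
  \<open>df\<close>, hence so is their difference \<open>\<psi>\<close>, which coincides with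
  \<open>df\<close> on that set and is 0 elsewhere.\<close>

lemma derivative_zero_AE:
  assumes d: "(u has_vector_derivative L2_of df) (at t)" and df: "square_int df"
    and nn: "eventually (\<lambda>s. nonneg_L2 (u s)) (at t)"
    and vf: "square_int vf" "u t = L2_of vf"
  shows "AE x in unit_measure. vf x = 0 \<longrightarrow> df x = 0"
proof -
  define \<phi> where "\<phi> c x = (if vf x = 0 then max (c * df x) 0 else 0)" for c x :: real
  have vm: "vf \<in> borel_measurable unit_measure" and dm: "df \<in> borel_measurable unit_measure"
    using vf df by (auto intro: square_int_measurable)
  have \<phi>: "square_int (\<phi> c)" for c
  proof (rule square_int_mono[OF _ square_int_scale[OF df, of c]])
    show "\<phi> c \<in> borel_measurable unit_measure"
      unfolding \<phi>_def using vm dm by measurable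
  qed (auto simp: \<phi>_def)
  have z: "inner (L2_of df) (L2_of (\<phi> c)) = 0" for c
  proof (rule derivative_on_zero_set[OF d nn])
    show "nonneg_L2 (L2_of (\<phi> c))"
      by (simp add: nonneg_L2_of \<phi>) (simp add: \<phi>_def)
    have vz: "vf x * \<phi> c x = 0" for x by (simp add: \<phi>_def)
    show "inner (u t) (L2_of (\<phi> c)) = 0"
      unfolding vf(2) inner_L2_of[OF vf(1) \<phi>] vz by simp
  qed
  define \<psi> where "\<psi> x = \<phi> 1 x - \<phi> (- 1) x" for x
  have \<psi>: "square_int \<psi>" unfolding \<psi>_def by (intro square_int_diff \<phi>)
  have "inner (L2_of df) (L2_of \<psi>) = 0"
    unfolding \<psi>_def by (simp add: L2_of_diff \<phi> inner_diff_right z)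
  then have "(\<integral>x. df x * \<psi> x \<partial>unit_measure) = 0"
    by (simp add: inner_L2_of df \<psi>)
  moreover have "df x * \<psi> x = (\<psi> x)\<^sup>2" for x
    by (auto simp: \<psi>_def \<phi>_def max_def power2_eq_square)
  ultimately have "(norm (L2_of \<psi>))\<^sup>2 = 0"
    by (simp add: norm_L2_of \<psi>)
  then have "AE x in unit_measure. \<psi> x = 0"
    using L2_of_eq_zero_iff[OF \<psi>] by simp
  then show ?thesis
    by eventually_elim (auto simp: \<psi>_def \<phi>_def max_def split: if_splits)
qed

text \<open>The set where the continuous representative is negative is open and of measure zero,
  hence empty.\<close>

lemma ser_nonneg:
  assumes v: "v \<in> dom_A" "nonneg_L2 v" and x: "0 < x" "x < 1"
  shows "0 \<le> ser v x"
proof (rule ccontr)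
  assume "\<not> 0 \<le> ser v x"
  define S where "S = {y\<in>{0<..<1}. ser v y < 0}"
  have "open S"
  proof -
    have "S = {0<..<1} \<inter> {y. ser v y < 0}" by (auto simp: S_def)
    then show ?thesis
      using continuous_on_ser[OF v(1), of UNIV]
      by (simp add: open_Int open_Collect_less continuous_on_const)
  qed
  moreover have "S \<noteq> {}" using x \<open>\<not> 0 \<le> ser v x\<close> by (auto simp: S_def)
  moreover have "negligible S"
  proof -
    have "nonneg_L2 (L2_of (ser v))" unfolding L2_of_ser(1)[OF v(1)] by (rule v)
    then have "AE y in unit_measure. 0 \<le> ser v y"
      unfolding nonneg_L2_of[OF L2_of_ser(2)[OF v(1)]] .
    then have "AE y in lborel. y \<notin> S"
      by (auto simp: AE_restrict_space_iff S_def elim!: eventually_mono)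
    then have "AE y in lebesgue. y \<notin> S"
      by (simp add: AE_completion_iff)
    moreover have "S \<in> sets lebesgue" using \<open>open S\<close> by simp
    ultimately show ?thesis
      by (simp add: negligible_iff_null_sets AE_iff_null_sets)
  qed
  ultimately show False using open_not_negligible by blast
qed

text \<open>A zero of a non-negative differentiable function in the open interval is a minimum,
  hence a critical point.\<close>

lemma op_A_zero_AE:
  assumes v: "v \<in> dom_A" "nonneg_L2 v"
  shows "AE x in unit_measure. ser v x = 0 \<longrightarrow> rep_L2 (op_A v) x = 0"
  using op_A_zero_on_critical[OF v(1)] AE_space
proof eventually_elim
  case (elim x)
  show ?case
  proof
    assume z: "ser v x = 0"
    have x: "0 < x" "x < 1" using elim(2) by auto
    have "ser' v x = 0"
    proof (rule DERIV_local_min[OF ser_deriv[OF v(1)]])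
      show "0 < min x (1 - x)" using x by simp
      show "\<forall>y. \<bar>x - y\<bar> < min x (1 - x) \<longrightarrow> ser v x \<le> ser v y"
        using z ser_nonneg[OF v] by auto
    qed
    then show "rep_L2 (op_A v) x = 0" using elim(1) by simp
  qed
qed

text \<open>Where \<open>vf\<close> is positive, \<open>H_0\<close> leaves the single value
  \<open>c\<close>. Where it is 0, three of the four terms of the equation vanish almost everywhere,
  and with them the fourth, \<open>rf\<close>.\<close>

lemma reaction_AE:
  assumes d: "(u has_vector_derivative d) (at t)"
    and nn: "eventually (\<lambda>s. nonneg_L2 (u s)) (at t)" "nonneg_L2 (u t)"
    and dom: "u t \<in> dom_A" and eq: "d + op_A (u t) = \<rho> + w *\<^sub>R u t"
    and vf: "represents vf (u t)" and rf: "represents rf \<rho>"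
    and sel: "AE x in unit_measure. rf x \<in> (\<lambda>z. c * z) ` H_0 (vf x)"
  shows "AE x in unit_measure. 0 \<le> vf x \<and> rf x = (if vf x > 0 then c else 0)"
proof -
  define df where "df = rep_L2 d"
  define qf where "qf = rep_L2 (op_A (u t))"
  have sq: "square_int df" "square_int qf" "square_int vf" "square_int rf"
    using vf rf by (auto simp: df_def qf_def square_int_rep represents_def)
  have L: "L2_of df = d" "L2_of qf = op_A (u t)" "L2_of vf = u t" "L2_of rf = \<rho>"
    using vf rf by (auto simp: df_def qf_def represents_def)
  have 1: "AE x in unit_measure. vf x = 0 \<longrightarrow> df x = 0"
    using d L sq by (intro derivative_zero_AE[OF _ _ nn(1)]) auto
  have "L2_of vf = L2_of (ser (u t))"
    by (simp add: L L2_of_ser[OF dom])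
  then have 2: "AE x in unit_measure. vf x = ser (u t) x"
    using L2_of_eq_iff[OF sq(3) L2_of_ser(2)[OF dom]] by simp
  have "L2_of (\<lambda>x. df x + qf x) = L2_of (\<lambda>x. rf x + w * vf x)"
    using eq sq by (simp add: L2_of_add L2_of_scale square_int_scale L)
  then have 3: "AE x in unit_measure. df x + qf x = rf x + w * vf x"
    using L2_of_eq_iff[OF square_int_add[OF sq(1,2)] square_int_add[OF sq(4) square_int_scale[OF sq(3)]]]
    by simp
  have 4: "AE x in unit_measure. 0 \<le> vf x"
    using nn(2) unfolding L(3)[symmetric] nonneg_L2_of[OF sq(3)] .
  show ?thesis
    using 1 2 3 4 sel op_A_zero_AE[OF dom nn(2)]
    by eventually_elim (auto simp: H_0_def qf_def split: if_splits)
qed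

section \<open>Structure of the non-negative solutions\<close>

lemma abs_continuous_on_diff:
  fixes u w :: "real \<Rightarrow> 'a::real_normed_vector"
  assumes "abs_continuous_on a b u" "abs_continuous_on a b w"
  shows "abs_continuous_on a b (\<lambda>t. u t - w t)"
  unfolding abs_continuous_on_def
proof (intro allI impI)
  fix \<epsilon> :: real assume "\<epsilon> > 0"
  then have e: "\<epsilon> / 2 > 0" by simp
  let ?Q = "\<lambda>\<delta> (n::nat) p q. (\<forall>i<n. a \<le> p i \<and> p i \<le> q i \<and> q i \<le> b) \<and>
      disjoint_family_on (\<lambda>i. {p i<..<q i}) {..<n} \<and> (\<Sum>i<n. q i - p i) < \<delta>"
  obtain \<delta>1 where \<delta>1: "\<delta>1 > 0" "\<And>n p q. ?Q \<delta>1 n p q \<Longrightarrow> (\<Sum>i<n. dist (u (p i)) (u (q i))) < \<epsilon> / 2"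
    using assms(1) e unfolding abs_continuous_on_def by meson
  obtain \<delta>2 where \<delta>2: "\<delta>2 > 0" "\<And>n p q. ?Q \<delta>2 n p q \<Longrightarrow> (\<Sum>i<n. dist (w (p i)) (w (q i))) < \<epsilon> / 2"
    using assms(2) e unfolding abs_continuous_on_def by meson
  show "\<exists>\<delta>>0. \<forall>n p q. ?Q \<delta> n p q \<longrightarrow> (\<Sum>i<n. dist (u (p i) - w (p i)) (u (q i) - w (q i))) < \<epsilon>"
  proof (intro exI[of _ "min \<delta>1 \<delta>2"] conjI allI impI)
    fix n and p q :: "nat \<Rightarrow> real"
    assume Q: "?Q (min \<delta>1 \<delta>2) n p q"
    have "(\<Sum>i<n. dist (u (p i) - w (p i)) (u (q i) - w (q i)))
        \<le> (\<Sum>i<n. dist (u (p i)) (u (q i)) + dist (w (p i)) (w (q i)))"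
    proof (rule sum_mono)
      fix i
      have "u (p i) - w (p i) - (u (q i) - w (q i)) = (u (p i) - u (q i)) - (w (p i) - w (q i))"
        by simp
      then show "dist (u (p i) - w (p i)) (u (q i) - w (q i)) \<le> dist (u (p i)) (u (q i)) + dist (w (p i)) (w (q i))"
        unfolding dist_norm by (metis norm_triangle_ineq4)
    qed
    also have "\<dots> = (\<Sum>i<n. dist (u (p i)) (u (q i))) + (\<Sum>i<n. dist (w (p i)) (w (q i)))"
      by (rule sum.distrib)
    also have "\<dots> < \<epsilon>"
      using \<delta>1(2)[of n p q] \<delta>2(2)[of n p q] Q by auto
    finally show "(\<Sum>i<n. dist (u (p i) - w (p i)) (u (q i) - w (q i))) < \<epsilon>" .
  qed (use \<delta>1 \<delta>2 in simp)
qed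

lemma dom_A_diff:
  assumes "v \<in> dom_A" "w \<in> dom_A"
  shows "v - w \<in> dom_A" "op_A (v - w) = op_A v - op_A w"
proof -
  have "coef (op_A v - op_A w) k = lam k * coef (v - w) k" for k
    using assms by (simp add: coef_op_A right_diff_distrib)
  then show "v - w \<in> dom_A" "op_A (v - w) = op_A v - op_A w"
    by (blast intro: dom_A_I, blast intro: op_A_eq)
qed

context coefficients
begin

lemma solution_nonneg: "nonneg_strong_solution b \<omega> \<tau> u \<Longrightarrow> \<tau> \<le> t \<Longrightarrow> nonneg_L2 (u t)"
  by (auto simp: nonneg_strong_solution_def H_pos_def)

lemma solution_continuous: "nonneg_strong_solution b \<omega> \<tau> u \<Longrightarrow> continuous_on {\<tau>..} u"
  by (simp add: nonneg_strong_solution_def strong_solution_def)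

text \<open>The notion of solution provides one null set for each pair \<open>T1\<close>,
  \<open>T2\<close>; countably many such intervals exhaust all times after
  \<open>\<tau>\<close>.\<close>

lemma solution_dom_A:
  assumes "nonneg_strong_solution b \<omega> \<tau> u"
  shows "AE t in lborel. t > \<tau> \<longrightarrow> u t \<in> dom_A"
proof -
  have "AE t in lborel. \<forall>n. t \<in> {\<tau> + 1 / real (Suc n)<..<\<tau> + real n + 2} \<longrightarrow> u t \<in> dom_A"
    unfolding AE_all_countable
  proof
    fix n
    have "\<tau> < \<tau> + 1 / real (Suc n)" by simp
    moreover have "\<tau> + 1 / real (Suc n) < \<tau> + real n + 2"
    proof -
      have "1 / real (Suc n) \<le> 1" by simp
      then show ?thesis by linarith
    qed
    ultimately show "AE t in lborel. t \<in> {\<tau> + 1 / real (Suc n)<..<\<tau> + real n + 2} \<longrightarrow> u t \<in> dom_A"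
      using assms unfolding nonneg_strong_solution_def strong_solution_def by blast
  qed
  then show ?thesis
  proof eventually_elim
    case (elim t)
    show ?case
    proof
      assume t: "t > \<tau>"
      obtain n :: nat where n: "max (1 / (t - \<tau>)) (t - \<tau>) < real n"
        using reals_Archimedean2 by blast
      have "1 / (t - \<tau>) < real (Suc n)" using n by simp
      then have "1 / real (Suc n) < t - \<tau>"
        using t by (simp add: field_simps)
      then have "t \<in> {\<tau> + 1 / real (Suc n)<..<\<tau> + real n + 2}"
        using n by auto
      then show "u t \<in> dom_A" using elim by blast
    qed
  qed
qed

text \<open>By Fubini, almost every time slice of the jointly measurable inclusion holds almost
  everywhere in space; at such a time \<open>reaction_AE\<close> fixes the reaction term.\<close>

lemma solution_AE:
  assumes sol: "nonneg_strong_solution b \<omega> \<tau> u"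
  shows "AE t in lborel. t > \<tau> \<longrightarrow> (\<exists>d \<rho> vf rf. (u has_vector_derivative d) (at t) \<and> u t \<in> dom_A \<and>
    d + op_A (u t) = \<rho> + \<omega> t *\<^sub>R u t \<and> represents vf (u t) \<and> represents rf \<rho> \<and>
    (AE x in unit_measure. 0 \<le> vf x \<and> rf x = (if vf x > 0 then b t else 0)))"
proof -
  obtain r where sel: "selection_of_H_0 b \<tau> u r"
    and eq: "AE t in lborel. t > \<tau> \<longrightarrow> (\<exists>u'. (u has_vector_derivative u') (at t) \<and>
      u' + op_A (u t) = r t + \<omega> t *\<^sub>R u t)"
    using sol unfolding nonneg_strong_solution_def strong_solution_def by blast
  obtain uf rf where uf: "joint_representative \<tau> uf u" and rf: "joint_representative \<tau> rf r"
    and H: "AE (t, x) in lborel. t > \<tau> \<and> 0 < x \<and> x < 1 \<longrightarrow> rf (t, x) \<in> (\<lambda>z. b t * z) ` H_0 (uf (t, x))"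
    using sel unfolding selection_of_H_0_def by blast
  have "AE p in lborel \<Otimes>\<^sub>M lborel. case p of (t, x) \<Rightarrow> t > \<tau> \<and> 0 < x \<and> x < 1 \<longrightarrow> rf (t, x) \<in> (\<lambda>z. b t * z) ` H_0 (uf (t, x))"
    using H unfolding lborel_prod .
  from lborel_pair.AE_pair[OF this]
  have H': "AE t in lborel. AE x in lborel. t > \<tau> \<and> 0 < x \<and> x < 1 \<longrightarrow> rf (t, x) \<in> (\<lambda>z. b t * z) ` H_0 (uf (t, x))"
    by simp
  have ur: "AE t in lborel. t > \<tau> \<longrightarrow> represents (\<lambda>x. uf (t, x)) (u t)"
    "AE t in lborel. t > \<tau> \<longrightarrow> represents (\<lambda>x. rf (t, x)) (r t)"
    using uf rf by (auto simp: joint_representative_def)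
  show ?thesis
    using solution_dom_A[OF sol] eq H' ur
  proof eventually_elim
    case (elim t)
    show ?case
    proof
      assume t: "t > \<tau>"
      obtain d where d: "(u has_vector_derivative d) (at t)" "d + op_A (u t) = r t + \<omega> t *\<^sub>R u t"
        using elim t by blast
      have sel: "AE x in unit_measure. rf (t, x) \<in> (\<lambda>z. b t * z) ` H_0 (uf (t, x))"
        using elim(3) t by (auto simp: AE_restrict_space_iff elim!: eventually_mono)
      have ev: "eventually (\<lambda>s. nonneg_L2 (u s)) (at t)"
        using eventually_at_in_open[of "{\<tau><..}" t] t
        by (auto elim!: eventually_mono intro: solution_nonneg[OF sol])
      have "AE x in unit_measure. 0 \<le> uf (t, x) \<and> rf (t, x) = (if uf (t, x) > 0 then b t else 0)"
        using elim t by (intro reaction_AE[OF d(1) ev solution_nonneg[OF sol] _ d(2) _ _ sel]) auto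
      moreover have "represents (\<lambda>x. uf (t, x)) (u t)" "represents (\<lambda>x. rf (t, x)) (r t)" "u t \<in> dom_A"
        using elim t by auto
      ultimately show "\<exists>d \<rho> vf rf. (u has_vector_derivative d) (at t) \<and> u t \<in> dom_A \<and>
        d + op_A (u t) = \<rho> + \<omega> t *\<^sub>R u t \<and> represents vf (u t) \<and> represents rf \<rho> \<and>
        (AE x in unit_measure. 0 \<le> vf x \<and> rf x = (if vf x > 0 then b t else 0))"
        by (intro exI[of _ d] exI[of _ "r t"] exI[of _ "\<lambda>x. uf (t, x)"] exI[of _ "\<lambda>x. rf (t, x)"] conjI d)
    qed
  qed
qed

lemma solution_abs_continuous:
  "nonneg_strong_solution b \<omega> \<tau> u \<Longrightarrow> \<tau> < T1 \<Longrightarrow> T1 < T2 \<Longrightarrow> abs_continuous_on T1 T2 u"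
  by (auto simp: nonneg_strong_solution_def strong_solution_def)

lemma solution_comparison:
  assumes sol: "nonneg_strong_solution b \<omega> \<tau> u" and T: "\<tau> < T1" "T1 < T2"
  shows "nonneg_L2 (u T2 - exp (\<Omega> T2 - \<Omega> T1) *\<^sub>R heat (T2 - T1) (u T1))"
proof (rule heat_comparison[OF T(2) _ solution_abs_continuous[OF sol T] \<Omega>_deriv \<omega>_cont])
  show "continuous_on {T1..T2} u"
    by (rule continuous_on_subset[OF solution_continuous[OF sol]]) (use T in auto)
  show "AE t in lborel. T1 < t \<and> t < T2 \<longrightarrow> (\<exists>u'. (u has_vector_derivative u') (at t) \<and>
        u t \<in> dom_A \<and> nonneg_L2 (u' + op_A (u t) - \<omega> t *\<^sub>R u t))"
    using solution_AE[OF sol]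
  proof eventually_elim
    case (elim t)
    show ?case
    proof
      assume "T1 < t \<and> t < T2"
      then have "\<tau> < t" using T by simp
      from elim[rule_format, OF this] obtain d \<rho> rf and vf :: "real \<Rightarrow> real" where d: "(u has_vector_derivative d) (at t)" "u t \<in> dom_A"
        "d + op_A (u t) = \<rho> + \<omega> t *\<^sub>R u t" and rf: "represents rf \<rho>"
        and pos: "AE x in unit_measure. 0 \<le> vf x \<and> rf x = (if vf x > 0 then b t else 0)"
        by blast
      have "AE x in unit_measure. 0 \<le> rf x"
        using pos by eventually_elim (use b_bounds(1)[of t] in auto)
      then have "nonneg_L2 \<rho>"
        using rf nonneg_L2_of by (auto simp: represents_def)
      then show "\<exists>u'. (u has_vector_derivative u') (at t) \<and>
        u t \<in> dom_A \<and> nonneg_L2 (u' + op_A (u t) - \<omega> t *\<^sub>R u t)"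
        using d by (intro exI[of _ d]) simp
    qed
  qed
qed

text \<open>
  A non-zero minorant \<open>g\<close> of \<open>u (\<sigma> n)\<close> for a sequence \<open>\<sigma> n\<close> decreasing to \<open>t0\<close>: on the zero set of
  \<open>u t\<close> all the functions \<open>heat (t - \<sigma> n) g\<close> vanish, and analyticity in time applies.
\<close>

lemma solution_positive:
  assumes sol: "nonneg_strong_solution b \<omega> \<tau> u" and t: "\<tau> < t0" "t0 < t" and nz: "u t0 \<noteq> 0"
    and vf: "represents vf (u t)"
  shows "AE x in unit_measure. 0 < vf x"
proof -
  define v where "v = u t0"
  have v: "nonneg_L2 v" "norm v > 0"
    using solution_nonneg[OF sol] t nz by (auto simp: v_def)
  have vfs: "square_int vf" "L2_of vf = u t" using vf by (auto simp: represents_def)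
  \<comment> \<open>The indicator of the zero set of \<open>vf\<close>; the aim is that it vanishes
    almost everywhere.\<close>
  define ff where "ff x = (if vf x = 0 then 1 else 0 :: real)" for x
  have "ff \<in> borel_measurable unit_measure"
    unfolding ff_def using square_int_measurable[OF vfs(1)] by measurable
  then have ffs: "square_int ff"
    by (rule square_int_bounded[of _ 1]) (simp add: ff_def)
  define f where "f = L2_of ff"
  have fnn: "nonneg_L2 f"
    by (simp add: f_def nonneg_L2_of ffs) (simp add: ff_def)
  have vff: "vf x * ff x = 0" for x by (simp add: ff_def)
  have uf: "inner (u t) f = 0"
    unfolding f_def vfs(2)[symmetric] inner_L2_of[OF vfs(1) ffs] vff by simp
  \<comment> \<open>The flow from time \<open>\<sigma>\<close> is squeezed between 0 and a multiple
    of \<open>u t\<close>, and \<open>u t\<close> vanishes where \<open>f\<close> does not.\<close>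
  have zero: "inner (heat (t - \<sigma>) (u \<sigma>)) f = 0" if \<sigma>: "t0 < \<sigma>" "\<sigma> < t" for \<sigma>
  proof -
    have "0 \<le> inner (u t - exp (\<Omega> t - \<Omega> \<sigma>) *\<^sub>R heat (t - \<sigma>) (u \<sigma>)) f"
      by (intro inner_nonneg_L2 fnn solution_comparison[OF sol]) (use t \<sigma> in auto)
    then have "exp (\<Omega> t - \<Omega> \<sigma>) * inner (heat (t - \<sigma>) (u \<sigma>)) f \<le> 0"
      by (simp add: inner_diff_left uf)
    then have "inner (heat (t - \<sigma>) (u \<sigma>)) f \<le> 0"
      by (simp add: mult_le_0_iff not_le[symmetric])
    moreover have "0 \<le> inner (heat (t - \<sigma>) (u \<sigma>)) f"
      using t \<sigma> by (intro inner_nonneg_L2 fnn nonneg_heat solution_nonneg[OF sol]) auto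
    ultimately show ?thesis by simp
  qed
  \<comment> \<open>The permitted deviations from \<open>v\<close> add up to
    \<open>norm v / 2\<close>, so that all of them together cannot cancel \<open>v\<close>.\<close>
  have "\<exists>\<sigma>. t0 < \<sigma> \<and> \<sigma> < t \<and> \<sigma> < t0 + inverse (real (Suc n)) \<and> norm (u \<sigma> - v) < norm v * (1 / 2) ^ (n + 2)" for n
  proof -
    have "norm v * (1 / 2) ^ (n + 2) > 0" using v by simp
    then obtain d where d: "d > 0" "\<And>s. s \<in> {\<tau>..} \<Longrightarrow> dist s t0 < d \<Longrightarrow> dist (u s) (u t0) < norm v * (1 / 2) ^ (n + 2)"
      using solution_continuous[OF sol] t unfolding continuous_on_iff by (metis atLeast_iff less_imp_le)
    define e where "e = min (min (t - t0) (inverse (real (Suc n)))) d"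
    have e: "e > 0" "e \<le> t - t0" "e \<le> inverse (real (Suc n))" "e \<le> d"
      using d(1) t by (auto simp: e_def)
    show ?thesis
      using e d(2)[of "t0 + e / 2"] t
      by (intro exI[of _ "t0 + e / 2"]) (auto simp: dist_real_def dist_norm v_def)
  qed
  then obtain \<sigma> where \<sigma>: "\<And>n. t0 < \<sigma> n" "\<And>n. \<sigma> n < t" "\<And>n. \<sigma> n < t0 + inverse (real (Suc n))"
      "\<And>n. norm (u (\<sigma> n) - v) < norm v * (1 / 2) ^ (n + 2)"
    by metis
  have \<sigma>lim: "\<sigma> \<longlonglongrightarrow> t0"
  proof (rule tendsto_sandwich[of "\<lambda>_. t0" _ _ "\<lambda>n. t0 + inverse (real (Suc n))"])
    show "(\<lambda>n. t0 + inverse (real (Suc n))) \<longlonglongrightarrow> t0"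
      using tendsto_add[OF tendsto_const[of t0] LIMSEQ_inverse_real_of_nat] by simp
  qed (use \<sigma>(1,3) in \<open>auto intro!: always_eventually less_imp_le simp del: of_nat_Suc\<close>)
  define a where "a n = L2_abs (u (\<sigma> n) - v)" for n
  have geo: "(\<lambda>n. norm v * (1 / 2) ^ (n + 2)) sums (norm v / 2)"
    using sums_mult[OF geometric_sums[of "1 / 2 :: real"], of "norm v * (1 / 4)"]
    by (simp add: power_add mult_ac)
  have an: "norm (a n) \<le> norm v * (1 / 2) ^ (n + 2)" for n
    using \<sigma>(4)[of n] by (simp add: a_def less_imp_le)
  have asum: "summable (\<lambda>n. norm (a n))"
    by (rule summable_comparison_test'[OF sums_summable[OF geo], of 0]) (use an in simp)
  \<comment> \<open>The sum of all absolute deviations dominates each of them, so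
    \<open>v - h\<close> lies below every \<open>u (\<sigma> n)\<close> at once.\<close>
  define h where "h = (\<Sum>n. a n)"
  have hs: "a sums h"
    unfolding h_def by (rule summable_sums[OF summable_norm_cancel[OF asum]])
  have "norm h \<le> (\<Sum>n. norm (a n))"
    unfolding h_def by (rule summable_norm[OF asum])
  also have "\<dots> \<le> norm v / 2"
    using suminf_le[OF an asum sums_summable[OF geo]] sums_unique[OF geo] by simp
  finally have hn: "norm h \<le> norm v / 2" .
  have abs_nn: "nonneg_L2 (L2_abs x)" for x
  proof -
    have "nonneg_L2 ((1/2) *\<^sub>R ((x + L2_abs x) + (L2_abs x - x)))"
      by (intro nonneg_L2_scaleR nonneg_L2_add nonneg_L2_abs_add nonneg_L2_abs_diff) simp
    then show ?thesis by (simp add: scaleR_2[symmetric])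
  qed
  have ha: "nonneg_L2 (h - a n)" for n
  proof (rule nonneg_L2_tendsto)
    show "(\<lambda>m. (\<Sum>i<m. a i) - a n) \<longlonglongrightarrow> h - a n"
      using hs unfolding sums_def by (intro tendsto_diff tendsto_const)
    show "\<forall>\<^sub>F m in sequentially. nonneg_L2 ((\<Sum>i<m. a i) - a n)"
      using eventually_gt_at_top[of n]
    proof eventually_elim
      case (elim m)
      have "(\<Sum>i<m. a i) - a n = (\<Sum>i\<in>{..<m} - {n}. a i)"
        using elim by (subst sum.remove[of _ n]) auto
      moreover have "nonneg_L2 (\<Sum>i\<in>{..<m} - {n}. a i)"
        by (intro nonneg_L2_sum) (simp add: a_def abs_nn)
      ultimately show ?case by simp
    qed
  qed simp
  \<comment> \<open>Twice the positive part of \<open>v - h\<close>. A function independent of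
    \<open>n\<close> is required, as one analytic function has to have infinitely many
    zeros.\<close>
  define G where "G = (v - h) + L2_abs (v - h)"
  have Gnn: "nonneg_L2 G" unfolding G_def by (rule nonneg_L2_abs_add)
  have Gle: "nonneg_L2 (2 *\<^sub>R u (\<sigma> n) - G)" for n
    unfolding G_def
  proof (rule nonneg_L2_pos_part_le)
    show "nonneg_L2 (u (\<sigma> n))"
      using \<sigma>(1)[of n] t by (intro solution_nonneg[OF sol]) auto
    have "nonneg_L2 (((u (\<sigma> n) - v) + a n) + (h - a n))"
      unfolding a_def[of n] by (intro nonneg_L2_add nonneg_L2_abs_add) (use ha[of n] in \<open>simp add: a_def\<close>)
    then show "nonneg_L2 (u (\<sigma> n) - (v - h))" by (simp add: algebra_simps)
  qed
  have Gz: "inner (heat (t - \<sigma> n) G) f = 0" for n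
  proof -
    have tn: "0 \<le> t - \<sigma> n" using \<sigma>(2)[of n] by simp
    have "0 \<le> inner (2 *\<^sub>R u (\<sigma> n) - G) (heat (t - \<sigma> n) f)"
      by (intro inner_nonneg_L2 Gle nonneg_heat tn fnn)
    then have "inner (heat (t - \<sigma> n) G) f \<le> 2 * inner (heat (t - \<sigma> n) (u (\<sigma> n))) f"
      by (simp add: inner_diff_left inner_heat_commute[OF tn])
    then have "inner (heat (t - \<sigma> n) G) f \<le> 0"
      using zero[OF \<sigma>(1,2)] by simp
    moreover have "0 \<le> inner (heat (t - \<sigma> n) G) f"
      by (intro inner_nonneg_L2 nonneg_heat tn Gnn fnn)
    ultimately show ?thesis by simp
  qed
  have "coef G 0 * coef f 0 = 0"
  proof (rule heat_inner_zeros[where s = "\<lambda>n. t - \<sigma> n" and ?s0.0 = "t - t0", OF Gz])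
    show "t - \<sigma> n > 0" "t - \<sigma> n \<noteq> t - t0" for n
      using \<sigma>(1,2)[of n] by auto
    show "(\<lambda>n. t - \<sigma> n) \<longlonglongrightarrow> t - t0"
      by (intro tendsto_intros \<sigma>lim)
  qed (use t in simp)
  \<comment> \<open>If the positive part of \<open>v - h\<close> were 0, then \<open>v\<close> would
    lie below \<open>h\<close>, whose norm is at most half of that of \<open>v\<close>.\<close>
  moreover have "coef G 0 \<noteq> 0"
  proof
    assume "coef G 0 = 0"
    then have "G = 0" by (rule nonneg_coef_0[OF Gnn])
    then have "h - v = L2_abs (v - h)" by (simp add: G_def algebra_simps eq_neg_iff_add_eq_0)
    then have "nonneg_L2 (h - v)" by (simp add: abs_nn)
    then have "norm v \<le> norm h" by (rule norm_mono_L2[OF v(1)])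
    then show False using hn v(2) by simp
  qed
  ultimately have "f = 0" using nonneg_coef_0[OF fnn] by simp
  then have "AE x in unit_measure. ff x = 0"
    using L2_of_eq_zero_iff[OF ffs] by (simp add: f_def)
  moreover have "AE x in unit_measure. 0 \<le> vf x"
    using solution_nonneg[OF sol, of t] t nonneg_L2_of[OF vfs(1)] by (simp add: vfs)
  ultimately show ?thesis
    by eventually_elim (auto simp: ff_def split: if_splits)
qed

text \<open>By strict positivity the reaction term is \<open>b r *\<^sub>R one\<close> at almost
  every later time, so \<open>u\<close> and \<open>W t0\<close> have the same residual. Comparison
  applied to their difference and to its negative gives two opposite inequalities.\<close>

lemma solution_linear:
  assumes sol: "nonneg_strong_solution b \<omega> \<tau> u" and t: "\<tau> < t0" "t0 < T" and nz: "u t0 \<noteq> 0"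
  shows "u T = W t0 T + exp (\<Omega> T - \<Omega> t0) *\<^sub>R heat (T - t0) (u t0)"
proof -
  have cu: "continuous_on {t0..T} u"
    by (rule continuous_on_subset[OF solution_continuous[OF sol]]) (use t in auto)
  have cW: "continuous_on {t0..T} (W t0)"
    by (rule lipschitz_continuous_on[OF _ rate_nonneg]) (auto intro: W_lipschitz)
  have au: "abs_continuous_on t0 T u" by (rule solution_abs_continuous[OF sol t])
  have aW: "abs_continuous_on t0 T (W t0)" by (rule W_abs_continuous) simp
  have eq: "AE r in lborel. t0 < r \<and> r < T \<longrightarrow> (\<exists>d e. (u has_vector_derivative d) (at r) \<and>
      (W t0 has_vector_derivative e) (at r) \<and> u r \<in> dom_A \<and> W t0 r \<in> dom_A \<and>
      d + op_A (u r) - \<omega> r *\<^sub>R u r = e + op_A (W t0 r) - \<omega> r *\<^sub>R W t0 r)"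
    using solution_AE[OF sol]
  proof eventually_elim
    case (elim r)
    show ?case
    proof
      assume r: "t0 < r \<and> r < T"
      then have "\<tau> < r" using t by simp
      from elim[rule_format, OF this] obtain d \<rho> vf rf where d: "(u has_vector_derivative d) (at r)" "u r \<in> dom_A"
        "d + op_A (u r) = \<rho> + \<omega> r *\<^sub>R u r" and vf: "represents vf (u r)" and rf: "represents rf \<rho>"
        and pos: "AE x in unit_measure. 0 \<le> vf x \<and> rf x = (if vf x > 0 then b r else 0)"
        by blast
      have "AE x in unit_measure. rf x = b r * 1"
        using pos solution_positive[OF sol t(1) _ nz vf] r by (auto elim: eventually_elim2)
      then have "L2_of rf = L2_of (\<lambda>x. b r * 1)"
        using rf L2_of_eq_iff[OF _ square_int_const, of rf "b r"] by (simp add: represents_def)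
      also have "\<dots> = b r *\<^sub>R one"
        unfolding one_def by (rule L2_of_scale[OF square_int_const])
      finally have "\<rho> = b r *\<^sub>R one" using rf by (simp add: represents_def)
      then show "\<exists>d e. (u has_vector_derivative d) (at r) \<and>
        (W t0 has_vector_derivative e) (at r) \<and> u r \<in> dom_A \<and> W t0 r \<in> dom_A \<and>
        d + op_A (u r) - \<omega> r *\<^sub>R u r = e + op_A (W t0 r) - \<omega> r *\<^sub>R W t0 r"
        using d r by (intro exI[of _ d] exI[of _ "b r *\<^sub>R one + \<omega> r *\<^sub>R W t0 r - op_A (W t0 r)"])
          (auto intro: W_vector_derivative W_dom_A)
    qed
  qed
  have "nonneg_L2 ((u T - W t0 T) - exp (\<Omega> T - \<Omega> t0) *\<^sub>R heat (T - t0) (u t0 - W t0 t0))"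
  proof (rule heat_comparison[OF t(2) continuous_on_diff[OF cu cW] abs_continuous_on_diff[OF au aW] \<Omega>_deriv \<omega>_cont])
    show "AE r in lborel. t0 < r \<and> r < T \<longrightarrow> (\<exists>u'. ((\<lambda>x. u x - W t0 x) has_vector_derivative u') (at r) \<and>
        u r - W t0 r \<in> dom_A \<and> nonneg_L2 (u' + op_A (u r - W t0 r) - \<omega> r *\<^sub>R (u r - W t0 r)))"
      using eq
    proof eventually_elim
      case (elim r)
      show ?case
      proof
        assume "t0 < r \<and> r < T"
        with elim obtain d e where *: "(u has_vector_derivative d) (at r)"
          "(W t0 has_vector_derivative e) (at r)" "u r \<in> dom_A" "W t0 r \<in> dom_A"
          "d + op_A (u r) - \<omega> r *\<^sub>R u r = e + op_A (W t0 r) - \<omega> r *\<^sub>R W t0 r" by blast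
        have z: "d - e + op_A (u r - W t0 r) - \<omega> r *\<^sub>R (u r - W t0 r) = 0"
          using *(5) by (simp add: dom_A_diff[OF *(3,4)] scaleR_diff_right algebra_simps)
        show "\<exists>u'. ((\<lambda>x. u x - W t0 x) has_vector_derivative u') (at r) \<and>
          u r - W t0 r \<in> dom_A \<and> nonneg_L2 (u' + op_A (u r - W t0 r) - \<omega> r *\<^sub>R (u r - W t0 r))"
          by (intro exI[of _ "d - e"]) (simp add: has_vector_derivative_diff * dom_A_diff(1) z)
      qed
    qed
  qed
  moreover have "nonneg_L2 ((W t0 T - u T) - exp (\<Omega> T - \<Omega> t0) *\<^sub>R heat (T - t0) (W t0 t0 - u t0))"
  proof (rule heat_comparison[OF t(2) continuous_on_diff[OF cW cu] abs_continuous_on_diff[OF aW au] \<Omega>_deriv \<omega>_cont])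
    show "AE r in lborel. t0 < r \<and> r < T \<longrightarrow> (\<exists>u'. ((\<lambda>x. W t0 x - u x) has_vector_derivative u') (at r) \<and>
        W t0 r - u r \<in> dom_A \<and> nonneg_L2 (u' + op_A (W t0 r - u r) - \<omega> r *\<^sub>R (W t0 r - u r)))"
      using eq
    proof eventually_elim
      case (elim r)
      show ?case
      proof
        assume "t0 < r \<and> r < T"
        with elim obtain d e where *: "(u has_vector_derivative d) (at r)"
          "(W t0 has_vector_derivative e) (at r)" "u r \<in> dom_A" "W t0 r \<in> dom_A"
          "d + op_A (u r) - \<omega> r *\<^sub>R u r = e + op_A (W t0 r) - \<omega> r *\<^sub>R W t0 r" by blast
        have z: "e - d + op_A (W t0 r - u r) - \<omega> r *\<^sub>R (W t0 r - u r) = 0"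
          using *(5) by (simp add: dom_A_diff[OF *(4,3)] scaleR_diff_right algebra_simps)
        show "\<exists>u'. ((\<lambda>x. W t0 x - u x) has_vector_derivative u') (at r) \<and>
          W t0 r - u r \<in> dom_A \<and> nonneg_L2 (u' + op_A (W t0 r - u r) - \<omega> r *\<^sub>R (W t0 r - u r))"
          by (intro exI[of _ "e - d"]) (simp add: has_vector_derivative_diff * dom_A_diff(1) z)
      qed
    qed
  qed
  moreover have "heat (T - t0) (- v) = - heat (T - t0) v" for v
    using t by (intro coef_eqI) (simp add: coef_heat)
  ultimately have "u T - W t0 T - exp (\<Omega> T - \<Omega> t0) *\<^sub>R heat (T - t0) (u t0) = 0"
    by (intro nonneg_L2_antisym) (simp_all add: algebra_simps)
  then show ?thesis by (simp add: algebra_simps)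
qed

text \<open>The time \<open>s\<close> is the last zero of \<open>u\<close> in \<open>[\<tau>, t]\<close>, or \<open>\<tau>\<close> if there is none.\<close>

lemma solution_representation:
  assumes sol: "nonneg_strong_solution b \<omega> \<tau> u" and t: "\<tau> \<le> t"
  shows "\<exists>s\<in>{\<tau>..t}. u t = W s t + exp (\<Omega> t - \<Omega> s) *\<^sub>R heat (t - s) (u s) \<and> (u s = 0 \<or> s = \<tau>)"
proof -
  define Z where "Z = {r\<in>{\<tau>..t}. u r = 0}"
  have cu: "continuous_on {\<tau>..t} u"
    by (rule continuous_on_subset[OF solution_continuous[OF sol]]) auto
  have heat0: "heat 0 v = v" for v by (rule coef_eqI) (simp add: coef_heat)
  obtain s where s: "s \<in> {\<tau>..t}" "u s = 0 \<or> s = \<tau>" and nz: "\<And>r. s < r \<Longrightarrow> r \<le> t \<Longrightarrow> u r \<noteq> 0"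
  proof (cases "Z = {}")
    case True
    then show thesis using that[of \<tau>] t by (auto simp: Z_def)
  next
    case False
    have "closed Z"
      unfolding Z_def by (rule continuous_closed_preimage_constant[OF cu]) simp
    moreover have "bdd_above Z" by (auto simp: Z_def)
    ultimately have Z: "Sup Z \<in> Z" using False by (intro closed_contains_Sup)
    show thesis
    proof (rule that[of "Sup Z"])
      fix r assume r: "Sup Z < r" "r \<le> t"
      show "u r \<noteq> 0"
      proof
        assume "u r = 0"
        then have "r \<in> Z" using Z r by (auto simp: Z_def)
        then show False using cSup_upper[OF _ \<open>bdd_above Z\<close>, of r] r by simp
      qed
    qed (use Z in \<open>auto simp: Z_def\<close>)
  qed
  have "u t = W s t + exp (\<Omega> t - \<Omega> s) *\<^sub>R heat (t - s) (u s)"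
  proof (cases "s = t")
    case True
    then show ?thesis by (simp add: heat0)
  next
    case False
    then have st: "s < t" using s by auto
    show ?thesis
    proof (rule coef_eqI)
      fix k
      \<comment> \<open>The \<open>k\<close>-th coefficient of the representation restarted at
        \<open>r\<close>. It does not depend on \<open>r\<close> strictly between \<open>s\<close>
        and \<open>t\<close>, and its limit at \<open>s\<close> is taken because
        \<open>solution_linear\<close> cannot be used there: \<open>s\<close> is a zero of
        \<open>u\<close> or the initial time.\<close>
      define F where "F r = wc r t k + exp (\<Omega> t - \<Omega> r) * (exp (- lam k * (t - r)) * coef (u r) k)" for r
      have "F r = coef (u t) k" if r: "s < r" "r < t" for r
        using arg_cong[OF solution_linear[OF sol _ r(2) nz], of "\<lambda>v. coef v k"] s r
        by (simp add: F_def coef_W coef_heat)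
      then have "eventually (\<lambda>r. F r = coef (u t) k) (at_right s)"
        using eventually_at_right_real[OF st] by (auto elim!: eventually_mono)
      then have l1: "(F \<longlongrightarrow> coef (u t) k) (at_right s)"
        by (rule tendsto_eventually)
      have "((\<lambda>r. u r) \<longlongrightarrow> u s) (at_right s)"
      proof -
        have "(u \<longlongrightarrow> u s) (at s within {s..})"
          using solution_continuous[OF sol] s
          by (auto simp: continuous_on_def intro: tendsto_within_subset)
        then show ?thesis by (rule tendsto_within_subset) auto
      qed
      then have uc: "((\<lambda>r. coef (u r) k) \<longlongrightarrow> coef (u s) k) (at_right s)"
        unfolding coef_def by (intro tendsto_inner tendsto_const)
      have \<beta>c: "(\<beta> k \<longlongrightarrow> \<beta> k s) (at_right s)" and \<Omega>c: "(\<Omega> \<longlongrightarrow> \<Omega> s) (at_right s)"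
        using DERIV_isCont[OF \<beta>_deriv[of k s]] DERIV_isCont[OF \<Omega>_deriv[of s]]
        by (auto simp: isCont_def intro: filterlim_mono[OF _ order_refl at_le])
      have l2: "(F \<longlongrightarrow> F s) (at_right s)"
        unfolding F_def wc_def by (intro tendsto_intros uc \<beta>c \<Omega>c)
      have "coef (u t) k = F s"
        using tendsto_unique[OF _ l1 l2] by simp
      then show "coef (u t) k = coef (W s t + exp (\<Omega> t - \<Omega> s) *\<^sub>R heat (t - s) (u s)) k"
        using st by (simp add: F_def coef_W coef_heat)
    qed
  qed
  then show ?thesis using s by blast
qed

end

section \<open>Exponential closeness to linear solutions, and comparison of two linear
  problems\<close>

context coefficients
begin

text \<open>The slowest rate at which the homogeneous linear problem is guaranteed to decay; the
  first eigenvalue determines it.\<close>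

definition decay :: real where
  "decay = pi\<^sup>2 - \<omega>1"

lemma decay_pos: "0 < decay"
  using \<omega>1 by (simp add: decay_def)

lemma remainder_norm:
  assumes "s \<le> t"
  shows "norm (exp (\<Omega> t - \<Omega> s) *\<^sub>R heat (t - s) v) \<le> exp (- decay * (t - s)) * norm v"
proof (rule norm_le_coef)
  fix k
  have "\<Omega> t - \<Omega> s + - lam k * (t - s) \<le> - decay * (t - s)"
  proof -
    have "pi\<^sup>2 * (t - s) \<le> lam k * (t - s)"
      using assms by (intro mult_right_mono lam_ge) auto
    then show ?thesis using \<Omega>_le[OF assms] by (simp add: decay_def algebra_simps)
  qed
  then have "exp (\<Omega> t - \<Omega> s) * exp (- lam k * (t - s)) \<le> exp (- decay * (t - s))"
    unfolding exp_add[symmetric] by simp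
  then have "exp (\<Omega> t - \<Omega> s) * exp (- lam k * (t - s)) * \<bar>coef v k\<bar> \<le> exp (- decay * (t - s)) * \<bar>coef v k\<bar>"
    by (rule mult_right_mono) simp
  then show "\<bar>coef (exp (\<Omega> t - \<Omega> s) *\<^sub>R heat (t - s) v) k\<bar> \<le> exp (- decay * (t - s)) * \<bar>coef v k\<bar>"
    using assms by (simp add: coef_heat abs_mult mult_ac)
qed simp

text \<open>In the representation of the solution the remainder starts from \<open>u s\<close>: this
  is either 0, so that nothing remains, or the initial value, which then decays over the full time
  from \<open>\<tau>\<close> to \<open>t\<close>.\<close>

lemma U_pos_near_W:
  assumes "\<tau> \<le> t" "y \<in> U_pos b \<omega> t \<tau> v"
  shows "\<exists>s\<in>{\<tau>..t}. dist y (W s t) \<le> exp (- decay * (t - \<tau>)) * norm v"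
proof -
  obtain u where u: "nonneg_strong_solution b \<omega> \<tau> u" "u \<tau> = v" "u t = y"
    using assms(2) by (auto simp: U_pos_def)
  obtain s where s: "s \<in> {\<tau>..t}" "u t = W s t + exp (\<Omega> t - \<Omega> s) *\<^sub>R heat (t - s) (u s)" "u s = 0 \<or> s = \<tau>"
    using solution_representation[OF u(1) assms(1)] by blast
  have "dist y (W s t) = norm (exp (\<Omega> t - \<Omega> s) *\<^sub>R heat (t - s) (u s))"
    using s(2) u(3) by (simp add: dist_norm)
  also have "\<dots> \<le> exp (- decay * (t - s)) * norm (u s)"
    using s(1) by (intro remainder_norm) simp
  also have "\<dots> \<le> exp (- decay * (t - \<tau>)) * norm v"
    using s(3) u(2) by auto
  finally show ?thesis using s(1) by blast
qed

text \<open>The difference of the two coefficients solves the homogeneous scalar equation and starts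
  from 0. For constant data every \<open>h\<close> is admissible.\<close>

lemma W_shift:
  assumes per: "\<And>t. b (t + h) = b t" "\<And>t. \<omega> (t + h) = \<omega> t" and st: "s \<le> t"
  shows "W (s + h) (t + h) = W s t"
proof (rule coef_eqI)
  fix k
  define z where "z r = wc (s + h) (r + h) k - wc s r k" for r
  have "((\<lambda>r. wc (s + h) (r + h) k) has_field_derivative
      (\<omega> r - lam k) * wc (s + h) (r + h) k + coef one k * b r) (at r)" for r
    using DERIV_shift[THEN iffD1, OF wc_deriv[of "s + h" k "r + h"]] by (simp add: per)
  from DERIV_diff[OF this wc_deriv]
  have zd: "(z has_field_derivative (\<omega> r - lam k) * z r) (at r)" for r
    unfolding z_def[abs_def] by (rule DERIV_cong) (simp add: algebra_simps)
  have "\<bar>z t\<bar> \<le> 0 / (lam k - \<omega>1) + \<bar>z s\<bar> * exp (- (lam k - \<omega>1) * (t - s))"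
  proof (rule ode_bound[OF st damping_deriv _ lam_gap_pos zd])
    show "lam k - \<omega>1 \<le> lam k - \<omega> r" for r using \<omega>_bounds(2)[of r] by simp
    show "\<bar>(\<omega> r - lam k) * z r + (lam k - \<omega> r) * z r\<bar> \<le> 0" for r
      by (simp add: algebra_simps)
  qed
  moreover have "z s = 0" by (simp add: z_def)
  ultimately show "coef (W (s + h) (t + h)) k = coef (W s t) k"
    using st by (simp add: z_def coef_W)
qed

end

text \<open>The difference obeys the damped scalar equation with forcing
  \<open>(b r - b' r) * coef one k\<close> plus \<open>(\<omega> r - \<omega>' r)\<close> times the
  second solution, and the latter is bounded through \<open>b1\<close> and \<open>\<kappa>\<close>
  uniformly in \<open>s\<close>. The time \<open>p\<close> is where closeness of the data sets
  in.\<close>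

lemma wc_compare:
  assumes 1: "coefficients b \<omega> b1 \<omega>1" and 2: "coefficients b' \<omega>' b1 \<omega>1"
    and pt: "s \<le> p" "p \<le> t"
    and near: "\<And>r. p \<le> r \<Longrightarrow> r \<le> t \<Longrightarrow>
      \<bar>b r - b' r\<bar> + b1 / coefficients.\<kappa> \<omega>1 * \<bar>\<omega> r - \<omega>' r\<bar> \<le> \<eta>"
  shows "\<bar>coefficients.wc b \<omega> s t k - coefficients.wc b' \<omega>' s t k\<bar>
    \<le> \<eta> * \<bar>coef one k\<bar> / coefficients.decay \<omega>1
      + \<bar>coefficients.wc b \<omega> s p k - coefficients.wc b' \<omega>' s p k\<bar> * exp (- coefficients.decay \<omega>1 * (t - p))"
proof -
  interpret E: coefficients b \<omega> b1 \<omega>1 by (rule 1)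
  interpret L: coefficients b' \<omega>' b1 \<omega>1 by (rule 2)
  define z where "z r = E.wc s r k - L.wc s r k" for r
  define z' where "z' r = ((\<omega> r - lam k) * E.wc s r k + coef one k * b r)
    - ((\<omega>' r - lam k) * L.wc s r k + coef one k * b' r)" for r
  have zd: "(z has_field_derivative z' r) (at r)" for r
    unfolding z_def[abs_def] z'_def by (intro DERIV_diff E.wc_deriv L.wc_deriv)
  have "\<bar>z t\<bar> \<le> (\<eta> * \<bar>coef one k\<bar>) / E.decay + \<bar>z p\<bar> * exp (- E.decay * (t - p))"
  proof (rule ode_bound[OF pt(2) E.damping_deriv _ E.decay_pos zd])
    show "E.decay \<le> lam k - \<omega> r" for r
      using E.\<omega>_bounds(2)[of r] lam_ge[of k] by (simp add: E.decay_def)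
    fix r assume r: "p \<le> r" "r \<le> t"
    have "z' r + (lam k - \<omega> r) * z r = (b r - b' r) * coef one k + (\<omega> r - \<omega>' r) * L.wc s r k"
      by (simp add: z'_def z_def algebra_simps)
    also have "\<bar>\<dots>\<bar> \<le> \<bar>b r - b' r\<bar> * \<bar>coef one k\<bar> + \<bar>\<omega> r - \<omega>' r\<bar> * \<bar>L.wc s r k\<bar>"
      unfolding abs_mult[symmetric] by (rule abs_triangle_ineq)
    also have "\<dots> \<le> \<bar>b r - b' r\<bar> * \<bar>coef one k\<bar> + \<bar>\<omega> r - \<omega>' r\<bar> * (b1 / E.\<kappa> * \<bar>coef one k\<bar>)"
      using pt r by (intro add_left_mono mult_left_mono L.wc_le) auto
    also have "\<dots> = (\<bar>b r - b' r\<bar> + b1 / E.\<kappa> * \<bar>\<omega> r - \<omega>' r\<bar>) * \<bar>coef one k\<bar>"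
      by (simp add: algebra_simps)
    also have "\<dots> \<le> \<eta> * \<bar>coef one k\<bar>"
      by (intro mult_right_mono near r) simp
    finally show "\<bar>z' r + (lam k - \<omega> r) * z r\<bar> \<le> \<eta> * \<bar>coef one k\<bar>" .
  qed
  then show ?thesis by (simp only: z_def)
qed

text \<open>After \<open>T0\<close> the data are so close that the forcing contributes at most half
  of \<epsilon>. For \<open>s \<ge> T0\<close> there is no other contribution; for earlier
  \<open>s\<close> the gap accumulated up to \<open>T0\<close> is at most \<open>2 * D\<close> times
  the coefficient of \<open>one\<close>, however long ago \<open>s\<close> was, and a further time
  \<open>R / decay\<close> damps it below the other half.\<close>

lemma W_compare:
  assumes 1: "coefficients b \<omega> b1 \<omega>1" and 2: "coefficients b' \<omega>' b1 \<omega>1"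
    and b: "((\<lambda>t. b t - b' t) \<longlongrightarrow> 0) at_top" and \<omega>: "((\<lambda>t. \<omega> t - \<omega>' t) \<longlongrightarrow> 0) at_top" and \<epsilon>: "\<epsilon> > 0"
  shows "\<exists>T. \<forall>t\<ge>T. \<forall>s\<le>t. dist (coefficients.W b \<omega> s t) (coefficients.W b' \<omega>' s t) \<le> \<epsilon>"
proof -
  interpret E: coefficients b \<omega> b1 \<omega>1 by (rule 1)
  interpret L: coefficients b' \<omega>' b1 \<omega>1 by (rule 2)
  define D where "D = b1 / E.\<kappa>"
  define \<eta> where "\<eta> = E.decay * (\<epsilon> / 2)"
  have \<eta>: "\<eta> > 0" using \<epsilon> E.decay_pos by (simp add: \<eta>_def)
  have D: "D > 0" using E.b1_pos E.\<kappa>_pos by (simp add: D_def)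
  have "((\<lambda>r. \<bar>b r - b' r\<bar> + D * \<bar>\<omega> r - \<omega>' r\<bar>) \<longlongrightarrow> \<bar>0\<bar> + D * \<bar>0\<bar>) at_top"
    by (intro tendsto_intros b \<omega>)
  then have "\<forall>\<^sub>F r in at_top. \<bar>b r - b' r\<bar> + D * \<bar>\<omega> r - \<omega>' r\<bar> < \<eta>"
    using \<eta> by (intro order_tendstoD(2)) auto
  then obtain T0 where T0: "\<And>r. r \<ge> T0 \<Longrightarrow> \<bar>b r - b' r\<bar> + D * \<bar>\<omega> r - \<omega>' r\<bar> < \<eta>"
    unfolding eventually_at_top_linorder by blast
  have "((\<lambda>r. exp (- r)) \<longlongrightarrow> (0::real)) at_top"
    by (intro filterlim_compose[OF exp_at_bot] filterlim_uminus_at_bot_at_top)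
  then have "\<forall>\<^sub>F r in at_top. exp (- r) < \<epsilon> / 2 / (2 * D)"
    using \<epsilon> D by (intro order_tendstoD(2)) auto
  then obtain R where R: "\<And>r. r \<ge> R \<Longrightarrow> exp (- r) < \<epsilon> / 2 / (2 * D)"
    unfolding eventually_at_top_linorder by blast
  show ?thesis
  proof (intro exI[of _ "max T0 (T0 + R / E.decay)"] allI impI)
    fix t s :: real assume t: "max T0 (T0 + R / E.decay) \<le> t" and st: "s \<le> t"
    have "norm (E.W s t - L.W s t) \<le> \<epsilon> * norm one"
    proof (rule norm_le_coef)
      fix k
      define p where "p = max s T0"
      have p: "s \<le> p" "p \<le> t" using t st by (auto simp: p_def)
      have c: "\<bar>E.wc s t k - L.wc s t k\<bar> \<le> \<eta> * \<bar>coef one k\<bar> / E.decay + \<bar>E.wc s p k - L.wc s p k\<bar> * exp (- E.decay * (t - p))"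
      proof (rule wc_compare[OF 1 2 p])
        fix r assume "p \<le> r"
        then have "T0 \<le> r" by (simp add: p_def)
        from T0[OF this] show "\<bar>b r - b' r\<bar> + b1 / E.\<kappa> * \<bar>\<omega> r - \<omega>' r\<bar> \<le> \<eta>" by (simp add: D_def)
      qed
      have half: "\<eta> * \<bar>coef one k\<bar> / E.decay = \<epsilon> / 2 * \<bar>coef one k\<bar>"
        using E.decay_pos by (simp add: \<eta>_def)
      have "\<bar>E.wc s p k - L.wc s p k\<bar> * exp (- E.decay * (t - p)) \<le> \<epsilon> / 2 * \<bar>coef one k\<bar>"
      proof (cases "T0 \<le> s")
        case True
        then have "p = s" by (simp add: p_def)
        then show ?thesis using \<epsilon> by simp
      next
        case False
        then have pT: "p = T0" by (simp add: p_def)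
        have "\<bar>E.wc s p k - L.wc s p k\<bar> \<le> \<bar>E.wc s p k\<bar> + \<bar>L.wc s p k\<bar>"
          by (rule abs_triangle_ineq4)
        also have "\<dots> \<le> D * \<bar>coef one k\<bar> + D * \<bar>coef one k\<bar>"
          unfolding D_def by (intro add_mono E.wc_le L.wc_le p)
        finally have 1: "\<bar>E.wc s p k - L.wc s p k\<bar> \<le> 2 * D * \<bar>coef one k\<bar>" by simp
        have "R \<le> E.decay * (t - p)"
          using t E.decay_pos by (simp add: pT field_simps)
        then have 2: "exp (- E.decay * (t - p)) \<le> \<epsilon> / 2 / (2 * D)"
          using R[of "E.decay * (t - p)"] by simp
        have "\<bar>E.wc s p k - L.wc s p k\<bar> * exp (- E.decay * (t - p)) \<le> (2 * D * \<bar>coef one k\<bar>) * (\<epsilon> / 2 / (2 * D))"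
          using D by (intro mult_mono 1 2) auto
        also have "\<dots> = \<epsilon> / 2 * \<bar>coef one k\<bar>" using D by simp
        finally show ?thesis .
      qed
      then have "\<bar>E.wc s t k - L.wc s t k\<bar> \<le> \<epsilon> * \<bar>coef one k\<bar>"
        using c half by simp
      then show "\<bar>coef (E.W s t - L.W s t) k\<bar> \<le> \<epsilon> * \<bar>coef one k\<bar>"
        by (simp add: E.coef_W[OF st] L.coef_W[OF st])
    qed (use \<epsilon> in simp)
    then show "dist (E.W s t) (L.W s t) \<le> \<epsilon>"
      by (simp add: dist_norm)
  qed
qed

section \<open>Attractors\<close>

lemma semidist_le:
  assumes "\<And>y. y \<in> A \<Longrightarrow> \<exists>x\<in>B. dist y x \<le> e"
  shows "semidist A B \<le> ennreal e"
  unfolding semidist_def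
proof (rule SUP_least)
  fix y assume "y \<in> A"
  then obtain x where "x \<in> B" "dist y x \<le> e" using assms by blast
  then show "(INF x\<in>B. ennreal (dist y x)) \<le> ennreal e"
    by (intro INF_lower2[of x]) (auto intro: ennreal_leI)
qed

lemma semidist_less:
  assumes "semidist A B < ennreal e" "y \<in> A"
  shows "\<exists>x\<in>B. dist y x < e"
proof -
  have "(INF x\<in>B. ennreal (dist y x)) < ennreal e"
    using assms(1) SUP_upper[OF assms(2), of "\<lambda>y. INF x\<in>B. ennreal (dist y x)"]
    unfolding semidist_def by (rule le_less_trans[rotated])
  then obtain x where "x \<in> B" "ennreal (dist y x) < ennreal e"
    by (auto simp: INF_less_iff)
  then show ?thesis by (auto simp: ennreal_less_iff)
qed

lemma ennreal_tendsto_0I: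
  fixes f :: "'a \<Rightarrow> ennreal"
  assumes "\<And>e. e > 0 \<Longrightarrow> eventually (\<lambda>x. f x \<le> ennreal e) F"
  shows "(f \<longlongrightarrow> 0) F"
proof (rule order_tendstoI)
  fix a :: ennreal assume "0 < a"
  then obtain c where c: "0 < c" "c < a" using dense by blast
  then obtain e where e: "c = ennreal e" "0 \<le> e" by (cases c) auto
  then have "e > 0" using c by (auto simp: less_le)
  from assms[OF this] show "eventually (\<lambda>x. f x < a) F"
    by eventually_elim (use c e in \<open>auto intro: le_less_trans\<close>)
qed simp

text \<open>Attraction applied to the fixed point \<open>y\<close> brings it arbitrarily close to
  \<open>K\<close>. It serves for \<open>y = W s t\<close>, which is reached from 0 from all
  sufficiently early starting times, and in the autonomous case at all sufficiently late
  times.\<close>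

lemma mem_of_semidist_tendsto:
  assumes "((\<lambda>t. semidist (S t) K) \<longlongrightarrow> 0) F" "F \<noteq> bot" "eventually (\<lambda>t. y \<in> S t) F" "closed K"
  shows "y \<in> K"
proof -
  have "\<exists>x\<in>K. dist x y < e" if e: "e > 0" for e
  proof -
    have "eventually (\<lambda>t. semidist (S t) K < ennreal e) F"
      using assms(1) e by (intro order_tendstoD(2)) auto
    from eventually_happens'[OF assms(2) eventually_conj[OF this assms(3)]]
    obtain t where "semidist (S t) K < ennreal e" "y \<in> S t" by blast
    then show ?thesis using semidist_less by (metis dist_commute)
  qed
  then have "y \<in> closure K" by (auto simp: closure_approachable)
  then show ?thesis using assms(4) by (simp add: closure_closed)
qed

lemma closed_H_pos: "closed H_pos"
  unfolding closed_sequential_limits H_pos_def by (auto intro: nonneg_L2_tendsto)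

lemma zero_H_pos: "0 \<in> H_pos"
  by (simp add: H_pos_def)

context coefficients
begin

lemma exp_decay_le:
  assumes "e > 0" "0 \<le> R"
  obtains N where "N \<ge> 0" "\<And>h. h \<ge> N \<Longrightarrow> exp (- decay * h) * R \<le> e"
proof -
  have "((\<lambda>h. exp (- (decay * h)) * R) \<longlongrightarrow> 0 * R) at_top"
    by (intro tendsto_mult tendsto_const filterlim_compose[OF exp_at_bot]
        filterlim_compose[OF filterlim_uminus_at_bot_at_top]
        filterlim_tendsto_pos_mult_at_top[OF tendsto_const decay_pos] filterlim_ident)
  then have "\<forall>\<^sub>F h in at_top. exp (- (decay * h)) * R < e"
    using assms by (intro order_tendstoD(2)) auto
  then obtain N where "\<And>h. h \<ge> N \<Longrightarrow> exp (- (decay * h)) * R < e"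
    unfolding eventually_at_top_linorder by blast
  then show thesis
    by (intro that[of "max N 0"]) (auto intro: less_imp_le)
qed

text \<open>The first inclusion comes from attraction of the single point 0. For the second, the
  closures \<open>C t\<close> form a closed family that attracts bounded sets by
  \<open>U_pos_near_W\<close>, so minimality places the attractor inside it.\<close>

lemma pullback_attractor_W:
  assumes K: "pullback_attractor H_pos (U_pos b \<omega>) K"
  shows "s \<le> t \<Longrightarrow> W s t \<in> K t" and "K t \<subseteq> closure ((\<lambda>s. W s t) ` {..t})"
proof -
  show "W s t \<in> K t" if "s \<le> t"
  proof (rule mem_of_semidist_tendsto)
    show "((\<lambda>t0. semidist (\<Union>v\<in>{0}. U_pos b \<omega> t t0 v) (K t)) \<longlongrightarrow> 0) at_bot"
      using K zero_H_pos unfolding pullback_attractor_def pullback_attracting_def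
      by (meson bounded_insert bounded_empty empty_subsetI insert_subset)
    show "closed (K t)" using K by (auto simp: pullback_attractor_def compact_imp_closed)
    show "\<forall>\<^sub>F t0 in at_bot. W s t \<in> (\<Union>v\<in>{0}. U_pos b \<omega> t t0 v)"
      using eventually_le_at_bot[of s] by eventually_elim (use W_in_U_pos that in auto)
  qed simp
  define C where "C t = closure ((\<lambda>s. W s t) ` {..t})" for t
  have "C t \<subseteq> H_pos" for t
    unfolding C_def by (rule closure_minimal[OF _ closed_H_pos]) (auto simp: H_pos_def W_nonneg)
  then have "closedin (top_of_set H_pos) (C t)" for t
    by (intro closed_subset) (auto simp: C_def)
  moreover have "pullback_attracting H_pos (U_pos b \<omega>) C"
    unfolding pullback_attracting_def
  proof (intro allI impI ennreal_tendsto_0I)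
    fix B t and e :: real assume B: "B \<subseteq> H_pos \<and> bounded B" and e: "e > 0"
    obtain R where R: "R > 0" "\<And>v. v \<in> B \<Longrightarrow> norm v \<le> R"
      using B unfolding bounded_pos by blast
    obtain N where N: "N \<ge> 0" "\<And>h. h \<ge> N \<Longrightarrow> exp (- decay * h) * R \<le> e"
      using exp_decay_le[OF e, of R] R by auto
    show "\<forall>\<^sub>F t0 in at_bot. semidist (\<Union>v\<in>B. U_pos b \<omega> t t0 v) (C t) \<le> ennreal e"
      using eventually_le_at_bot[of "t - N"]
    proof eventually_elim
      case (elim t0)
      show ?case
      proof (rule semidist_le)
        fix y assume "y \<in> (\<Union>v\<in>B. U_pos b \<omega> t t0 v)"
        then obtain v where v: "v \<in> B" "y \<in> U_pos b \<omega> t t0 v" by blast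
        obtain s where s: "s \<in> {t0..t}" "dist y (W s t) \<le> exp (- decay * (t - t0)) * norm v"
          using U_pos_near_W[OF _ v(2)] elim N(1) by auto
        have "exp (- decay * (t - t0)) * norm v \<le> exp (- decay * (t - t0)) * R"
          using R(2)[OF v(1)] by (intro mult_left_mono) auto
        also have "\<dots> \<le> e" using elim by (intro N(2)) simp
        finally have "dist y (W s t) \<le> e" using s(2) by simp
        moreover have "W s t \<in> C t"
          unfolding C_def using s(1) by (intro subsetD[OF closure_subset] imageI) simp
        ultimately show "\<exists>x\<in>C t. dist y x \<le> e" by blast
      qed
    qed
  qed
  moreover have "(\<forall>t. closedin (top_of_set H_pos) (C t)) \<and> pullback_attracting H_pos (U_pos b \<omega>) C
      \<longrightarrow> (\<forall>t. K t \<subseteq> C t)"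
    using K unfolding pullback_attractor_def by (elim conjE) (erule spec)
  ultimately have "K t \<subseteq> C t" by simp
  then show "K t \<subseteq> closure ((\<lambda>s. W s t) ` {..t})" by (simp add: C_def)
qed

end

lemma G_pos_eq_U_pos: "G_pos c d t v = U_pos (\<lambda>_. c) (\<lambda>_. d) t 0 v"
  by (simp add: G_pos_def U_pos_def)

text \<open>For the first claim, time shifts make \<open>W s t\<close> a value of solutions from 0
  at every late time. For the second, negative invariance writes \<open>y\<close> as the value after
  a long time \<open>N\<close> of a solution starting in the bounded set \<open>K\<close>; it is
  then close to some \<open>W s N\<close>, and a shift moves the final time to the prescribed
  \<open>t\<close>.\<close>

lemma global_attractor_W:
  assumes cf: "coefficients (\<lambda>_. c) (\<lambda>_. d) b1 \<omega>1" and K: "global_attractor H_pos (G_pos c d) K"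
  shows "s \<le> t \<Longrightarrow> coefficients.W (\<lambda>_. c) (\<lambda>_. d) s t \<in> K"
    and "y \<in> K \<Longrightarrow> e > 0 \<Longrightarrow> \<exists>s\<le>t. dist y (coefficients.W (\<lambda>_. c) (\<lambda>_. d) s t) \<le> e"
proof -
  interpret L: coefficients "\<lambda>_. c" "\<lambda>_. d" b1 \<omega>1 by (rule cf)
  have shift: "L.W (s + h) (t + h) = L.W s t" if "s \<le> t" for s t h
    by (rule L.W_shift[OF _ _ that]) simp_all
  show "L.W s t \<in> K" if st: "s \<le> t"
  proof (rule mem_of_semidist_tendsto)
    show "((\<lambda>t. semidist (\<Union>v\<in>{0}. G_pos c d t v) K) \<longlongrightarrow> 0) at_top"
      using K zero_H_pos unfolding global_attractor_def
      by (meson bounded_insert bounded_empty empty_subsetI insert_subset)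
    show "closed K" using K by (auto simp: global_attractor_def compact_imp_closed)
    show "\<forall>\<^sub>F r in at_top. L.W s t \<in> (\<Union>v\<in>{0}. G_pos c d r v)"
      using eventually_ge_at_top[of "t - s"]
    proof eventually_elim
      case (elim r)
      have "L.W (s + (r - t)) (t + (r - t)) \<in> U_pos (\<lambda>_. c) (\<lambda>_. d) (t + (r - t)) 0 0"
        by (rule L.W_in_U_pos) (use elim st in auto)
      then show ?case
        unfolding shift[OF st] by (simp add: G_pos_eq_U_pos)
    qed
  qed simp
  show "\<exists>s\<le>t. dist y (L.W s t) \<le> e" if y: "y \<in> K" and e: "e > 0"
  proof -
    have "bounded K" using K by (auto simp: global_attractor_def compact_imp_bounded)
    then obtain R where R: "R > 0" "\<And>v. v \<in> K \<Longrightarrow> norm v \<le> R"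
      unfolding bounded_pos by blast
    obtain N where N: "N \<ge> 0" "\<And>h. h \<ge> N \<Longrightarrow> exp (- L.decay * h) * R \<le> e"
      using L.exp_decay_le[OF e, of R] R by auto
    have "K \<subseteq> (\<Union>v\<in>K. G_pos c d N v)"
      using K N(1) by (auto simp: global_attractor_def)
    then obtain v where v: "v \<in> K" "y \<in> U_pos (\<lambda>_. c) (\<lambda>_. d) N 0 v"
      using y by (auto simp: G_pos_eq_U_pos)
    obtain s where s: "s \<in> {0..N}" "dist y (L.W s N) \<le> exp (- L.decay * (N - 0)) * norm v"
      using L.U_pos_near_W[OF N(1) v(2)] by blast
    have "exp (- L.decay * (N - 0)) * norm v \<le> exp (- L.decay * N) * R"
      using R(2)[OF v(1)] by (simp add: mult_left_mono)
    also have "\<dots> \<le> e" by (rule N(2)) simp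
    finally have "dist y (L.W s N) \<le> e" using s(2) by simp
    moreover have "L.W (s + (t - N)) (N + (t - N)) = L.W s N"
      using s(1) by (intro shift) simp
    ultimately show ?thesis
      using s(1) by (intro exI[of _ "s + (t - N)"]) simp
  qed
qed

theorem lemma46:
  fixes b \<omega> :: "real \<Rightarrow> real"
    and b0 b1 b_inf \<omega>0 \<omega>1 \<omega>_inf :: real
    and \<A> :: "real \<Rightarrow> L2 set"
    and \<A>_inf :: "L2 set"
  assumes "continuous_on UNIV b" and "continuous_on UNIV \<omega>"
    and "0 < b0" and "\<And>t. b0 \<le> b t \<and> b t \<le> b1"
    and "0 \<le> \<omega>0" and "\<And>t. \<omega>0 \<le> \<omega> t \<and> \<omega> t \<le> \<omega>1" and "\<omega>1 < pi\<^sup>2"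
    and "b_inf \<in> {b0..b1}" and "(b \<longlongrightarrow> b_inf) at_top"
    and "\<omega>_inf \<in> {\<omega>0..\<omega>1}" and "(\<omega> \<longlongrightarrow> \<omega>_inf) at_top"
    and "pullback_attractor H_pos (U_pos b \<omega>) \<A>"
    and "global_attractor H_pos (G_pos b_inf \<omega>_inf) \<A>_inf"
  shows "((\<lambda>t. Hausdorff_dist (\<A> t) \<A>_inf) \<longlongrightarrow> 0) at_top"
proof (rule ennreal_tendsto_0I)
  have E: "coefficients b \<omega> b1 \<omega>1"
  proof
    fix t
    show "0 < b t" "b t \<le> b1" "0 \<le> \<omega> t" "\<omega> t \<le> \<omega>1"
      using assms(3,5) assms(4,6)[of t] by auto
  qed (fact assms)+
  have L: "coefficients (\<lambda>_. b_inf) (\<lambda>_. \<omega>_inf) b1 \<omega>1"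
    by standard (use assms in auto)
  interpret E: coefficients b \<omega> b1 \<omega>1 by (rule E)
  interpret L: coefficients "\<lambda>_. b_inf" "\<lambda>_. \<omega>_inf" b1 \<omega>1 by (rule L)
  fix e :: real assume "e > 0"
  then have e: "e / 2 > 0" by simp
  have lim: "((\<lambda>t. b t - b_inf) \<longlongrightarrow> 0) at_top" "((\<lambda>t. \<omega> t - \<omega>_inf) \<longlongrightarrow> 0) at_top"
    using assms(9,11) by (simp_all add: LIM_zero_iff)
  \<comment> \<open>The threshold serves all \<open>s\<close> at once. The other half of
    \<open>e\<close> is reserved for the approximation of points of either attractor by the linear
    solutions.\<close>
  obtain T where T: "\<And>t s. t \<ge> T \<Longrightarrow> s \<le> t \<Longrightarrow> dist (E.W s t) (L.W s t) \<le> e / 2"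
    using W_compare[OF E L lim e] by blast
  show "\<forall>\<^sub>F t in at_top. Hausdorff_dist (\<A> t) \<A>_inf \<le> ennreal e"
    using eventually_ge_at_top[of T]
  proof eventually_elim
    case (elim t)
    have "semidist (\<A> t) \<A>_inf \<le> ennreal e"
    proof (rule semidist_le)
      fix y assume "y \<in> \<A> t"
      then have "y \<in> closure ((\<lambda>s. E.W s t) ` {..t})"
        using E.pullback_attractor_W(2)[OF assms(12)] by blast
      then obtain s where s: "s \<le> t" "dist (E.W s t) y < e / 2"
        using e unfolding closure_approachable by blast
      have "dist y (L.W s t) \<le> dist y (E.W s t) + dist (E.W s t) (L.W s t)"
        by (rule dist_triangle)
      also have "\<dots> \<le> e" using s T[OF elim s(1)] by (simp add: dist_commute)
      finally show "\<exists>x\<in>\<A>_inf. dist y x \<le> e"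
        using global_attractor_W(1)[OF L assms(13) s(1)] by blast
    qed
    moreover have "semidist \<A>_inf (\<A> t) \<le> ennreal e"
    proof (rule semidist_le)
      fix y assume "y \<in> \<A>_inf"
      then obtain s where s: "s \<le> t" "dist y (L.W s t) \<le> e / 2"
        using global_attractor_W(2)[OF L assms(13) _ e] by blast
      have "dist y (E.W s t) \<le> dist y (L.W s t) + dist (L.W s t) (E.W s t)"
        by (rule dist_triangle)
      also have "\<dots> \<le> e" using s T[OF elim s(1)] by (simp add: dist_commute)
      finally show "\<exists>x\<in>\<A> t. dist y x \<le> e"
        using E.pullback_attractor_W(1)[OF assms(12) s(1)] by blast
    qed
    ultimately show ?case by (simp add: Hausdorff_dist_def)
  qed
qed

end
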